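(* The min-cost perfect augmentation problem is NP-hard for strict preference lists of length at most 2.
   Context: Popular matchings: a preference instance is a bipartite graph $G=(\mathcal{A}\cup\mathcal{B},E)$ with $\mathcal{A}$ a set of people and $\mathcal{B}$ a set of items; each person ranks the items adjacent to her in order of preference; each item $b$ has a number $\mathsf{copies}(b)$ of copies. A matching $M$ assigns each person at most one acceptable item such that each item $b$ is assigned to at most $\mathsf{copies}(b)$ people; $M(a)$ is the item assigned to $a$. A person $a$ prefers $M$ to $M'$ if $a$ is matched in $M$ and unmatched in $M'$, or matched in both and prefers $M(a)$ to $M'(a)$. $M$ is more popular than $M'$ if more people prefer $M$ to $M'$ than prefer $M'$ to $M$; $M$ is popular if no matching is more popular than $M$. A perfect popular matching is a popular matching that matches every person. Min-cost perfect augmentation problem: the input is a preference instance $G=(\mathcal{A}\cup\mathcal{B},E)$ in which each item is available in one copy, together with a price $\mathsf{cost}(b)\ge 0$ for each item. Extra copies of any item $b$ can be added at price $\mathsf{cost}(b)$ per copy, without limit. The task is to choose numbers $k_b\ge 0$ of extra copies so that the resulting instance admits a perfect popular matching, minimizing $\sum_b k_b\,\mathsf{cost}(b)$. "Strict lists of length at most 2" means no ties and each person ranks at most 2 items. *)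

theory Defs
  imports Complex_Main "HOL-Computational_Algebra.Polynomial"
begin

section \<open>Multi-tape Turing machines and NP-hardness\<close>

text \<open>
  Tapes are infinite to the right, and a left move on cell 0 leaves the head in place.
  Symbol 0 is the blank, symbol 1 marks the left end of every tape in the initial configuration,
  and symbols 2 and 3 stand for the bits \<^term>\<open>False\<close> and \<^term>\<open>True\<close>. State 0 is the start state
  and state 1 the halting state. The first tape holds the input and the last tape the output.
\<close>

datatype move = Go_Left | Stay | Go_Right

record tm =
  tapes :: nat
  symbols :: nat
  states :: nat
  trans :: "nat \<Rightarrow> nat list \<Rightarrow> nat \<times> (nat \<times> move) list"

definition valid_tm :: "tm \<Rightarrow> bool" where
  "valid_tm M \<longleftrightarrow> tapes M \<ge> 1 \<and> symbols M \<ge> 4 \<and> states M \<ge> 2 \<and>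
     (\<forall>q<states M. \<forall>ss. length ss = tapes M \<and> set ss \<subseteq> {..<symbols M} \<longrightarrow>
        fst (trans M q ss) < states M \<and>
        length (snd (trans M q ss)) = tapes M \<and>
        fst ` set (snd (trans M q ss)) \<subseteq> {..<symbols M})"

type_synonym tape = "(nat \<Rightarrow> nat) \<times> nat"

type_synonym config = "nat \<times> tape list"

fun move_head :: "move \<Rightarrow> nat \<Rightarrow> nat" where
  "move_head Go_Left h = h - 1"
| "move_head Stay h = h"
| "move_head Go_Right h = h + 1"

definition tape_read :: "tape \<Rightarrow> nat" where
  "tape_read t = fst t (snd t)"

definition tape_act :: "nat \<times> move \<Rightarrow> tape \<Rightarrow> tape" where
  "tape_act a t = ((fst t)(snd t := fst a), move_head (snd a) (snd t))"

definition tm_step :: "tm \<Rightarrow> config \<Rightarrow> config" where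
  "tm_step M c =
     (if fst c = 1 then c
      else let r = trans M (fst c) (map tape_read (snd c))
           in (fst r, map2 tape_act (snd r) (snd c)))"

definition tape_content :: "bool list \<Rightarrow> nat \<Rightarrow> nat" where
  "tape_content x i =
     (if i = 0 then 1 else if i \<le> length x then (if x ! (i - 1) then 3 else 2) else 0)"

definition tm_init :: "tm \<Rightarrow> bool list \<Rightarrow> config" where
  "tm_init M x = (0, (tape_content x, 0) # replicate (tapes M - 1) (tape_content [], 0))"

text \<open>A halted configuration does not change, so halting after exactly \<open>T n\<close> steps means halting
  within \<open>T n\<close> steps.\<close>

definition computes_in_time :: "tm \<Rightarrow> (bool list \<Rightarrow> bool list) \<Rightarrow> (nat \<Rightarrow> nat) \<Rightarrow> bool" where
  "computes_in_time M f T \<longleftrightarrow>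
     (\<forall>x. let c = (tm_step M ^^ T (length x)) (tm_init M x)
          in fst c = 1 \<and> fst (last (snd c)) = tape_content (f x))"

definition polytime :: "(bool list \<Rightarrow> bool list) \<Rightarrow> bool" where
  "polytime f \<longleftrightarrow> (\<exists>M (p :: nat poly). valid_tm M \<and> computes_in_time M f (poly p))"

text \<open>All encoders produce self-delimiting bit strings, so they can be concatenated.\<close>

definition enc_list :: "('a \<Rightarrow> bool list) \<Rightarrow> 'a list \<Rightarrow> bool list" where
  "enc_list e xs = concat (map (\<lambda>x. True # e x) xs) @ [False]"

definition pair_string :: "bool list \<Rightarrow> bool list \<Rightarrow> bool list" where
  "pair_string x u = enc_list (\<lambda>b. [b]) x @ u"

definition NP :: "bool list set set" where
  "NP = {L. \<exists>v (p :: nat poly). polytime v \<and>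
     (\<forall>x. x \<in> L \<longleftrightarrow> (\<exists>u. length u \<le> poly p (length x) \<and> v (pair_string x u) = [True]))}"

definition poly_reducible :: "bool list set \<Rightarrow> bool list set \<Rightarrow> bool" where
  "poly_reducible L L' \<longleftrightarrow> (\<exists>f. polytime f \<and> (\<forall>x. x \<in> L \<longleftrightarrow> f x \<in> L'))"

definition NP_hard :: "bool list set \<Rightarrow> bool" where
  "NP_hard L \<longleftrightarrow> (\<forall>L'\<in>NP. poly_reducible L' L)"


section \<open>Popular matchings\<close>

text \<open>A smaller rank means more preferred; equal ranks are ties. Ranks matter only on edges.\<close>

record ('a, 'b) pref_instance =
  people :: "'a set"
  items :: "'b set"
  edges :: "('a \<times> 'b) set"
  rank :: "'a \<Rightarrow> 'b \<Rightarrow> nat"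

definition pref_instance :: "('a, 'b) pref_instance \<Rightarrow> bool" where
  "pref_instance G \<longleftrightarrow> finite (people G) \<and> finite (items G) \<and> edges G \<subseteq> people G \<times> items G"

definition acceptable :: "('a, 'b) pref_instance \<Rightarrow> 'a \<Rightarrow> 'b set" where
  "acceptable G a = {b. (a, b) \<in> edges G}"

definition strict_prefs :: "('a, 'b) pref_instance \<Rightarrow> bool" where
  "strict_prefs G \<longleftrightarrow> (\<forall>a\<in>people G. inj_on (rank G a) (acceptable G a))"

definition matching ::
    "('a, 'b) pref_instance \<Rightarrow> ('b \<Rightarrow> nat) \<Rightarrow> ('a \<Rightarrow> 'b option) \<Rightarrow> bool" where
  "matching G copies M \<longleftrightarrow>
     dom M \<subseteq> people G \<and>
     (\<forall>a b. M a = Some b \<longrightarrow> (a, b) \<in> edges G) \<and>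
     (\<forall>b\<in>items G. card {a \<in> people G. M a = Some b} \<le> copies b)"

definition prefers ::
    "('a, 'b) pref_instance \<Rightarrow> 'a \<Rightarrow> ('a \<Rightarrow> 'b option) \<Rightarrow> ('a \<Rightarrow> 'b option) \<Rightarrow> bool" where
  "prefers G a M M' \<longleftrightarrow>
     (M a \<noteq> None \<and> M' a = None) \<or>
     (\<exists>b b'. M a = Some b \<and> M' a = Some b' \<and> rank G a b < rank G a b')"

definition more_popular ::
    "('a, 'b) pref_instance \<Rightarrow> ('a \<Rightarrow> 'b option) \<Rightarrow> ('a \<Rightarrow> 'b option) \<Rightarrow> bool" where
  "more_popular G M M' \<longleftrightarrow>
     card {a \<in> people G. prefers G a M M'} > card {a \<in> people G. prefers G a M' M}"

definition popular ::
    "('a, 'b) pref_instance \<Rightarrow> ('b \<Rightarrow> nat) \<Rightarrow> ('a \<Rightarrow> 'b option) \<Rightarrow> bool" where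
  "popular G copies M \<longleftrightarrow>
     matching G copies M \<and> \<not> (\<exists>M'. matching G copies M' \<and> more_popular G M' M)"

definition perfect :: "('a, 'b) pref_instance \<Rightarrow> ('a \<Rightarrow> 'b option) \<Rightarrow> bool" where
  "perfect G M \<longleftrightarrow> (\<forall>a\<in>people G. M a \<noteq> None)"

text \<open>Here \<open>k b\<close> is the number of extra copies of \<open>b\<close>, on top of the one copy in the input.\<close>

definition perfect_augmentation :: "('a, 'b) pref_instance \<Rightarrow> ('b \<Rightarrow> nat) \<Rightarrow> bool" where
  "perfect_augmentation G k \<longleftrightarrow> (\<exists>M. popular G (\<lambda>b. 1 + k b) M \<and> perfect G M)"

definition augmentation_cost ::
    "('a, 'b) pref_instance \<Rightarrow> ('b \<Rightarrow> rat) \<Rightarrow> ('b \<Rightarrow> nat) \<Rightarrow> rat" where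
  "augmentation_cost G cost k = (\<Sum>b\<in>items G. of_nat (k b) * cost b)"


section \<open>The min-cost perfect augmentation problem as a language\<close>

text \<open>The people are the indices of \<open>pref_lists\<close> and the items are the indices of \<open>prices\<close>.
  Entry \<open>a\<close> of \<open>pref_lists\<close> lists the items acceptable to \<open>a\<close> together with their ranks.\<close>

record aug_input =
  pref_lists :: "(nat \<times> nat) list list"
  prices :: "rat list"

definition valid_input :: "aug_input \<Rightarrow> bool" where
  "valid_input I \<longleftrightarrow>
     (\<forall>l\<in>set (pref_lists I).
        distinct (map fst l) \<and> fst ` set l \<subseteq> {..<length (prices I)}) \<and>
     (\<forall>c\<in>set (prices I). c \<ge> 0)"

definition graph_of :: "aug_input \<Rightarrow> (nat, nat) pref_instance" where
  "graph_of I =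
     \<lparr>people = {..<length (pref_lists I)},
      items = {..<length (prices I)},
      edges = {(a, b). a < length (pref_lists I) \<and> b \<in> fst ` set (pref_lists I ! a)},
      rank = (\<lambda>a b. the (map_of (pref_lists I ! a) b))\<rparr>"

definition cost_of :: "aug_input \<Rightarrow> nat \<Rightarrow> rat" where
  "cost_of I b = prices I ! b"

lemma pref_instance_graph_of: "valid_input I \<Longrightarrow> pref_instance (graph_of I)"
  unfolding valid_input_def pref_instance_def graph_of_def using nth_mem by fastforce

text \<open>The decision version: a pair \<open>(I, \<beta>)\<close> is a yes-instance iff the minimum cost of a perfect
  augmentation of \<open>I\<close> is at most \<open>\<beta>\<close>.\<close>

definition min_cost_perfect_augmentation :: "(aug_input \<times> rat) set" where
  "min_cost_perfect_augmentation =
     {(I, \<beta>). valid_input I \<and> \<beta> \<ge> 0 \<and>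
        (\<exists>k. perfect_augmentation (graph_of I) k \<and>
             augmentation_cost (graph_of I) (cost_of I) k \<le> \<beta>)}"

text \<open>Numbers are written in binary, least significant bit first; a nonnegative rational is
  written as its reduced numerator and denominator.\<close>

fun nat_bits :: "nat \<Rightarrow> bool list" where
  "nat_bits n = (if n = 0 then [] else odd n # nat_bits (n div 2))"

declare nat_bits.simps [simp del]

definition enc_nat :: "nat \<Rightarrow> bool list" where
  "enc_nat n = enc_list (\<lambda>b. [b]) (nat_bits n)"

definition enc_rat :: "rat \<Rightarrow> bool list" where
  "enc_rat r = enc_nat (nat (fst (quotient_of r))) @ enc_nat (nat (snd (quotient_of r)))"

definition encode :: "aug_input \<times> rat \<Rightarrow> bool list" where
  "encode p =
     enc_list (enc_list (\<lambda>e. enc_nat (fst e) @ enc_nat (snd e))) (pref_lists (fst p)) @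
     enc_list enc_rat (prices (fst p)) @
     enc_rat (snd p)"

lemma enc_list_cancel:
  assumes "\<And>x y r s. x \<in> S \<Longrightarrow> y \<in> S \<Longrightarrow> e x @ r = e y @ s \<Longrightarrow> x = y \<and> r = s"
    and "set xs \<subseteq> S" "set ys \<subseteq> S" "enc_list e xs @ r = enc_list e ys @ s"
  shows "xs = ys \<and> r = s"
  using assms(2-4)
proof (induction xs arbitrary: ys)
  case Nil
  then show ?case by (cases ys) (auto simp: enc_list_def)
next
  case (Cons x xs)
  then obtain y ys' where ys: "ys = y # ys'"
    by (cases ys) (auto simp: enc_list_def)
  with Cons.prems have "e x @ (enc_list e xs @ r) = e y @ (enc_list e ys' @ s)"
    by (simp add: enc_list_def)
  with assms(1) Cons.prems ys have "x = y" "enc_list e xs @ r = enc_list e ys' @ s"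
    by (meson list.set_intros(1) subsetD)+
  with Cons.IH[of ys'] Cons.prems ys show ?case by simp
qed

lemma nat_bits_inject: "nat_bits m = nat_bits n \<Longrightarrow> m = n"
proof (induction m arbitrary: n rule: less_induct)
  case (less m)
  show ?case
  proof (cases "m = 0 \<or> n = 0")
    case True
    with less.prems show ?thesis
      by (metis list.distinct(1) nat_bits.simps)
  next
    case False
    with less.prems have "odd m = odd n" "nat_bits (m div 2) = nat_bits (n div 2)"
      by (simp_all add: nat_bits.simps[of m] nat_bits.simps[of n])
    moreover from this less.IH[of "m div 2" "n div 2"] False have "m div 2 = n div 2" by simp
    ultimately show ?thesis by presburger
  qed
qed

lemma enc_nat_cancel: "enc_nat m @ r = enc_nat n @ s \<Longrightarrow> m = n \<and> r = s"
  using enc_list_cancel[of UNIV "\<lambda>b. [b]" "nat_bits m" "nat_bits n" r s] nat_bits_inject[of m n]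
  by (simp add: enc_nat_def)

lemma enc_rat_cancel:
  assumes "a \<ge> 0" "b \<ge> 0" "enc_rat a @ r = enc_rat b @ s"
  shows "a = b \<and> r = s"
proof -
  have eq: "nat (fst (quotient_of a)) = nat (fst (quotient_of b))"
    "nat (snd (quotient_of a)) = nat (snd (quotient_of b))" "r = s"
    using assms(3) enc_nat_cancel unfolding enc_rat_def append_assoc by blast+
  have num: "fst (quotient_of c) \<ge> 0" if "c \<ge> 0" for c
  proof (rule ccontr)
    assume "\<not> fst (quotient_of c) \<ge> 0"
    then have "rat_of_int (fst (quotient_of c)) / rat_of_int (snd (quotient_of c)) < 0"
      using quotient_of_denom_pos'[of c] by (simp add: divide_neg_pos)
    moreover have "c = rat_of_int (fst (quotient_of c)) / rat_of_int (snd (quotient_of c))"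
      by (rule quotient_of_div) simp
    ultimately show False using that by linarith
  qed
  have "fst (quotient_of a) = fst (quotient_of b)"
    using eq(1) num[OF assms(1)] num[OF assms(2)] by linarith
  moreover have "snd (quotient_of a) = snd (quotient_of b)"
    using eq(2) quotient_of_denom_pos'[of a] quotient_of_denom_pos'[of b] by linarith
  ultimately have "a = b"
    using prod_eqI quotient_of_inject by blast
  with eq(3) show ?thesis by blast
qed

lemma inj_on_encode: "inj_on encode {(I, \<beta>). valid_input I \<and> \<beta> \<ge> 0}"
proof (rule inj_onI)
  fix p q
  assume "p \<in> {(I, \<beta>). valid_input I \<and> \<beta> \<ge> 0}" "q \<in> {(I, \<beta>). valid_input I \<and> \<beta> \<ge> 0}"
    and enc: "encode p = encode q"
  then obtain I \<beta> J \<gamma> where pq: "p = (I, \<beta>)" "q = (J, \<gamma>)"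
    and v: "valid_input I" "valid_input J" "\<beta> \<ge> 0" "\<gamma> \<ge> 0" by auto
  let ?e = "\<lambda>e :: nat \<times> nat. enc_nat (fst e) @ enc_nat (snd e)"
  have c1: "x = y \<and> r = s" if "?e x @ r = ?e y @ s" for x y r s
    using that enc_nat_cancel unfolding append_assoc by (metis prod.expand)
  have c2: "x = y \<and> r = s" if "enc_list ?e x @ r = enc_list ?e y @ s" for x y r s
    using enc_list_cancel[of UNIV ?e] c1 that by blast
  have c3: "xs = ys \<and> r = s"
    if "enc_list (enc_list ?e) xs @ r = enc_list (enc_list ?e) ys @ s" for xs ys r s
    using enc_list_cancel[of UNIV "enc_list ?e"] c2 that by blast
  have c4: "xs = ys \<and> r = s"
    if "enc_list enc_rat xs @ r = enc_list enc_rat ys @ s" "set xs \<subseteq> {0..}" "set ys \<subseteq> {0..}"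
    for xs ys r s
    using enc_list_cancel[of "{0..}" enc_rat] enc_rat_cancel that by (metis atLeast_iff)
  have p: "set (prices I) \<subseteq> {0..}" "set (prices J) \<subseteq> {0..}"
    using v by (auto simp: valid_input_def)
  have "pref_lists I = pref_lists J \<and>
      enc_list enc_rat (prices I) @ enc_rat \<beta> = enc_list enc_rat (prices J) @ enc_rat \<gamma>"
    using c3 enc by (simp add: encode_def pq)
  with c4[OF _ p] have "pref_lists I = pref_lists J" "prices I = prices J" "enc_rat \<beta> = enc_rat \<gamma>"
    by blast+
  with enc_rat_cancel[of \<beta> \<gamma> "[]" "[]"] v pq show "p = q" by simp
qed

end

(*
  An item b that is the first choice of d(b) people costs d(b) - 1 extra copies, unless some of
  these people are pushed to their second choices, where they need copies instead. In a popular
  matching an item that pushes people away is held by its first-choosers only, so no item can both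
  push and receive. Let a vertex be an item of price 1 with two people who may be pushed to an item
  free of charge, and an edge an item of price 2 with two people who may be pushed to the two
  endpoints. Every unit saved at a vertex means that the vertex pushes, every unit saved at an edge
  that an endpoint receives; so the cheapest augmentations are given by the maximum independent sets.

  An accepting computation of a multi-tape machine is a tiling of a polynomial grid by tiles from a
  fixed finite set with local constraints, hence an independent set with one vertex per cell in the
  graph whose vertices are pairs of a cell and a tile. Numbering items by the binary digits of the
  tile followed by those of the cell, this instance is written down by nested loops over strings and
  binary counters that are only ever appended to or incremented; such loop programs run on
  a Turing machine with one tape per variable in time polynomial in the final lengths of the variables.
*)

theory Submission
  imports Defs
begin

section \<open>A register language compiled to Turing machines\<close>

text \<open>Polynomial time refers to a concrete machine model and hardness to every language in NP,
  so the reduction starts from the machine of an arbitrary verifier and its output is kept uniform: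
  tiles, rules and slot numbers are constants of the program text, and at run time only positions,
  prices and the budget vary. Registers never shrink, so polynomial bounds on their final lengths
  already give a polynomial running time, by recursion over the program. The price 2 of an edge
  comes from a repair step. An edge that pushes nobody costs 2, one unit more than the copy needed
  for a person it pushes, and this unit pays for removing one of its endpoints from the set of
  pushing vertices. Thus every augmentation, not only a well-behaved one, yields an independent set
  of the right size. The tiles of one cell exclude each other, so the number of cells is the largest
  conceivable size of an independent set. Asking for exactly this size makes the budget a sum over
  the cells.\<close>

datatype cmd = Skip | App nat bool | Inc nat | Seq cmd cmd | For nat cmd cmd

type_synonym regs = "nat \<Rightarrow> bool list"

fun inc_bits :: "bool list \<Rightarrow> bool list" where
  "inc_bits [] = [True]"
| "inc_bits (False # bs) = True # bs"
| "inc_bits (True # bs) = False # inc_bits bs"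

primrec exec :: "cmd \<Rightarrow> regs \<Rightarrow> regs" where
  "exec Skip = (\<lambda>s. s)"
| "exec (App r b) = (\<lambda>s. s(r := s r @ [b]))"
| "exec (Inc r) = (\<lambda>s. s(r := inc_bits (s r)))"
| "exec (Seq c d) = (\<lambda>s. exec d (exec c s))"
| "exec (For r c d) = (\<lambda>s. foldl (\<lambda>s b. (if b then exec d else exec c) s) s (s r))"

primrec regs_of :: "cmd \<Rightarrow> nat set" where
  "regs_of Skip = {}"
| "regs_of (App r b) = {r}"
| "regs_of (Inc r) = {r}"
| "regs_of (Seq c d) = regs_of c \<union> regs_of d"
| "regs_of (For r c d) = insert r (regs_of c \<union> regs_of d)"

text \<open>The compiled loop keeps its place by the head on tape \<open>r\<close>, so the body must
  not touch that register at all, not even read it.\<close>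

primrec wf_cmd :: "cmd \<Rightarrow> bool" where
  "wf_cmd Skip \<longleftrightarrow> True"
| "wf_cmd (App r b) \<longleftrightarrow> True"
| "wf_cmd (Inc r) \<longleftrightarrow> True"
| "wf_cmd (Seq c d) \<longleftrightarrow> wf_cmd c \<and> wf_cmd d"
| "wf_cmd (For r c d) \<longleftrightarrow> wf_cmd c \<and> wf_cmd d \<and> r \<notin> regs_of c \<and> r \<notin> regs_of d"

primrec writes :: "cmd \<Rightarrow> nat set" where
  "writes Skip = {}"
| "writes (App r b) = {r}"
| "writes (Inc r) = {r}"
| "writes (Seq c d) = writes c \<union> writes d"
| "writes (For r c d) = writes c \<union> writes d"

lemma exec_unchanged: "r \<notin> writes c \<Longrightarrow> exec c s r = s r"
proof (induction c arbitrary: s)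
  case (For q c d)
  have "foldl (\<lambda>s b. (if b then exec d else exec c) s) s bs r = s r" for bs s
    using For by (induction bs arbitrary: s) auto
  then show ?case by simp
qed auto

lemma writes_subset: "writes c \<subseteq> regs_of c"
  by (induction c) auto

lemma length_inc_bits: "length bs \<le> length (inc_bits bs)" "length (inc_bits bs) \<le> Suc (length bs)"
  by (induction bs rule: inc_bits.induct) auto

text \<open>Because of this, lengths after the last command bound all lengths on the way, and the
  time analysis needs no separate space bound.\<close>

lemma length_exec_mono: "length (s r) \<le> length (exec c s r)"
proof (induction c arbitrary: s)
  case (Seq c d)
  then show ?case by (metis exec.simps(4) order_trans)
next
  case (For q c d)
  have "length (s r) \<le> length (foldl (\<lambda>s b. (if b then exec d else exec c) s) s bs r)" for bs s
  proof (induction bs arbitrary: s)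
    case (Cons b bs)
    show ?case
      using Cons[of "(if b then exec d else exec c) s"] For(1,2)[of s]
      by (auto intro: order_trans split: if_splits)
  qed simp
  then show ?case by simp
qed (auto simp: length_inc_bits)

section \<open>Compilation into code for a Turing machine\<close>

type_synonym instr = "nat \<times> (nat \<Rightarrow> nat \<times> move \<times> nat)"

text \<open>Symbol 1 stands only in cell 0. Returning there restores the convention that a command
  finds the heads of its tapes at cell 0.\<close>

definition rewind :: "nat \<Rightarrow> nat \<Rightarrow> instr" where
  "rewind r l = (r, \<lambda>x. if x = 1 then (x, Stay, l + 1) else (x, Go_Left, l))"

primrec comp_size :: "cmd \<Rightarrow> nat" where
  "comp_size Skip = 0"
| "comp_size (App r b) = 2"
| "comp_size (Inc r) = 2"
| "comp_size (Seq c d) = comp_size c + comp_size d"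
| "comp_size (For r c d) = comp_size c + comp_size d + 5"

text \<open>In a loop, state \<open>l\<close> moves off the marker or off the bit just served,
  \<open>l + 1\<close> branches on the symbol then read, each body ends in a jump back to
  \<open>l\<close>, and a blank leads to the rewind. In \<open>Inc\<close> the case of symbol 3 is
  the carry; the last case covers both a bit \<open>False\<close> and the blank behind the last bit,
  as in \<open>inc_bits []\<close>.\<close>

primrec comp :: "cmd \<Rightarrow> nat \<Rightarrow> instr list" where
  "comp Skip = (\<lambda>l. [])"
| "comp (App r b) = (\<lambda>l.
     [(r, \<lambda>x. if x = 0 then (if b then 3 else 2, Stay, l + 1) else (x, Go_Right, l)),
      rewind r (l + 1)])"
| "comp (Inc r) = (\<lambda>l.
     [(r, \<lambda>x. if x = 1 then (1, Go_Right, l) else if x = 3 then (2, Go_Right, l)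
              else (3, Stay, l + 1)),
      rewind r (l + 1)])"
| "comp (Seq c d) = (\<lambda>l. comp c l @ comp d (l + comp_size c))"
| "comp (For r c d) = (\<lambda>l.
     [(r, \<lambda>x. (x, Go_Right, l + 1)),
      (r, \<lambda>x. (x, Stay, if x = 2 then l + 2 else if x = 3 then l + 3 + comp_size c
                       else l + 4 + comp_size c + comp_size d))] @
     comp c (l + 2) @ [(r, \<lambda>x. (x, Stay, l))] @
     comp d (l + 3 + comp_size c) @ [(r, \<lambda>x. (x, Stay, l))] @
     [rewind r (l + 4 + comp_size c + comp_size d)])"

lemma length_comp [simp]: "length (comp c l) = comp_size c"
  by (induction c arbitrary: l) auto

text \<open>Out-of-range targets and symbols are clipped, so that the machine is valid for any code.\<close>

definition tm_of :: "nat \<Rightarrow> instr list \<Rightarrow> tm" where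
  "tm_of k code = \<lparr>tapes = k, symbols = 4, states = length code,
     trans = (\<lambda>q ss. case code ! q of (r, f) \<Rightarrow> case f (ss ! r) of (w, m, n) \<Rightarrow>
       (if n < length code then n else 0,
        (map (\<lambda>x. (x, Stay)) ss)[r := (if w < 4 then w else 0, m)]))\<rparr>"

lemma valid_tm_of:
  assumes "k \<ge> 1" "length code \<ge> 2"
  shows "valid_tm (tm_of k code)"
proof -
  have 1: "fst (trans (tm_of k code) q ss) < length code" for q ss
    using assms by (auto simp: tm_of_def split: prod.splits)
  have 2: "length (snd (trans (tm_of k code) q ss)) = length ss" for q ss
    by (auto simp: tm_of_def split: prod.splits)
  have 3: "fst ` set (snd (trans (tm_of k code) q ss)) \<subseteq> {..<4}" if "set ss \<subseteq> {..<4}" for q ss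
  proof -
    obtain r f where rf: "code ! q = (r, f)" by force
    obtain w m n where wmn: "f (ss ! r) = (w, m, n)" by (metis prod_cases3)
    have "set (snd (trans (tm_of k code) q ss)) \<subseteq>
        insert (if w < 4 then w else 0, m) ((\<lambda>x. (x, Stay)) ` set ss)"
      using set_update_subset_insert[of "map (\<lambda>x. (x, Stay)) ss" r "(if w < 4 then w else 0, m)"]
      by (simp add: tm_of_def rf wmn)
    then have "fst ` set (snd (trans (tm_of k code) q ss)) \<subseteq>
        insert (if w < 4 then w else 0) (set ss)"
      by (force split: if_splits)
    then show ?thesis using that by (auto split: if_splits)
  qed
  show ?thesis
    unfolding valid_tm_def using assms 1 2 3 by (simp add: tm_of_def)
qed

section \<open>Runs of compiled code\<close>

definition conf :: "nat \<Rightarrow> (nat \<Rightarrow> nat \<Rightarrow> nat) \<Rightarrow> (nat \<Rightarrow> nat) \<Rightarrow> tape list" where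
  "conf k F h = map (\<lambda>j. (F j, h j)) [0..<k]"

definition reach :: "tm \<Rightarrow> config \<Rightarrow> nat \<Rightarrow> config \<Rightarrow> bool" where
  "reach M c t c' \<longleftrightarrow> (\<exists>t'\<le>t. (tm_step M ^^ t') c = c')"

lemma reach_refl: "reach M c t c"
  by (auto simp: reach_def intro!: exI[of _ 0])

lemma reach_trans: "reach M c t c' \<Longrightarrow> reach M c' u c'' \<Longrightarrow> reach M c (t + u) c''"
proof -
  assume "reach M c t c'" "reach M c' u c''"
  then obtain t' u' where "t' \<le> t" "(tm_step M ^^ t') c = c'" "u' \<le> u" "(tm_step M ^^ u') c' = c''"
    by (auto simp: reach_def)
  then show ?thesis
    unfolding reach_def by (intro exI[of _ "u' + t'"]) (auto simp: funpow_add)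
qed

lemma reach_mono: "reach M c t c' \<Longrightarrow> t \<le> u \<Longrightarrow> reach M c u c'"
  unfolding reach_def using order_trans by blast

lemma reach_step:
  assumes "tm_step M c = c'" "reach M c' t c''"
  shows "reach M c (Suc t) c''"
proof -
  have "reach M c 1 c'"
    using assms(1) unfolding reach_def by (intro exI[of _ 1]) simp
  from reach_trans[OF this assms(2)] show ?thesis by simp
qed

lemma tm_step_tm_of:
  assumes "q < length code" "q \<noteq> 1" "code ! q = (r, f)" "r < k"
    "f (F r (h r)) = (w, m, n)" "w < 4" "n < length code"
  shows "tm_step (tm_of k code) (q, conf k F h) =
    (n, conf k (F(r := (F r)(h r := w))) (h(r := move_head m (h r))))"
proof -
  have ss: "map tape_read (conf k F h) = map (\<lambda>j. F j (h j)) [0..<k]"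
    by (simp add: conf_def tape_read_def)
  have "map2 tape_act ((map (\<lambda>x. (x, Stay)) (map (\<lambda>j. F j (h j)) [0..<k]))[r := (w, m)]) (conf k F h) =
     conf k (F(r := (F r)(h r := w))) (h(r := move_head m (h r)))"
    using assms(4)
    by (intro nth_equalityI) (auto simp: conf_def tape_act_def nth_list_update)
  then show ?thesis
    using assms by (simp add: tm_step_def ss tm_of_def)
qed

text \<open>The successor enters through equations, so the rule applies to a target of any syntactic
  shape and leaves only identities between function updates.\<close>

lemma tm_step_at:
  assumes "code ! q = (r, f)" "q < length code" "q \<noteq> 1" "r < k"
    "fst (f (F r (h r))) < 4" "n < length code" "n = snd (snd (f (F r (h r))))"
    "F' = F(r := (F r)(h r := fst (f (F r (h r)))))"
    "h' = h(r := move_head (fst (snd (f (F r (h r))))) (h r))"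
  shows "tm_step (tm_of k code) (q, conf k F h) = (n, conf k F' h')"
  using tm_step_tm_of[where f = f] assms by (metis prod.collapse)

lemma reach_rewind:
  assumes "code ! l = rewind r l" "l \<noteq> 1" "l + 1 < length code" "r < k"
    "F r 0 = 1" "\<And>i. i > 0 \<Longrightarrow> F r i \<noteq> 1" "\<And>i. F r i < 4"
  shows "reach (tm_of k code) (l, conf k F h) (h r + 1) (l + 1, conf k F (h(r := 0)))"
proof (induction "h r" arbitrary: h)
  case 0
  have "tm_step (tm_of k code) (l, conf k F h) = (l + 1, conf k F (h(r := 0)))"
    by (rule tm_step_at[OF assms(1)[unfolded rewind_def]]) (use assms 0 in \<open>auto simp: fun_upd_idem\<close>)
  from reach_step[OF this reach_refl[of _ _ 0]] 0 show ?case by (simp del: fun_upd_apply)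
next
  case (Suc i)
  have "tm_step (tm_of k code) (l, conf k F h) = (l, conf k F (h(r := i)))"
    by (rule tm_step_at[OF assms(1)[unfolded rewind_def]]) (use assms Suc(2)[symmetric] in \<open>auto simp: fun_upd_idem\<close>)
  from reach_step[OF this Suc(1)[of "h(r := i)"]] Suc(2)[symmetric] show ?case by simp
qed

abbreviation content :: "regs \<Rightarrow> nat \<Rightarrow> nat \<Rightarrow> nat" where
  "content s \<equiv> \<lambda>j. tape_content (s j)"

lemma content_upd: "content (s(r := v)) = (content s)(r := tape_content v)"
  by auto

lemma tape_content_simps [simp]:
  "tape_content x 0 = 1" "i > 0 \<Longrightarrow> tape_content x i \<noteq> Suc 0" "tape_content x i < 4"
  "tape_content (x @ b # y) (Suc (length x)) = (if b then 3 else 2)"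
  "tape_content x (Suc (length x)) = 0"
  by (auto simp: tape_content_def nth_append)

lemma tape_content_neq_0: "i \<le> length x \<Longrightarrow> tape_content x i \<noteq> 0"
  by (auto simp: tape_content_def)

lemma tape_content_upd:
  "(tape_content (x @ b # y))(Suc (length x) := if c then 3 else 2) = tape_content (x @ c # y)"
  "(tape_content x)(Suc (length x) := if c then 3 else 2) = tape_content (x @ [c])"
  by (auto simp: tape_content_def nth_append nth_Cons' fun_eq_iff)

lemmas tape_content_write = tape_content_upd[where c=True, simplified]
  tape_content_upd[where c=False, simplified]

definition code_at :: "instr list \<Rightarrow> nat \<Rightarrow> instr list \<Rightarrow> bool" where
  "code_at code l is \<longleftrightarrow> l + length is \<le> length code \<and> (\<forall>i<length is. code ! (l + i) = is ! i)"

lemma code_at_append: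
  "code_at code l (xs @ ys) \<longleftrightarrow> code_at code l xs \<and> code_at code (l + length xs) ys" (is "?l = ?r")
proof -
  have "(\<forall>i<length (xs @ ys). code ! (l + i) = (xs @ ys) ! i) \<longleftrightarrow>
    (\<forall>i<length xs. code ! (l + i) = xs ! i) \<and> (\<forall>i<length ys. code ! (l + length xs + i) = ys ! i)"
    (is "?A = (?B \<and> ?C)")
  proof
    assume A: ?A
    have "code ! (l + length xs + i) = ys ! i" if "i < length ys" for i
      using A[rule_format, of "length xs + i"] that by (simp add: add.assoc)
    moreover have "code ! (l + i) = xs ! i" if "i < length xs" for i
      using A[rule_format, of i] that by (simp add: nth_append)
    ultimately show "?B \<and> ?C" by simp
  next
    assume BC: "?B \<and> ?C"
    show ?A
    proof (intro allI impI)
      fix i assume "i < length (xs @ ys)"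
      then show "code ! (l + i) = (xs @ ys) ! i"
        using BC by (cases "i < length xs") (auto simp: nth_append dest!: spec[of _ "i - length xs"])
    qed
  qed
  then show ?thesis by (auto simp: code_at_def)
qed

lemma code_at_Cons:
  "code_at code l (x # xs) \<longleftrightarrow> l < length code \<and> code ! l = x \<and> code_at code (Suc l) xs"
  using code_at_append[of code l "[x]" xs] by (auto simp: code_at_def)

lemma code_at_Nil: "code_at code l [] \<longleftrightarrow> l \<le> length code"
  by (simp add: code_at_def)

text \<open>\<open>B\<close> bounds the final lengths of all registers. The 3 in a loop pays for
  move, branch and jump back; adding the costs of both bodies avoids a maximum. The trailing
  \<open>B + 4\<close> is the last probe, of two steps, and the rewind.\<close>

primrec time_bound :: "cmd \<Rightarrow> nat \<Rightarrow> nat" where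
  "time_bound Skip B = 0"
| "time_bound (App r b) B = 2 * B + 4"
| "time_bound (Inc r) B = 2 * B + 4"
| "time_bound (Seq c d) B = time_bound c B + time_bound d B"
| "time_bound (For r c d) B = B * (3 + time_bound c B + time_bound d B) + B + 4"

lemma reach_App:
  assumes "code_at code l (comp (App r b) l)" "l \<ge> 2" "l + 2 < length code" "r < k" "h r = 0"
  shows "reach (tm_of k code) (l, conf k (content s) h) (2 * length (s r) + 4)
    (l + 2, conf k (content (s(r := s r @ [b]))) h)"
proof -
  let ?M = "tm_of k code"
  have c: "code ! l = (r, \<lambda>x. if x = 0 then (if b then 3 else 2, Stay, l + 1) else (x, Go_Right, l))"
    "code ! (l + 1) = rewind r (l + 1)"
    using assms(1) by (auto simp: code_at_Cons)
  have scan: "reach ?M (l, conf k (content s) (h(r := i))) (length (s r) + 1 - i)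
      (l, conf k (content s) (h(r := length (s r) + 1)))" if "i \<le> length (s r) + 1" for i
    using that
  proof (induction rule: inc_induct)
    case base
    then show ?case by (simp add: reach_refl)
  next
    case (step n)
    have "tm_step ?M (l, conf k (content s) (h(r := n))) = (l, conf k (content s) (h(r := Suc n)))"
      by (rule tm_step_at[OF c(1)]) (use assms step tape_content_neq_0[of n "s r"] in \<open>auto simp: fun_upd_idem\<close>)
    from reach_step[OF this step.IH] step(2) show ?case
      by (simp add: Suc_diff_le del: fun_upd_apply)
  qed
  let ?s = "s(r := s r @ [b])"
  have w: "tm_step ?M (l, conf k (content s) (h(r := length (s r) + 1))) =
      (l + 1, conf k (content ?s) (h(r := length (s r) + 1)))"
    by (rule tm_step_at[OF c(1)])
       (use assms in \<open>auto simp: content_upd tape_content_upd tape_content_write\<close>)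
  have r: "reach ?M (l + 1, conf k (content ?s) (h(r := length (s r) + 1)))
      (length (s r) + 2) (l + 2, conf k (content ?s) h)"
    using reach_rewind[of code "l + 1" r k "content ?s" "h(r := length (s r) + 1)"] assms c
    by (simp add: fun_upd_idem)
  have "reach ?M (l, conf k (content s) (h(r := 0))) (length (s r) + 1 + Suc (length (s r) + 2))
      (l + 2, conf k (content ?s) h)"
    using reach_trans[OF scan[of 0] reach_step[OF w r]] by simp
  then have "reach ?M (l, conf k (content s) h) (length (s r) + 1 + Suc (length (s r) + 2))
      (l + 2, conf k (content ?s) h)"
    using assms(5) by (simp only: fun_upd_idem)
  from reach_mono[OF this] show ?thesis by simp
qed

lemma reach_Inc:
  assumes "code_at code l (comp (Inc r) l)" "l \<ge> 2" "l + 2 < length code" "r < k" "h r = 0"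
  shows "reach (tm_of k code) (l, conf k (content s) h) (2 * length (s r) + 4)
    (l + 2, conf k (content (s(r := inc_bits (s r)))) h)"
proof -
  let ?M = "tm_of k code"
  have c: "code ! l = (r, \<lambda>x. if x = 1 then (1, Go_Right, l) else if x = 3 then (2, Go_Right, l)
              else (3, Stay, l + 1))"
    "code ! (l + 1) = rewind r (l + 1)"
    using assms(1) by (auto simp: code_at_Cons)
  \<comment> \<open>\<open>pre\<close> has been passed already. The stopping cell \<open>i\<close>
    is only bounded, since nothing but the cost of the rewind depends on it.\<close>
  have scan: "\<exists>i\<le>length pre + length bs + 1.
      reach ?M (l, conf k (content (s(r := pre @ bs))) (h(r := length pre + 1))) (length bs + 1)
      (l + 1, conf k (content (s(r := pre @ inc_bits bs))) (h(r := i)))" for pre bs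
  proof (induction bs arbitrary: pre rule: inc_bits.induct)
    case 1
    have "tm_step ?M (l, conf k (content (s(r := pre))) (h(r := length pre + 1))) =
      (l + 1, conf k (content (s(r := pre @ [True]))) (h(r := length pre + 1)))"
      by (rule tm_step_at[OF c(1)])
         (use assms in \<open>auto simp: content_upd tape_content_upd tape_content_write\<close>)
    from reach_step[OF this reach_refl[of _ _ 0]] show ?case
      by (intro exI[of _ "length pre + 1"]) (auto simp del: fun_upd_apply)
  next
    case (2 bs)
    have "tm_step ?M (l, conf k (content (s(r := pre @ False # bs))) (h(r := length pre + 1))) =
      (l + 1, conf k (content (s(r := pre @ True # bs))) (h(r := length pre + 1)))"
      by (rule tm_step_at[OF c(1)])
         (use assms in \<open>auto simp: content_upd tape_content_upd tape_content_write\<close>)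
    from reach_step[OF this reach_refl[of _ _ "Suc (length bs)"]] show ?case
      by (intro exI[of _ "length pre + 1"]) (auto simp del: fun_upd_apply)
  next
    case (3 bs)
    have step: "tm_step ?M (l, conf k (content (s(r := pre @ True # bs))) (h(r := length pre + 1))) =
      (l, conf k (content (s(r := (pre @ [False]) @ bs))) (h(r := length (pre @ [False]) + 1)))"
      by (rule tm_step_at[OF c(1)])
         (use assms in \<open>auto simp: content_upd tape_content_upd tape_content_write\<close>)
    from 3[of "pre @ [False]"] obtain i where "i \<le> length (pre @ [False]) + length bs + 1"
      "reach ?M (l, conf k (content (s(r := (pre @ [False]) @ bs))) (h(r := length (pre @ [False]) + 1)))
        (length bs + 1)
        (l + 1, conf k (content (s(r := (pre @ [False]) @ inc_bits bs))) (h(r := i)))" by blast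
    with reach_step[OF step this(2)] show ?case
      by (intro exI[of _ i]) (simp del: fun_upd_apply)
  qed
  have 0: "tm_step ?M (l, conf k (content s) h) = (l, conf k (content s) (h(r := 1)))"
    by (rule tm_step_at[OF c(1)]) (use assms in \<open>auto simp: fun_upd_idem\<close>)
  from scan[of "[]" "s r"] obtain i where i: "i \<le> length (s r) + 1"
    and *: "reach ?M (l, conf k (content s) (h(r := 1))) (length (s r) + 1)
      (l + 1, conf k (content (s(r := inc_bits (s r)))) (h(r := i)))" by auto
  have r: "reach ?M (l + 1, conf k (content (s(r := inc_bits (s r)))) (h(r := i)))
      (i + 1) (l + 2, conf k (content (s(r := inc_bits (s r)))) h)"
    using reach_rewind[of code "l + 1" r k "content (s(r := inc_bits (s r)))" "h(r := i)"] assms c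
    by (simp add: fun_upd_idem)
  show ?thesis
    using reach_mono[OF reach_step[OF 0 reach_trans[OF * r]], of "2 * length (s r) + 4"] i by simp
qed

text \<open>Only the tapes in \<open>regs_of c\<close> have to be rewound. Nested loops rely on
  this: while a body runs, the head of the loop register rests in the middle of its tape.\<close>

lemma reach_comp:
  assumes "wf_cmd c" "code_at code l (comp c l)" "l \<ge> 2" "l + comp_size c < length code"
    "regs_of c \<subseteq> {..<k}" "\<forall>r\<in>regs_of c. h r = 0" "\<And>r. length (exec c s r) \<le> B"
  shows "reach (tm_of k code) (l, conf k (content s) h) (time_bound c B)
    (l + comp_size c, conf k (content (exec c s)) h)"
  using assms
proof (induction c arbitrary: l s h)
  case Skip
  then show ?case by (simp add: reach_refl)
next
  case (App r b)
  then have "reach (tm_of k code) (l, conf k (content s) h) (2 * length (s r) + 4)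
    (l + 2, conf k (content (s(r := s r @ [b]))) h)"
    by (intro reach_App) auto
  from reach_mono[OF this] App.prems(7)[of r] show ?case by simp
next
  case (Inc r)
  then have "reach (tm_of k code) (l, conf k (content s) h) (2 * length (s r) + 4)
    (l + 2, conf k (content (s(r := inc_bits (s r)))) h)"
    by (intro reach_Inc) auto
  from reach_mono[OF this] Inc.prems(7)[of r] length_inc_bits(1)[of "s r"] show ?case by simp
next
  case (Seq c d)
  have B: "length (exec c s r) \<le> B" for r
    using Seq.prems(7)[of r] length_exec_mono[of "exec c s" r d] by simp
  have "reach (tm_of k code) (l, conf k (content s) h) (time_bound c B)
      (l + comp_size c, conf k (content (exec c s)) h)"
    using Seq.prems B by (intro Seq.IH(1)) (auto simp: code_at_append)
  moreover have "reach (tm_of k code) (l + comp_size c, conf k (content (exec c s)) h) (time_bound d B)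
      (l + comp_size c + comp_size d, conf k (content (exec d (exec c s))) h)"
    using Seq.prems by (intro Seq.IH(2)) (auto simp: code_at_append)
  ultimately show ?case by (simp add: reach_trans add.assoc)
next
  case (For r c d)
  let ?M = "tm_of k code"
  let ?m = "comp_size c" and ?n = "comp_size d"
  let ?e = "\<lambda>s b. (if b then exec d else exec c) s"
  have code: "code ! l = (r, \<lambda>x. (x, Go_Right, l + 1))"
    "code ! (l + 1) = (r, \<lambda>x. (x, Stay, if x = 2 then l + 2 else if x = 3 then l + 3 + ?m
        else l + 4 + ?m + ?n))"
    "code_at code (l + 2) (comp c (l + 2))" "code ! (l + 2 + ?m) = (r, \<lambda>x. (x, Stay, l))"
    "code_at code (l + 3 + ?m) (comp d (l + 3 + ?m))" "code ! (l + 3 + ?m + ?n) = (r, \<lambda>x. (x, Stay, l))"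
    "code ! (l + 4 + ?m + ?n) = rewind r (l + 4 + ?m + ?n)"
    and len: "l + 5 + ?m + ?n < length code" and r: "r < k" "r \<notin> regs_of c" "r \<notin> regs_of d" "h r = 0"
    using For.prems by (auto simp: code_at_append code_at_Cons code_at_Nil eval_nat_numeral)
  let ?T = "3 + time_bound c B + time_bound d B"
  \<comment> \<open>The head position \<open>length pre\<close> is the loop counter;
    \<open>s r = pre @ bs\<close> survives each round because the bodies do not write to
    \<open>r\<close>.\<close>
  have loop: "reach ?M (l, conf k (content s) (h(r := length pre))) (length bs * ?T + 2)
      (l + 4 + ?m + ?n, conf k (content (foldl ?e s bs)) (h(r := length pre + length bs + 1)))"
    if "s r = pre @ bs" "\<And>r. length (foldl ?e s bs r) \<le> B" for s pre bs
    using that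
  proof (induction bs arbitrary: s pre)
    case Nil
    have 1: "tm_step ?M (l, conf k (content s) (h(r := length pre))) =
       (l + 1, conf k (content s) (h(r := length pre + 1)))"
      by (rule tm_step_at[OF code(1)]) (use len r For.prems Nil in \<open>auto simp: fun_upd_idem\<close>)
    have 2: "tm_step ?M (l + 1, conf k (content s) (h(r := length pre + 1))) =
       (l + 4 + ?m + ?n, conf k (content s) (h(r := length pre + 1)))"
      by (rule tm_step_at[OF code(2)]) (use len r For.prems Nil in \<open>auto simp: fun_upd_idem\<close>)
    from reach_step[OF 1 reach_step[OF 2 reach_refl[of _ _ 0]]] show ?case
      by (simp add: numeral_2_eq_2 del: fun_upd_apply)
  next
    case (Cons b bs)
    let ?h = "h(r := length pre + 1)"
    have er: "?e s b r = s r" 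
    proof -
      have "r \<notin> writes c" "r \<notin> writes d" using r(2,3) writes_subset by blast+
      then show ?thesis by (simp add: exec_unchanged)
    qed
    have mono: "length (t q) \<le> length (foldl ?e t bs q)" for t q bs
    proof (induction bs arbitrary: t)
      case (Cons b bs)
      then show ?case using length_exec_mono[of t q] by (auto intro: order_trans)
    qed simp
    have B: "length (?e s b q) \<le> B" for q
      using Cons.prems(2)[of q] mono[of "?e s b" q bs] by simp
    have 1: "tm_step ?M (l, conf k (content s) (h(r := length pre))) =
       (l + 1, conf k (content s) ?h)"
      by (rule tm_step_at[OF code(1)]) (use len r For.prems Cons.prems in \<open>auto simp: fun_upd_idem\<close>)
    have 2: "tm_step ?M (l + 1, conf k (content s) ?h) =
       (if b then l + 3 + ?m else l + 2, conf k (content s) ?h)"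
      by (rule tm_step_at[OF code(2)]) (use len r For.prems Cons.prems in \<open>auto simp: fun_upd_idem\<close>)
    have 3: "reach ?M (if b then l + 3 + ?m else l + 2, conf k (content s) ?h)
       (time_bound c B + time_bound d B) 
       (if b then l + 3 + ?m + ?n else l + 2 + ?m, conf k (content (?e s b)) ?h)"
    proof (cases b)
      case True
      have "reach ?M (l + 3 + ?m, conf k (content s) ?h) (time_bound d B)
         (l + 3 + ?m + ?n, conf k (content (exec d s)) ?h)"
        using For.prems code len r B True by (intro For.IH(2)) auto
      from reach_mono[OF this] show ?thesis using True by simp
    next
      case False
      have "reach ?M (l + 2, conf k (content s) ?h) (time_bound c B)
         (l + 2 + ?m, conf k (content (exec c s)) ?h)"
        using For.prems code len r B False by (intro For.IH(1)) auto
      from reach_mono[OF this] show ?thesis using False by simp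
    qed
    have 4: "tm_step ?M (if b then l + 3 + ?m + ?n else l + 2 + ?m, conf k (content (?e s b)) ?h) =
       (l, conf k (content (?e s b)) (h(r := length (pre @ [b]))))"
    proof (cases b)
      case True
      show ?thesis
        unfolding if_P[OF True]
        by (rule tm_step_at[OF code(6)]) (use len r For.prems True in \<open>auto simp: fun_upd_idem\<close>)
    next
      case False
      show ?thesis
        unfolding if_not_P[OF False]
        by (rule tm_step_at[OF code(4)]) (use len r For.prems False in \<open>auto simp: fun_upd_idem\<close>)
    qed
    have 5: "reach ?M (l, conf k (content (?e s b)) (h(r := length (pre @ [b])))) (length bs * ?T + 2)
      (l + 4 + ?m + ?n, conf k (content (foldl ?e (?e s b) bs)) (h(r := length (pre @ [b]) + length bs + 1)))"
      using Cons.prems er by (intro Cons.IH) auto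
    have len: "length (pre @ [b]) + length bs + 1 = length pre + length (b # bs) + 1" by simp
    have "reach ?M (l, conf k (content s) (h(r := length pre))) (length (b # bs) * ?T + 2)
      (l + 4 + ?m + ?n, conf k (content (foldl ?e (?e s b) bs))
        (h(r := length (pre @ [b]) + length bs + 1)))"
      by (rule reach_mono[OF reach_step[OF 1 reach_step[OF 2 reach_trans[OF 3 reach_step[OF 4 5]]]]])
         (simp add: algebra_simps)
    then show ?case by (simp only: foldl_Cons len)
  qed
  have sB: "length (s r) \<le> B"
    using For.prems(7)[of r] length_exec_mono[of s r "For r c d"] by (meson order_trans)
  have l: "reach ?M (l, conf k (content s) h) (length (s r) * ?T + 2)
      (l + 4 + ?m + ?n, conf k (content (exec (For r c d) s)) (h(r := length (s r) + 1)))"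
    using loop[of s "[]" "s r"] For.prems(7) r by (simp add: fun_upd_idem)
  have "reach ?M (l + 4 + ?m + ?n, conf k (content (exec (For r c d) s)) (h(r := length (s r) + 1)))
      ((h(r := length (s r) + 1)) r + 1)
      (l + 4 + ?m + ?n + 1, conf k (content (exec (For r c d) s)) ((h(r := length (s r) + 1))(r := 0)))"
    by (rule reach_rewind) (use code(7) len r in auto)
  then have rr: "reach ?M (l + 4 + ?m + ?n, conf k (content (exec (For r c d) s)) (h(r := length (s r) + 1)))
      (length (s r) + 2) (l + 4 + ?m + ?n + 1, conf k (content (exec (For r c d) s)) h)"
    using r by (simp add: fun_upd_idem del: exec.simps)
  have "length (s r) * ?T + 2 + (length (s r) + 2) \<le> time_bound (For r c d) B"
    using add_mono[OF mult_le_mono1[OF sB, of ?T] sB] by simp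
  note * = reach_mono[OF reach_trans[OF l rr] this]
  have e: "l + comp_size (For r c d) = l + 4 + ?m + ?n + 1" by simp
  show ?case unfolding e by (rule *)
qed

section \<open>Polynomial bounds\<close>

definition is_poly :: "(nat \<Rightarrow> nat) \<Rightarrow> bool" where
  "is_poly f \<longleftrightarrow> (\<exists>p. f = poly p)"

lemma is_poly_intros:
  "is_poly (\<lambda>_. c)" "is_poly (\<lambda>x. x)" "is_poly (poly p)"
  "is_poly f \<Longrightarrow> is_poly g \<Longrightarrow> is_poly (\<lambda>x. f x + g x)"
  "is_poly f \<Longrightarrow> is_poly g \<Longrightarrow> is_poly (\<lambda>x. f x * g x)"
proof -
  show "is_poly (\<lambda>_. c)" "is_poly (\<lambda>x. x)" "is_poly (poly p)"
    unfolding is_poly_def fun_eq_iff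
    by (rule exI[of _ "[:c:]"] exI[of _ "[:0, 1:]"] exI[of _ p], simp)+
  assume "is_poly f" "is_poly g"
  then obtain p q where "f = poly p" "g = poly q" by (auto simp: is_poly_def)
  then have "(\<lambda>x. f x + g x) = poly (p + q)" "(\<lambda>x. f x * g x) = poly (p * q)"
    by (auto simp: fun_eq_iff)
  then show "is_poly (\<lambda>x. f x + g x)" "is_poly (\<lambda>x. f x * g x)"
    by (auto simp: is_poly_def)
qed

lemma is_poly_compose:
  assumes "is_poly f" "is_poly g"
  shows "is_poly (\<lambda>x. f (g x))"
proof -
  obtain p q where "f = poly p" "g = poly q" using assms by (auto simp: is_poly_def)
  then have "(\<lambda>x. f (g x)) = poly (pcompose p q)" by (simp add: fun_eq_iff poly_pcompose)
  then show ?thesis by (auto simp: is_poly_def)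
qed

lemma is_poly_time_bound: "is_poly (time_bound c)"
proof (induction c)
  case (For r c d)
  have "time_bound (For r c d) = (\<lambda>B. B * (3 + time_bound c B + time_bound d B) + B + 4)"
    by (simp add: fun_eq_iff)
  then show ?case using For by (auto intro!: is_poly_intros)
next
  case (Seq c d)
  have "time_bound (Seq c d) = (\<lambda>B. time_bound c B + time_bound d B)"
    by (simp add: fun_eq_iff)
  then show ?case using Seq by (auto intro!: is_poly_intros)
next
  case Skip
  have "time_bound Skip = (\<lambda>B. 0)" by (simp add: fun_eq_iff)
  then show ?case by (auto intro!: is_poly_intros)
next
  case (App r b)
  have "time_bound (App r b) = (\<lambda>B. 2 * B + 4)" by (simp add: fun_eq_iff)
  then show ?case by (auto intro!: is_poly_intros)
next
  case (Inc r)
  have "time_bound (Inc r) = (\<lambda>B. 2 * B + 4)" by (simp add: fun_eq_iff)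
  then show ?case by (auto intro!: is_poly_intros)
qed

lemma mono_poly_nat: "a \<le> b \<Longrightarrow> poly p a \<le> poly p (b :: nat)"
  by (induction p) (auto intro: add_mono mult_mono)

lemma halted_stable: "fst c = 1 \<Longrightarrow> (tm_step M ^^ t) c = c"
  by (induction t) (auto simp: tm_step_def)

definition input_regs :: "bool list \<Rightarrow> regs" where
  "input_regs x = (\<lambda>r. if r = 0 then x else [])"

text \<open>Register 0 is the input tape and register \<open>k - 1\<close>, the last tape, the
  output tape; \<open>time_bound\<close> turns the length bound into a step bound.\<close>

theorem polytime_exec:
  assumes "wf_cmd c" "regs_of c \<subseteq> {..<k}" "k \<ge> 1"
    "is_poly b" "\<And>x r. length (exec c (input_regs x) r) \<le> b (length x)"
  shows "polytime (\<lambda>x. exec c (input_regs x) (k - 1))"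
proof -
  \<comment> \<open>State 0 has to start and state 1 to halt, so the compiled code begins at state
    2. The entry for state 1 is a placeholder, and the last instruction jumps to that state.\<close>
  define code where "code = [(0, \<lambda>x. (x, Stay, 2)), (0, \<lambda>x. (x, Stay, 1))] @ comp c 2 @
    [(0, \<lambda>x. (x, Stay, 1)) :: instr]"
  define M where "M = tm_of k code"
  define T where "T = (\<lambda>n. time_bound c (b n) + 2)"
  have "is_poly T"
    unfolding T_def
    by (intro is_poly_intros is_poly_compose[of "time_bound c" b] is_poly_time_bound assms(4))
  then obtain p where p: "T = poly p" by (auto simp: is_poly_def)
  have "computes_in_time M (\<lambda>x. exec c (input_regs x) (k - 1)) T"
    unfolding computes_in_time_def Let_def
  proof
    fix x
    let ?s = "input_regs x" and ?h = "\<lambda>_ :: nat. 0 :: nat"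
    have init: "tm_init M x = (0, conf k (content ?s) ?h)"
      using assms(3)
      by (intro prod_eqI nth_equalityI)
         (auto simp: tm_init_def conf_def M_def tm_of_def input_regs_def nth_Cons' )
    have c: "code ! 0 = (0, \<lambda>x. (x, Stay, 2))" "code_at code 2 (comp c 2)"
      "code ! (2 + comp_size c) = (0, \<lambda>x. (x, Stay, 1))" "length code = 3 + comp_size c"
      by (auto simp: code_def code_at_def nth_append)
    have 1: "tm_step M (0, conf k (content ?s) ?h) = (2, conf k (content ?s) ?h)"
      unfolding M_def by (rule tm_step_at[OF c(1)]) (use c assms(3) in \<open>auto simp: fun_upd_idem\<close>)
    have 2: "reach M (2, conf k (content ?s) ?h) (time_bound c (b (length x)))
       (2 + comp_size c, conf k (content (exec c ?s)) ?h)"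
      unfolding M_def using assms c by (intro reach_comp) auto
    have 3: "tm_step M (2 + comp_size c, conf k (content (exec c ?s)) ?h) =
       (1, conf k (content (exec c ?s)) ?h)"
      unfolding M_def by (rule tm_step_at[OF c(3)]) (use c assms(3) in \<open>auto simp: fun_upd_idem\<close>)
    have "reach M (0, conf k (content ?s) ?h) (T (length x)) (1, conf k (content (exec c ?s)) ?h)"
      using reach_step[OF 1 reach_trans[OF 2 reach_step[OF 3 reach_refl[of _ _ 0]]]]
      by (simp add: T_def)
    then obtain t where "t \<le> T (length x)"
      "(tm_step M ^^ t) (tm_init M x) = (1, conf k (content (exec c ?s)) ?h)"
      by (auto simp: reach_def init)
    \<comment> \<open>A halted machine stays put, which pads the run to exactly
      \<open>T (length x)\<close> steps.\<close>
    then have "(tm_step M ^^ T (length x)) (tm_init M x) = (1, conf k (content (exec c ?s)) ?h)"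
      using halted_stable[of "(1, conf k (content (exec c ?s)) ?h)" "T (length x) - t" M]
        funpow_add[of "T (length x) - t" t "tm_step M"] by simp
    then show "fst ((tm_step M ^^ T (length x)) (tm_init M x)) = 1 \<and>
      fst (last (snd ((tm_step M ^^ T (length x)) (tm_init M x)))) =
        tape_content (exec c ?s (k - 1))"
      using assms(3) by (simp add: conf_def last_map)
  qed
  moreover have "valid_tm M"
    unfolding M_def using assms(3) by (intro valid_tm_of) (auto simp: code_def)
  ultimately show ?thesis unfolding polytime_def p by blast
qed

section \<open>Popular matchings when every person ranks two items\<close>

locale two_choices =
  fixes I :: aug_input and fi se :: "nat \<Rightarrow> nat" and N :: nat
  assumes pref_lists: "pref_lists I = map (\<lambda>a. [(fi a, 0), (se a, 1)]) [0..<N]"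
    and fi_neq_se: "a < N \<Longrightarrow> fi a \<noteq> se a"
    and item_bounds: "a < N \<Longrightarrow> fi a < length (prices I)" "a < N \<Longrightarrow> se a < length (prices I)"
begin

lemma graph_simps [simp]:
  "people (graph_of I) = {..<N}" "items (graph_of I) = {..<length (prices I)}"
  "(a, b) \<in> edges (graph_of I) \<longleftrightarrow> a < N \<and> (b = fi a \<or> b = se a)"
  "a < N \<Longrightarrow> rank (graph_of I) a (fi a) = 0" "a < N \<Longrightarrow> rank (graph_of I) a (se a) = 1"
  using fi_neq_se[of a] by (auto simp: graph_of_def pref_lists)

lemma strict_prefs_graph: "strict_prefs (graph_of I)"
  unfolding strict_prefs_def
proof
  fix a assume "a \<in> people (graph_of I)"
  then show "inj_on (rank (graph_of I) a) (acceptable (graph_of I) a)"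
    by (auto simp: inj_on_def acceptable_def)
qed

lemma card_acceptable: "card (acceptable (graph_of I) a) \<le> 2"
proof -
  have "acceptable (graph_of I) a \<subseteq> {fi a, se a}" by (auto simp: acceptable_def)
  then have "card (acceptable (graph_of I) a) \<le> card {fi a, se a}" by (intro card_mono) auto
  also have "\<dots> \<le> 2" by (simp add: card_insert_if)
  finally show ?thesis .
qed

lemma matching_iff:
  "matching (graph_of I) cp M \<longleftrightarrow> dom M \<subseteq> {..<N} \<and>
     (\<forall>a<N. M a = None \<or> M a = Some (fi a) \<or> M a = Some (se a)) \<and>
     (\<forall>b<length (prices I). card {a. a < N \<and> M a = Some b} \<le> cp b)"
proof (cases "dom M \<subseteq> {..<N}")
  case True
  have "(\<forall>a b. M a = Some b \<longrightarrow> (a, b) \<in> edges (graph_of I)) \<longleftrightarrow>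
      (\<forall>a<N. M a = None \<or> M a = Some (fi a) \<or> M a = Some (se a))" (is "?A = ?B")
  proof
    assume ?A
    then show ?B by (metis graph_simps(3) not_None_eq)
  next
    assume B: ?B
    show ?A
    proof (intro allI impI)
      fix a b assume "M a = Some b"
      then have "a < N" using True by auto
      then show "(a, b) \<in> edges (graph_of I)" using B \<open>M a = Some b\<close> by fastforce
    qed
  qed
  then show ?thesis unfolding matching_def by (simp add: Ball_def)
qed (simp add: matching_def)

lemma matching_cases:
  assumes "matching (graph_of I) cp M" "a < N"
  obtains "M a = None" | "M a = Some (fi a)" | "M a = Some (se a)"
  using assms by (auto simp: matching_iff)

lemma prefers_first:
  assumes "matching (graph_of I) cp M" "a < N" "M a = Some (fi a)" "M' a \<noteq> Some (fi a)"
    "matching (graph_of I) cp' M'"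
  shows "prefers (graph_of I) a M M'"
  using assms by (cases rule: matching_cases[OF assms(5,2)]) (auto simp: prefers_def)

text \<open>With two ranks and nobody unmatched, a gain can only be a move from the second to the
  first choice.\<close>

lemma prefers_perfect:
  assumes "matching (graph_of I) cp M" "perfect (graph_of I) M" "a < N"
    "matching (graph_of I) cp' M'" "prefers (graph_of I) a M' M"
  shows "M a \<noteq> Some (fi a) \<and> M' a = Some (fi a)"
proof -
  have "M a \<noteq> None" using assms(2,3) by (auto simp: perfect_def)
  then show ?thesis
  using assms(5) fi_neq_se[OF assms(3)] assms(3)
  by (cases rule: matching_cases[OF assms(1,3)]; cases rule: matching_cases[OF assms(4,3)])
     (auto simp: prefers_def)
qed

text \<open>Whoever gains moves to a first choice \<open>b\<close> that had pushed them away. By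
  \<open>full\<close>, people with first choice \<open>b\<close> hold all its copies, so each
  newcomer drives out one of them, who loses. Gains are thus outweighed item by item.\<close>

lemma popularI:
  assumes M: "matching (graph_of I) cp M" "perfect (graph_of I) M"
    and full: "\<And>a. a < N \<Longrightarrow> M a \<noteq> Some (fi a) \<Longrightarrow>
      cp (fi a) \<le> card {a'. a' < N \<and> fi a' = fi a \<and> M a' = Some (fi a)}"
  shows "popular (graph_of I) cp M"
proof -
  have False if M': "matching (graph_of I) cp M'" and mp: "more_popular (graph_of I) M' M" for M'
  proof -
    \<comment> \<open>\<open>X b\<close> are the newcomers at \<open>b\<close>, \<open>Y b\<close>
      those who leave their first choice \<open>b\<close>, \<open>Z b\<close> those who stay.
      \<open>X b\<close> and \<open>Z b\<close> fit into the copies of \<open>b\<close>, and if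
      \<open>X b\<close> is nonempty, \<open>Y b\<close> and \<open>Z b\<close> fill them.\<close>
    define X where "X b = {a. a < N \<and> fi a = b \<and> M a \<noteq> Some b \<and> M' a = Some b}" for b
    define Y where "Y b = {a. a < N \<and> fi a = b \<and> M a = Some b \<and> M' a \<noteq> Some b}" for b
    define Z where "Z b = {a. a < N \<and> fi a = b \<and> M a = Some b \<and> M' a = Some b}" for b
    have fin [simp]: "finite (X b)" "finite (Y b)" "finite (Z b)" for b
      by (auto simp: X_def Y_def Z_def)
    have XY: "card (X b) \<le> card (Y b)" for b
    proof (cases "X b = {}")
      case False
      then obtain a where a: "a < N" "fi a = b" "M a \<noteq> Some b" by (auto simp: X_def)
      have "card (X b) + card (Z b) = card (X b \<union> Z b)"
        by (intro card_Un_disjoint[symmetric]) (auto simp: X_def Z_def)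
      also have "\<dots> \<le> card {a. a < N \<and> M' a = Some b}"
        by (intro card_mono) (auto simp: X_def Z_def)
      also have "\<dots> \<le> cp b"
        using M' a item_bounds(1)[of a] by (auto simp: matching_iff)
      also have "\<dots> \<le> card {a'. a' < N \<and> fi a' = b \<and> M a' = Some b}"
        using full a by auto
      also have "{a'. a' < N \<and> fi a' = b \<and> M a' = Some b} = Y b \<union> Z b"
        by (auto simp: Y_def Z_def)
      also have "card \<dots> = card (Y b) + card (Z b)"
        by (intro card_Un_disjoint) (auto simp: Y_def Z_def)
      finally show ?thesis by simp
    qed simp
    have disj: "card (\<Union>b\<in>fi ` {..<N}. W b) = (\<Sum>b\<in>fi ` {..<N}. card (W b))"
      if "\<And>b. finite (W b)" "\<And>b. W b \<subseteq> {a. fi a = b}" for W :: "nat \<Rightarrow> nat set"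
    proof (intro card_UN_disjoint ballI impI)
      fix b b' :: nat assume "b \<noteq> b'"
      then show "W b \<inter> W b' = {}" using that(2)[of b] that(2)[of b'] by auto
    qed (use that(1) in auto)
    have "card {a \<in> people (graph_of I). prefers (graph_of I) a M' M} \<le> card (\<Union>b\<in>fi ` {..<N}. X b)"
      using prefers_perfect[OF M _ M'] by (intro card_mono) (auto simp: X_def)
    also have "\<dots> = (\<Sum>b\<in>fi ` {..<N}. card (X b))"
      by (intro disj) (auto simp: X_def)
    also have "\<dots> \<le> (\<Sum>b\<in>fi ` {..<N}. card (Y b))"
      by (intro sum_mono XY)
    also have "\<dots> = card (\<Union>b\<in>fi ` {..<N}. Y b)"
      by (intro disj[symmetric]) (auto simp: Y_def)
    also have "\<dots> \<le> card {a \<in> people (graph_of I). prefers (graph_of I) a M M'}"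
      using prefers_first[OF M(1) _ _ _ M'] by (intro card_mono) (auto simp: Y_def)
    finally show False using mp by (simp add: more_popular_def)
  qed
  then show ?thesis using M by (auto simp: popular_def)
qed

text \<open>If somebody were pushed away from an item held by one of its second-choosers, then
  both could get their first choices at the expense of at most one other person.\<close>

lemma popular_second_choice:
  assumes pop: "popular (graph_of I) cp M" and cp: "\<And>b. cp b \<ge> 1"
    and a: "a < N" "M a \<noteq> Some (fi a)" and a': "a' < N" "M a' = Some (fi a)"
  shows "fi a' = fi a"
proof (rule ccontr)
  assume neq: "fi a' \<noteq> fi a"
  have M: "matching (graph_of I) cp M" using pop by (simp add: popular_def)
  define occ where "occ b = {x. x < N \<and> M x = Some b}" for b
  have fin [simp]: "finite (occ b)" for b by (auto simp: occ_def)
  have occ: "card (occ b) \<le> cp b" if "b < length (prices I)" for b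
    using M that by (auto simp: matching_iff occ_def)
  \<comment> \<open>\<open>z\<close> has to leave \<open>fi a'\<close> to make room for
    \<open>a'\<close>. If \<open>a\<close> sits there, the move of \<open>a\<close> to
    \<open>fi a\<close> vacates a copy and nobody is dismissed; if nobody sits there, a copy is
    free.\<close>
  define z where "z = (if a \<in> occ (fi a') then a else SOME z. z \<in> occ (fi a'))"
  have z: "occ (fi a') \<noteq> {} \<Longrightarrow> z \<in> occ (fi a')"
    unfolding z_def by (auto intro: someI)
  define M' where "M' x = (if x = a then Some (fi a) else if x = a' then Some (fi a')
    else if x = z \<and> x \<in> occ (fi a') then None else M x)" for x
  have aa: "a \<noteq> a'" using a a' by auto
  have "card {x. x < N \<and> M' x = Some b} \<le> cp b" if b: "b < length (prices I)" for b
  proof -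
    consider "b = fi a" | "b = fi a'" | "b \<noteq> fi a" "b \<noteq> fi a'" by blast
    then show ?thesis
    proof cases
      case 1
      have "a' \<in> occ b" using a' 1 by (auto simp: occ_def)
      have "card {x. x < N \<and> M' x = Some b} \<le> card (insert a (occ b - {a'}))"
        using 1 neq by (intro card_mono) (auto simp: M'_def occ_def split: if_splits)
      also have "\<dots> \<le> Suc (card (occ b - {a'}))" by (simp add: card_insert_if)
      also have "\<dots> = card (occ b)" using \<open>a' \<in> occ b\<close> by (intro card_Suc_Diff1) auto
      finally show ?thesis using occ[OF b] by simp
    next
      case 2
      have "{x. x < N \<and> M' x = Some b} \<subseteq> insert a' (occ b - {z})"
        using 2 neq z by (auto simp: M'_def occ_def z_def split: if_splits)
      then have "card {x. x < N \<and> M' x = Some b} \<le> card (insert a' (occ b - {z}))"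
        by (intro card_mono) auto
      also have "\<dots> \<le> Suc (card (occ b - {z}))" by (simp add: card_insert_if)
      also have "\<dots> \<le> cp b"
        using z occ[OF b] cp[of b] 2
        by (cases "occ b = {}") (auto simp: card_Suc_Diff1 simp del: card_Diff_insert)
      finally show ?thesis .
    next
      case 3
      have "card {x. x < N \<and> M' x = Some b} \<le> card (occ b)"
        using 3 by (intro card_mono) (auto simp: M'_def occ_def split: if_splits)
      then show ?thesis using occ[OF b] by simp
    qed
  qed
  then have M': "matching (graph_of I) cp M'"
    using M a a' by (auto simp: matching_iff M'_def dom_def split: if_splits)
  have gain: "{a, a'} \<subseteq> {x \<in> people (graph_of I). prefers (graph_of I) x M' M}"
    using prefers_first[OF M' _ _ _ M] a a' aa neq by (auto simp: M'_def)
  have "2 \<le> card {x \<in> people (graph_of I). prefers (graph_of I) x M' M}"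
    using card_mono[OF _ gain] aa by simp
  moreover have "{x \<in> people (graph_of I). prefers (graph_of I) x M M'} \<subseteq> {z}"
    using a a' by (auto simp: prefers_def M'_def split: if_splits)
  then have "card {x \<in> people (graph_of I). prefers (graph_of I) x M M'} \<le> 1"
    using card_mono[of "{z}"] by fastforce
  ultimately have "more_popular (graph_of I) M' M" by (simp add: more_popular_def)
  then show False using pop M' by (auto simp: popular_def)
qed

end

section \<open>From independent sets to augmentations\<close>

text \<open>Every item \<open>b\<close> with an entry \<open>(b, s, t)\<close> is the first choice of exactly two people, whose
  second choices are \<open>s\<close> and \<open>t\<close>. A vertex \<open>v\<close> has the entry \<open>(v, z, z)\<close> with \<open>z\<close> free of charge,
  an edge \<open>e\<close> has the entry \<open>(e, u, v)\<close> with endpoints \<open>u, v\<close>, which may coincide.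
  Pushing somebody from a vertex to \<open>z\<close> or from an edge to an endpoint saves one unit;
  an item cannot both push people away and receive them.\<close>

definition gadget_input :: "(nat \<times> nat \<times> nat) list \<Rightarrow> nat list \<Rightarrow> aug_input" where
  "gadget_input D pr =
     \<lparr>pref_lists = concat (map (\<lambda>(b, s, t). [[(b, 0), (s, 1)], [(b, 0), (t, 1)]]) D),
      prices = map of_nat pr\<rparr>"

definition first_choice :: "(nat \<times> nat \<times> nat) list \<Rightarrow> nat \<Rightarrow> nat" where
  "first_choice D a = fst (D ! (a div 2))"

definition second_choice :: "(nat \<times> nat \<times> nat) list \<Rightarrow> nat \<Rightarrow> nat" where
  "second_choice D a = (if even a then fst else snd) (snd (D ! (a div 2)))"

lemma pref_lists_gadget_input:
  "pref_lists (gadget_input D pr) =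
     map (\<lambda>a. [(first_choice D a, 0), (second_choice D a, 1)]) [0..<2 * length D]"
proof (induction D rule: rev_induct)
  case (snoc x D)
  have "map (\<lambda>a. [(first_choice (D @ [x]) a, 0), (second_choice (D @ [x]) a, 1)]) [0..<2 * length D] =
      map (\<lambda>a. [(first_choice D a, 0 :: nat), (second_choice D a, 1 :: nat)]) [0..<2 * length D]"
    by (auto simp: first_choice_def second_choice_def nth_append)
  moreover have "[0..<2 * length (D @ [x])] = [0..<2 * length D] @ [2 * length D, Suc (2 * length D)]"
    by simp
  ultimately show ?case
    using snoc by (auto simp: gadget_input_def first_choice_def second_choice_def split: prod.splits)
qed (simp add: gadget_input_def)

locale gadgets =
  fixes D :: "(nat \<times> nat \<times> nat) list" and pr :: "nat list" and VS ES :: "nat set"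
  assumes distinct_items: "distinct (map fst D)"
    and items_eq: "fst ` set D = VS \<union> ES" and disjoint: "VS \<inter> ES = {}"
    and vertex: "(b, s, t) \<in> set D \<Longrightarrow> b \<in> VS \<Longrightarrow>
      s \<notin> VS \<union> ES \<and> t \<notin> VS \<union> ES \<and> pr ! s = 0 \<and> pr ! t = 0 \<and> pr ! b = 1"
    and edge: "(b, s, t) \<in> set D \<Longrightarrow> b \<in> ES \<Longrightarrow> s \<in> VS \<and> t \<in> VS \<and> pr ! b = 2"
    and bounds: "(b, s, t) \<in> set D \<Longrightarrow> b < length pr \<and> s < length pr \<and> t < length pr"
begin

abbreviation "fi \<equiv> first_choice D"
abbreviation "se \<equiv> second_choice D"
abbreviation "N \<equiv> 2 * length D"
abbreviation "G \<equiv> graph_of (gadget_input D pr)"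

lemma person_entry:
  assumes "a < N"
  obtains s t where "(fi a, s, t) \<in> set D" "se a = s \<or> se a = t"
proof -
  have "a div 2 < length D" using assms by auto
  then have "D ! (a div 2) \<in> set D" by simp
  then show ?thesis
    using that[of "fst (snd (D ! (a div 2)))" "snd (snd (D ! (a div 2)))"]
    by (auto simp: first_choice_def second_choice_def)
qed

lemma fi_in:
  assumes "a < N"
  shows "fi a \<in> VS \<union> ES"
proof -
  obtain s t where "(fi a, s, t) \<in> set D" using assms by (rule person_entry)
  then have "fi a \<in> fst ` set D" by force
  then show ?thesis using items_eq by simp
qed

lemma se_vertex:
  assumes "a < N" "fi a \<in> VS"
  shows "se a \<notin> VS \<union> ES \<and> pr ! se a = 0"
proof -
  obtain s t where "(fi a, s, t) \<in> set D" "se a = s \<or> se a = t"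
    using assms(1) by (rule person_entry)
  then show ?thesis using vertex[of "fi a" s t] assms(2) by auto
qed

lemma se_edge:
  assumes "a < N" "fi a \<in> ES"
  shows "se a \<in> VS"
proof -
  obtain s t where "(fi a, s, t) \<in> set D" "se a = s \<or> se a = t"
    using assms(1) by (rule person_entry)
  then show ?thesis using edge[of "fi a" s t] assms(2) by auto
qed

lemma item_entry:
  assumes "b \<in> VS \<union> ES"
  obtains s t where "(b, s, t) \<in> set D"
proof -
  have "b \<in> fst ` set D" using assms items_eq by simp
  then show ?thesis using that by auto
qed

lemma price_vertex: "b \<in> VS \<Longrightarrow> pr ! b = 1"
  using item_entry[of b] vertex by blast

lemma price_edge: "b \<in> ES \<Longrightarrow> pr ! b = 2"
  using item_entry[of b] edge by blast

lemma item_bound: "b \<in> VS \<union> ES \<Longrightarrow> b < length pr"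
  using item_entry[of b] bounds by blast

lemma length_prices: "length (prices (gadget_input D pr)) = length pr"
  by (simp add: gadget_input_def)

sublocale two_choices "gadget_input D pr" fi se N
proof
  fix a assume a: "a < N"
  show "fi a \<noteq> se a" using fi_in[OF a] se_vertex[OF a] se_edge[OF a] disjoint by auto
  show "fi a < length (prices (gadget_input D pr))" "se a < length (prices (gadget_input D pr))"
    using person_entry[OF a] bounds unfolding length_prices by metis+
qed (rule pref_lists_gadget_input)

definition fans :: "nat \<Rightarrow> nat set" where
  "fans b = {a. a < N \<and> fi a = b}"

lemma finite_fans [simp]: "finite (fans b)"
  by (simp add: fans_def)

lemma fans_eq:
  assumes j: "j < length D"
  shows "fans (fst (D ! j)) = {2 * j, 2 * j + 1}"
proof -
  have "a = 2 * j \<or> a = 2 * j + 1" if "a \<in> fans (fst (D ! j))" for a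
  proof -
    have a: "a div 2 < length D" "fst (D ! (a div 2)) = fst (D ! j)"
      using that unfolding fans_def first_choice_def by auto
    then have "a div 2 = j"
      using nth_eq_iff_index_eq[OF distinct_items, of "a div 2" j] j by simp
    then show ?thesis by linarith
  qed
  then have "fans (fst (D ! j)) \<subseteq> {2 * j, 2 * j + 1}" by blast
  moreover have "{2 * j, 2 * j + 1} \<subseteq> fans (fst (D ! j))"
    using j by (simp add: fans_def first_choice_def)
  ultimately show ?thesis by (rule subset_antisym)
qed

lemma card_fans:
  assumes "b \<in> VS \<union> ES"
  shows "card (fans b) = 2"
proof -
  obtain s t where "(b, s, t) \<in> set D" using assms by (rule item_entry)
  then obtain j where "j < length D" "D ! j = (b, s, t)" by (auto simp: in_set_conv_nth)
  with fans_eq[of j] show ?thesis by simp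
qed

text \<open>For an edge these are the endpoints; a loop, which forbids its vertex altogether, yields
  a singleton.\<close>

definition ends :: "nat \<Rightarrow> nat set" where
  "ends e = se ` fans e"

lemma ends_eq:
  assumes "(b, s, t) \<in> set D"
  shows "ends b = {s, t}"
proof -
  obtain j where "j < length D" "D ! j = (b, s, t)" using assms by (auto simp: in_set_conv_nth)
  with fans_eq[of j] show ?thesis by (simp add: ends_def second_choice_def)
qed

lemma valid_gadget_input: "valid_input (gadget_input D pr)"
proof -
  have "distinct (map fst l) \<and> fst ` set l \<subseteq> {..<length (prices (gadget_input D pr))}"
    if "l \<in> set (pref_lists (gadget_input D pr))" for l
    using that fi_neq_se item_bounds by (auto simp: pref_lists_gadget_input)
  then show ?thesis by (auto simp: valid_input_def gadget_input_def)
qed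

lemma finite_VS: "finite VS" and finite_ES: "finite ES"
proof -
  have "finite (VS \<union> ES)" unfolding items_eq[symmetric] by simp
  then show "finite VS" "finite ES" by simp_all
qed

lemma cost_eq:
  "augmentation_cost G (cost_of (gadget_input D pr)) k = of_nat (\<Sum>b<length pr. k b * pr ! b)"
  by (simp add: augmentation_cost_def cost_of_def graph_of_def gadget_input_def)

text \<open>Every edge and every vertex of \<open>S\<close> pushes one of its two fans, keeps the
  other and needs no extra copy. A vertex outside \<open>S\<close> keeps both fans and pays one copy
  for this and one for each person received from an edge. Each edge sends one person, so the cost is
  at most \<open>card (VS - S) + card ES\<close>.\<close>

lemma augmentation_of_independent:
  assumes S: "S \<subseteq> VS" "\<And>e. e \<in> ES \<Longrightarrow> \<not> ends e \<subseteq> S"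
  shows "\<exists>k. perfect_augmentation G k \<and>
    (\<Sum>b<length pr. k b * pr ! b) + card S \<le> card VS + card ES"
proof -
  \<comment> \<open>Independence lets each edge push towards an endpoint outside \<open>S\<close>,
    so that no vertex both pushes and receives.\<close>
  have "\<exists>a\<in>fans b. b \<in> ES \<longrightarrow> se a \<notin> S" if "b \<in> VS \<union> ES" for b
  proof (cases "b \<in> ES")
    case True
    then show ?thesis using S(2)[of b] by (auto simp: ends_def)
  next
    case False
    have "fans b \<noteq> {}" using card_fans[OF that] by auto
    then show ?thesis using False by auto
  qed
  then obtain q where q: "\<And>b. b \<in> VS \<union> ES \<Longrightarrow> q b \<in> fans b"
    "\<And>b. b \<in> ES \<Longrightarrow> se (q b) \<notin> S" by (metis UnCI)
  define Q where "Q = q ` (S \<union> ES)"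
  have Q: "a < N \<and> fi a \<in> S \<union> ES \<and> a = q (fi a)" if "a \<in> Q" for a
    using that q S(1) by (force simp: Q_def fans_def)
  have qQ: "q b \<in> Q" if "b \<in> S \<union> ES" for b using that by (auto simp: Q_def)
  define M where "M a = (if a < N then if a \<in> Q then Some (se a) else Some (fi a) else None)" for a
  define occ where "occ b = {a. a < N \<and> M a = Some b}" for b
  \<comment> \<open>Truncated subtraction: an item held by nobody gets no extra copy.\<close>
  define k where "k b = card (occ b) - 1" for b
  define inn where "inn b = card {a \<in> Q. fi a \<in> ES \<and> se a = b}" for b
  have finQ: "finite Q" using S(1) finite_VS finite_ES by (auto simp: Q_def dest: finite_subset)
  have occ1: "occ b = fans b - {q b}" if b: "b \<in> S \<union> ES" for b
  proof
    show "occ b \<subseteq> fans b - {q b}"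
    proof
      fix a assume a: "a \<in> occ b"
      then have aN: "a < N" by (auto simp: occ_def)
      show "a \<in> fans b - {q b}"
      proof (cases "a \<in> Q")
        case True
        then have "se a = b" using a by (auto simp: occ_def M_def)
        moreover have "fi a \<notin> ES" using Q[OF True] q(2)[of "fi a"] b \<open>se a = b\<close> se_edge[OF aN] disjoint
          by auto
        ultimately show ?thesis using Q[OF True] se_vertex[OF aN] b S(1) by auto
      next
        case False
        then show ?thesis using a qQ[OF b] by (auto simp: occ_def M_def fans_def)
      qed
    qed
    show "fans b - {q b} \<subseteq> occ b"
      using Q by (auto simp: occ_def M_def fans_def)
  qed
  have card1: "card (occ b) = 1" if "b \<in> S \<union> ES" for b
    using occ1[OF that] q(1)[of b] card_fans[of b] that S(1) by (auto simp: card_Diff_singleton_if)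
  have perfect: "perfect G M" by (auto simp: perfect_def M_def)
  have popular: "popular G (\<lambda>b. 1 + k b) M"
  proof (rule popularI)
    show "matching G (\<lambda>b. 1 + k b) M"
      unfolding matching_iff by (auto simp: M_def k_def occ_def dom_def)
    show "perfect G M" by (rule perfect)
    fix a assume a: "a < N" "M a \<noteq> Some (fi a)"
    then have b: "fi a \<in> S \<union> ES" using Q[of a] by (auto simp: M_def split: if_splits)
    have "{a'. a' < N \<and> fi a' = fi a \<and> M a' = Some (fi a)} = occ (fi a)"
      using occ1[OF b] by (auto simp: occ_def fans_def)
    then show "1 + k (fi a) \<le> card {a'. a' < N \<and> fi a' = fi a \<and> M a' = Some (fi a)}"
      using card1[OF b] by (simp add: k_def)
  qed
  have bound: "k b * pr ! b \<le> (if b \<in> VS - S then 1 + inn b else 0)" for b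
  proof (cases "b \<in> VS \<union> ES")
    case True
    show ?thesis
    proof (cases "b \<in> S \<union> ES")
      case True
      then show ?thesis using card1[OF True] by (simp add: k_def)
    next
      case False
      have "occ b \<subseteq> fans b \<union> {a \<in> Q. fi a \<in> ES \<and> se a = b}"
      proof
        fix a assume a: "a \<in> occ b"
        then have aN: "a < N" and Ma: "M a = Some b" by (auto simp: occ_def)
        show "a \<in> fans b \<union> {a \<in> Q. fi a \<in> ES \<and> se a = b}"
        proof (cases "a \<in> Q")
          case True
          then have "se a = b" using Ma aN by (simp add: M_def)
          moreover have "fi a \<in> ES"
            using fi_in[OF aN] se_vertex[OF aN] \<open>b \<in> VS \<union> ES\<close> \<open>se a = b\<close> by blast
          ultimately show ?thesis using True by simp
        next
          case False
          then show ?thesis using Ma aN by (simp add: M_def fans_def)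
        qed
      qed
      then have "card (occ b) \<le> card (fans b \<union> {a \<in> Q. fi a \<in> ES \<and> se a = b})"
        using finQ by (intro card_mono) auto
      also have "\<dots> \<le> card (fans b) + inn b"
        unfolding inn_def by (rule card_Un_le)
      finally have "k b \<le> 1 + inn b" using card_fans[OF True] by (simp add: k_def)
      moreover have "b \<in> VS - S" using False \<open>b \<in> VS \<union> ES\<close> by blast
      ultimately show ?thesis using price_vertex[of b] by simp
    qed
  next
    case False
    have "k b * pr ! b = 0"
    proof (cases "occ b = {}")
      case False
      then obtain a where aN: "a < N" and Ma: "M a = Some b" by (auto simp: occ_def)
      have "fi a \<noteq> b" using fi_in[OF aN] \<open>b \<notin> VS \<union> ES\<close> by blast
      then have "se a = b" using Ma aN by (simp add: M_def split: if_splits)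
      then have "pr ! b = 0"
        using fi_in[OF aN] se_vertex[OF aN] se_edge[OF aN] \<open>b \<notin> VS \<union> ES\<close> by auto
      then show ?thesis by simp
    qed (simp add: k_def)
    then show ?thesis using \<open>b \<notin> VS \<union> ES\<close> by simp
  qed
  have "(\<Sum>b<length pr. k b * pr ! b) \<le> (\<Sum>b<length pr. if b \<in> VS - S then 1 + inn b else 0)"
    by (intro sum_mono bound)
  also have "\<dots> = (\<Sum>b\<in>VS - S. 1 + inn b)"
    using item_bound finite_VS by (intro sum.mono_neutral_cong_right) auto
  also have "\<dots> = card (VS - S) + (\<Sum>b\<in>VS - S. inn b)"
    by (simp add: sum_Suc)
  \<comment> \<open>People received at different vertices are different, and all of them are chosen
    fans \<open>q e\<close> of edges, hence at most \<open>card ES\<close> many.\<close>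
  also have "(\<Sum>b\<in>VS - S. inn b) = card (\<Union>b\<in>VS - S. {a \<in> Q. fi a \<in> ES \<and> se a = b})"
    unfolding inn_def using finite_VS finQ by (intro card_UN_disjoint[symmetric]) auto
  also have "\<dots> \<le> card (q ` ES)"
    using Q finite_ES by (intro card_mono) auto
  also have "\<dots> \<le> card ES" using finite_ES by (rule card_image_le)
  finally have "(\<Sum>b<length pr. k b * pr ! b) \<le> card (VS - S) + card ES" by simp
  moreover have "card (VS - S) + card S = card VS"
    using S(1) finite_VS by (simp add: card_Diff_subset card_mono finite_subset)
  ultimately have "(\<Sum>b<length pr. k b * pr ! b) + card S \<le> card VS + card ES" by linarith
  moreover have "perfect_augmentation G k"
    unfolding perfect_augmentation_def using popular perfect by blast
  ultimately show ?thesis by blast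
qed

text \<open>\<open>P\<close> are the pushing vertices, \<open>bad\<close> the edges that keep both
  fans. A vertex outside \<open>P\<close> pays for its second fan and for everyone it receives, a
  bad edge pays 2, and every other edge sends somebody to a vertex outside \<open>P\<close>. So the
  cost is at least \<open>card (VS - P) + card ES + card bad\<close>, and the surplus
  \<open>card bad\<close> allows one endpoint of each bad edge to be deleted from
  \<open>P\<close>.\<close>

lemma independent_of_augmentation:
  assumes "perfect_augmentation G k"
  shows "\<exists>S. S \<subseteq> VS \<and> (\<forall>e\<in>ES. \<not> ends e \<subseteq> S) \<and>
    card VS + card ES \<le> (\<Sum>b<length pr. k b * pr ! b) + card S"
proof -
  obtain M where pop: "popular G (\<lambda>b. 1 + k b) M" and perf: "perfect G M"
    using assms by (auto simp: perfect_augmentation_def)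
  have M: "matching G (\<lambda>b. 1 + k b) M" using pop by (simp add: popular_def)
  have cases: "M a = Some (fi a) \<or> M a = Some (se a)" if "a < N" for a
  proof -
    have "M a \<noteq> None" using perf that by (auto simp: perfect_def)
    then show ?thesis by (cases rule: matching_cases[OF M that]) auto
  qed
  define occ where "occ b = {a. a < N \<and> M a = Some b}" for b
  have fin [simp]: "finite (occ b)" for b by (simp add: occ_def)
  have occ: "card (occ b) \<le> 1 + k b" if "b < length pr" for b
    using M that unfolding matching_iff length_prices occ_def by blast
  define P where "P = {b \<in> VS. \<exists>a\<in>fans b. M a \<noteq> Some b}"
  define bad where "bad = {e \<in> ES. \<forall>a\<in>fans e. M a = Some e}"
  define inn where "inn b = card {a \<in> occ b. fi a \<in> ES}" for b
  \<comment> \<open>A pushing vertex is held by its own first-choosers only, by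
    \<open>popular_second_choice\<close>, and these are not fans of an edge.\<close>
  have noin: "{a \<in> occ b. fi a \<in> ES} = {}" if b: "b \<in> P" for b
  proof -
    obtain a where a: "a < N" "fi a = b" "M a \<noteq> Some (fi a)" using b by (auto simp: P_def fans_def)
    have "fi a' = b" if "a' \<in> occ b" for a'
      using popular_second_choice[OF pop _ a(1,3), of a'] that a(2) by (auto simp: occ_def)
    then show ?thesis using b disjoint by (auto simp: P_def)
  qed
  have v: "1 + inn b \<le> k b * pr ! b" if b: "b \<in> VS - P" for b
  proof -
    have "fans b \<union> {a \<in> occ b. fi a \<in> ES} \<subseteq> occ b" using b by (auto simp: P_def fans_def occ_def)
    then have "card (fans b \<union> {a \<in> occ b. fi a \<in> ES}) \<le> card (occ b)" by (intro card_mono) auto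
    moreover have "card (fans b \<union> {a \<in> occ b. fi a \<in> ES}) = card (fans b) + inn b"
      unfolding inn_def using b disjoint by (intro card_Un_disjoint) (auto simp: fans_def)
    ultimately show ?thesis
      using card_fans[of b] b occ[of b] item_bound[of b] price_vertex[of b] by auto
  qed
  have e: "2 \<le> k b * pr ! b" if b: "b \<in> bad" for b
  proof -
    have "card (fans b) \<le> card (occ b)"
      using b by (intro card_mono) (auto simp: bad_def fans_def occ_def)
    then show ?thesis
      using card_fans[of b] b occ[of b] item_bound[of b] price_edge[of b] by (auto simp: bad_def)
  qed
  have finP: "finite P" and finbad: "finite bad"
    using finite_VS finite_ES by (auto simp: P_def bad_def)
  have "\<exists>a\<in>fans e. M a = Some (se a)" if "e \<in> ES - bad" for e
    using that cases by (fastforce simp: bad_def fans_def)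
  then obtain q where q: "\<And>e. e \<in> ES - bad \<Longrightarrow> q e \<in> fans e \<and> M (q e) = Some (se (q e))" by metis
  \<comment> \<open>Different edges have different fans, so choosing one pushed fan for each edge
    outside \<open>bad\<close> is injective.\<close>
  have "card (ES - bad) \<le> card (\<Union>b\<in>VS. {a \<in> occ b. fi a \<in> ES})"
  proof (rule card_inj_on_le)
    show "inj_on q (ES - bad)"
    proof (rule inj_onI)
      fix x y assume "x \<in> ES - bad" "y \<in> ES - bad" "q x = q y"
      then show "x = y" using q[of x] q[of y] by (simp add: fans_def)
    qed
    show "q ` (ES - bad) \<subseteq> (\<Union>b\<in>VS. {a \<in> occ b. fi a \<in> ES})"
    proof
      fix x assume "x \<in> q ` (ES - bad)"
      then obtain e where "e \<in> ES - bad" "x = q e" by auto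
      with q[of e] se_edge[of x] show "x \<in> (\<Union>b\<in>VS. {a \<in> occ b. fi a \<in> ES})"
        by (auto simp: fans_def occ_def)
    qed
  qed (use finite_VS in auto)
  also have "\<dots> = (\<Sum>b\<in>VS. inn b)"
    unfolding inn_def using finite_VS by (intro card_UN_disjoint) (auto simp: occ_def)
  also have "\<dots> = (\<Sum>b\<in>VS - P. inn b)"
    using finite_VS noin by (intro sum.mono_neutral_right) (auto simp: inn_def)
  finally have 1: "card (ES - bad) \<le> (\<Sum>b\<in>VS - P. inn b)" .
  have "card (VS - P) + (\<Sum>b\<in>VS - P. inn b) + 2 * card bad = (\<Sum>b\<in>VS - P. 1 + inn b) + (\<Sum>b\<in>bad. 2)"
    by (simp add: sum_Suc)
  also have "\<dots> \<le> (\<Sum>b\<in>VS - P. k b * pr ! b) + (\<Sum>b\<in>bad. k b * pr ! b)"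
    by (intro add_mono sum_mono v e)
  also have "\<dots> = (\<Sum>b\<in>(VS - P) \<union> bad. k b * pr ! b)"
    using finite_VS finbad disjoint by (intro sum.union_disjoint[symmetric]) (auto simp: bad_def)
  also have "\<dots> \<le> (\<Sum>b<length pr. k b * pr ! b)"
    using item_bound by (intro sum_mono2) (auto simp: bad_def)
  finally have cost: "card (VS - P) + card (ES - bad) + 2 * card bad \<le> (\<Sum>b<length pr. k b * pr ! b)"
    using 1 by simp
  have "P \<subseteq> VS" "bad \<subseteq> ES" by (auto simp: P_def bad_def)
  then have c: "card (VS - P) + card P = card VS" "card (ES - bad) + card bad = card ES"
    using finite_VS finite_ES finP finbad by (simp_all add: card_Diff_subset card_mono)
  \<comment> \<open>One endpoint of each edge, to be removed when the edge is bad. All other edges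
    have an endpoint that receives somebody and so lies outside \<open>P\<close>.\<close>
  define x where "x e = (SOME u. u \<in> ends e)" for e
  have x: "x e \<in> ends e" if "e \<in> ES" for e
  proof -
    have "fans e \<noteq> {}" using card_fans[of e] that by auto
    then have "\<exists>u. u \<in> ends e" unfolding ends_def by blast
    then show ?thesis unfolding x_def by (rule someI_ex)
  qed
  let ?S = "P - x ` bad"
  have "\<not> ends e \<subseteq> ?S" if e: "e \<in> ES" for e
  proof
    assume sub: "ends e \<subseteq> ?S"
    have "e \<in> bad"
    proof (rule ccontr)
      assume "e \<notin> bad"
      then have qe: "q e \<in> fans e" "M (q e) = Some (se (q e))" using q[of e] e by simp_all
      then have "q e \<in> {a \<in> occ (se (q e)). fi a \<in> ES}" using e by (simp add: occ_def fans_def)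
      moreover have "se (q e) \<in> P" using sub qe(1) unfolding ends_def by blast
      ultimately show False using noin by blast
    qed
    then show False using x[OF e] sub by blast
  qed
  moreover have "card P \<le> card ?S + card bad"
  proof -
    have "card P \<le> card (?S \<union> x ` bad)" using finP finbad by (intro card_mono) blast+
    also have "\<dots> \<le> card ?S + card (x ` bad)" by (rule card_Un_le)
    also have "card (x ` bad) \<le> card bad" using finbad by (rule card_image_le)
    finally show ?thesis by simp
  qed
  moreover have "?S \<subseteq> VS" using \<open>P \<subseteq> VS\<close> by blast
  moreover have "card VS + card ES \<le> (\<Sum>b<length pr. k b * pr ! b) + card ?S"
    using cost c \<open>card P \<le> card ?S + card bad\<close> by linarith
  ultimately show ?thesis by blast
qed

text \<open>Stating the budget by a sum avoids truncated subtraction in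
  \<open>card VS + card ES - K\<close>.\<close>

theorem augmentation_iff_independent:
  assumes "\<beta> + K = card VS + card ES"
  shows "(\<exists>k. perfect_augmentation G k \<and>
      augmentation_cost G (cost_of (gadget_input D pr)) k \<le> of_nat \<beta>) \<longleftrightarrow>
    (\<exists>S. S \<subseteq> VS \<and> K \<le> card S \<and> (\<forall>e\<in>ES. \<not> ends e \<subseteq> S))" (is "?l = ?r")
proof
  assume ?l
  then obtain k where k: "perfect_augmentation G k" "(\<Sum>b<length pr. k b * pr ! b) \<le> \<beta>"
    unfolding cost_eq of_nat_le_iff by blast
  from independent_of_augmentation[OF k(1)] obtain S where "S \<subseteq> VS" "\<forall>e\<in>ES. \<not> ends e \<subseteq> S"
    "card VS + card ES \<le> (\<Sum>b<length pr. k b * pr ! b) + card S" by blast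
  then show ?r using k(2) assms by (intro exI[of _ S]) simp
next
  assume ?r
  then obtain S where S: "S \<subseteq> VS" "K \<le> card S" "\<And>e. e \<in> ES \<Longrightarrow> \<not> ends e \<subseteq> S" by blast
  from augmentation_of_independent[OF S(1,3)] obtain k where
    "perfect_augmentation G k" "(\<Sum>b<length pr. k b * pr ! b) + card S \<le> card VS + card ES" by blast
  then show ?l unfolding cost_eq of_nat_le_iff using S(2) assms by (intro exI[of _ k]) auto
qed

end

section \<open>Local constraint systems\<close>

text \<open>A constraint \<open>(U, H, V)\<close> at position \<open>p\<close> restricts the value at \<open>p\<close> by \<open>U\<close>, the values at
  \<open>p\<close> and \<open>p + 1\<close> by \<open>H\<close>, and the values at \<open>p\<close> and \<open>p + W\<close> by \<open>V\<close>: for row-major numbering,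
  \<open>p + W\<close> is the position below \<open>p\<close> in a grid of width \<open>W\<close>.\<close>

type_synonym constraint = "(nat \<Rightarrow> bool) \<times> (nat \<Rightarrow> nat \<Rightarrow> bool) \<times> (nat \<Rightarrow> nat \<Rightarrow> bool)"

definition satisfies :: "nat \<Rightarrow> nat \<Rightarrow> constraint list \<Rightarrow> (nat \<Rightarrow> nat) \<Rightarrow> bool" where
  "satisfies g W cs \<tau> \<longleftrightarrow> (\<forall>p<length cs. case cs ! p of (U, H, V) \<Rightarrow>
     \<tau> p < g \<and> U (\<tau> p) \<and> H (\<tau> p) (\<tau> (p + 1)) \<and> V (\<tau> p) (\<tau> (p + W)))"

text \<open>A relation reaching past the last position would concern a cell without vertices, which
  no edge gadget can express.\<close>

definition inside_grid :: "nat \<Rightarrow> constraint list \<Rightarrow> bool" where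
  "inside_grid W cs \<longleftrightarrow> (\<forall>p<length cs. case cs ! p of (U, H, V) \<Rightarrow>
     (p + 1 \<ge> length cs \<longrightarrow> H = (\<lambda>_ _. True)) \<and> (p + W \<ge> length cs \<longrightarrow> V = (\<lambda>_ _. True)))"

text \<open>Direction 0 makes the values of one cell a clique and turns each value violating
  \<open>U\<close> into a loop. Both orders of a pair in the clique occur; the parallel edges are
  counted in the budget like any other.\<close>

definition conflicts :: "nat \<Rightarrow> constraint \<Rightarrow> (nat \<times> nat \<times> nat) list" where
  "conflicts g c = (case c of (U, H, V) \<Rightarrow>
     filter (\<lambda>(d, i, j). if d = 0 then i \<noteq> j \<or> \<not> U i else if d = 1 then \<not> H i j else \<not> V i j)
       (List.product [0..<3] (List.product [0..<g] [0..<g])))"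

lemma conflicts_iff:
  "(d, i, j) \<in> set (conflicts g (U, H, V)) \<longleftrightarrow> i < g \<and> j < g \<and> d < 3 \<and>
     (if d = 0 then i \<noteq> j \<or> \<not> U i else if d = 1 then \<not> H i j else \<not> V i j)"
  by (auto simp: conflicts_def)

lemma length_conflicts: "length (conflicts g c) \<le> 3 * (g * g)"
  unfolding conflicts_def
  by (cases c) (auto intro!: order_trans[OF length_filter_le] simp: length_product)

text \<open>Item \<open>s + 2 ^ w * P\<close> is slot \<open>s\<close> of position \<open>P\<close>, where positions are counted from 1, so that
  in binary the digits of \<open>P\<close> simply follow \<open>w\<close> digits for \<open>s\<close>. Slot 0 is free of charge, the
  next \<open>g\<close> slots are the possible values at \<open>P\<close>, the remaining ones the conflicts.\<close>

definition slot_bits :: "nat \<Rightarrow> nat" where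
  "slot_bits g = 1 + g + 3 * (g * g)"

text \<open>Taking the number of slots itself as exponent is generous, but a constant for a fixed
  machine, and it spares logarithms.\<close>

lemma slot_bits: "1 + g + length (conflicts g c) < 2 ^ slot_bits g"
proof -
  have "1 + g + length (conflicts g c) \<le> slot_bits g"
    using length_conflicts[of g c] by (simp add: slot_bits_def)
  then show ?thesis using less_exp[of "slot_bits g"] by (rule le_less_trans)
qed

definition item_of :: "nat \<Rightarrow> nat \<Rightarrow> nat \<Rightarrow> nat" where
  "item_of g P s = s + 2 ^ slot_bits g * P"

lemma item_of_inject:
  assumes "s < 2 ^ slot_bits g" "s' < 2 ^ slot_bits g"
  shows "item_of g P s = item_of g P' s' \<longleftrightarrow> P = P' \<and> s = s'"
proof
  assume eq: "item_of g P s = item_of g P' s'"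
  then have "item_of g P s div 2 ^ slot_bits g = item_of g P' s' div 2 ^ slot_bits g"
    "item_of g P s mod 2 ^ slot_bits g = item_of g P' s' mod 2 ^ slot_bits g" by simp_all
  then show "P = P' \<and> s = s'" using assms by (simp add: item_of_def)
qed simp

definition offset :: "nat \<Rightarrow> nat \<Rightarrow> nat" where
  "offset W d = (if d = 0 then 0 else if d = 1 then 1 else W)"

lemma offset_0 [simp]: "offset W 0 = 0"
  by (simp add: offset_def)

text \<open>In a pair \<open>(d, s)\<close> the direction \<open>d = 0, 1, 2\<close> stands for position \<open>P\<close>, \<open>P + 1\<close>, \<open>P + W\<close>,
  and \<open>s\<close> is a slot of that position.\<close>

definition block :: "nat \<Rightarrow> constraint \<Rightarrow> (nat \<times> (nat \<times> nat) \<times> (nat \<times> nat)) list" where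
  "block g c = map (\<lambda>i. (1 + i, (0, 0), (0, 0))) [0..<g] @
     map (\<lambda>l. case conflicts g c ! l of (d, i, j) \<Rightarrow> (1 + g + l, (0, 1 + i), (d, 1 + j)))
       [0..<length (conflicts g c)]"

definition place :: "nat \<Rightarrow> nat \<Rightarrow> nat \<Rightarrow> nat \<times> (nat \<times> nat) \<times> (nat \<times> nat) \<Rightarrow> nat \<times> nat \<times> nat" where
  "place g W P = (\<lambda>(s, (d1, s1), (d2, s2)).
     (item_of g P s, item_of g (P + offset W d1) s1, item_of g (P + offset W d2) s2))"

definition grid_entries :: "nat \<Rightarrow> nat \<Rightarrow> constraint list \<Rightarrow> (nat \<times> nat \<times> nat) list" where
  "grid_entries g W cs = concat (map (\<lambda>(P, c). map (place g W P) (block g c)) (List.enumerate 1 cs))"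

text \<open>The slots behind the last conflict pad the block to a power of two, so that one price
  string serves every position, whatever its constraint.\<close>

definition price_block :: "nat \<Rightarrow> nat list" where
  "price_block g = map (\<lambda>s. if s = 0 then 0 else if s \<le> g then 1 else 2) [0..<2 ^ slot_bits g]"

text \<open>Positions are counted from 1, so reaching the last one takes one block more than there
  are constraints; block 0 is padding.\<close>

definition grid_prices :: "nat \<Rightarrow> constraint list \<Rightarrow> nat list" where
  "grid_prices g cs = concat (replicate (length cs + 1) (price_block g))"

text \<open>All vertices and edges of a cell, less the one vertex that the independent set takes
  there.\<close>

definition grid_budget :: "nat \<Rightarrow> constraint list \<Rightarrow> nat" where
  "grid_budget g cs = (\<Sum>c\<leftarrow>cs. g - 1 + length (conflicts g c))"

lemma length_price_block [simp]: "length (price_block g) = 2 ^ slot_bits g"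
  by (simp add: price_block_def)

lemma length_grid_prices: "length (grid_prices g cs) = 2 ^ slot_bits g * (length cs + 1)"
  by (simp add: grid_prices_def length_concat sum_list_replicate)

lemma nth_concat_replicate:
  "s < length xs \<Longrightarrow> P < n \<Longrightarrow> concat (replicate n xs) ! (s + length xs * P) = xs ! s"
proof (induction n arbitrary: P)
  case (Suc n)
  then show ?case
    by (cases P) (auto simp: nth_append)
qed simp

lemma grid_prices_nth:
  assumes "s < 2 ^ slot_bits g" "P \<le> length cs"
  shows "grid_prices g cs ! item_of g P s = (if s = 0 then 0 else if s \<le> g then 1 else 2)"
  using nth_concat_replicate[of s "price_block g" P "length cs + 1"] assms
  by (simp add: grid_prices_def item_of_def price_block_def)

definition vertex_items :: "nat \<Rightarrow> constraint list \<Rightarrow> nat set" where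
  "vertex_items g cs = (\<lambda>(p, i). item_of g (p + 1) (1 + i)) ` ({..<length cs} \<times> {..<g})"

definition edge_items :: "nat \<Rightarrow> constraint list \<Rightarrow> nat set" where
  "edge_items g cs = (\<lambda>(p, l). item_of g (p + 1) (1 + g + l)) `
     (SIGMA p:{..<length cs}. {..<length (conflicts g (cs ! p))})"

lemma block_slot: "x \<in> set (block g c) \<Longrightarrow> fst x < 2 ^ slot_bits g"
  using slot_bits[of g c] by (auto simp: block_def split: prod.splits)

lemma distinct_block: "distinct (map fst (block g c))"
proof -
  have "map fst (block g c) =
      map (\<lambda>i. 1 + i) [0..<g] @ map (\<lambda>l. 1 + g + l) [0..<length (conflicts g c)]"
    by (auto simp: block_def split: prod.splits)
  also have "\<dots> = [1..<1 + g + length (conflicts g c)]"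
    by (rule nth_equalityI) (auto simp: nth_append simp del: upt_Suc)
  finally show ?thesis by (metis distinct_upt)
qed

lemma in_grid_entries:
  "x \<in> set (grid_entries g W cs) \<longleftrightarrow> (\<exists>p<length cs. x \<in> place g W (p + 1) ` set (block g (cs ! p)))"
proof -
  have "x \<in> set (grid_entries g W cs) \<longleftrightarrow>
      (\<exists>y\<in>set (List.enumerate 1 cs). x \<in> place g W (fst y) ` set (block g (snd y)))"
    by (simp add: grid_entries_def case_prod_beta)
  also have "\<dots> \<longleftrightarrow> (\<exists>p<length cs. x \<in> place g W (p + 1) ` set (block g (cs ! p)))"
  proof
    assume "\<exists>y\<in>set (List.enumerate 1 cs). x \<in> place g W (fst y) ` set (block g (snd y))"
    then obtain y where "y \<in> set (List.enumerate 1 cs)" "x \<in> place g W (fst y) ` set (block g (snd y))"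
      by blast
    then show "\<exists>p<length cs. x \<in> place g W (p + 1) ` set (block g (cs ! p))"
      unfolding in_set_enumerate_eq by (intro exI[of _ "fst y - 1"]) auto
  next
    assume "\<exists>p<length cs. x \<in> place g W (p + 1) ` set (block g (cs ! p))"
    then obtain p where "p < length cs" "x \<in> place g W (p + 1) ` set (block g (cs ! p))" by blast
    then show "\<exists>y\<in>set (List.enumerate 1 cs). x \<in> place g W (fst y) ` set (block g (snd y))"
      by (intro bexI[of _ "(p + 1, cs ! p)"]) (simp_all add: in_set_enumerate_eq)
  qed
  finally show ?thesis .
qed

lemma in_grid_entriesI:
  "p < length cs \<Longrightarrow> x \<in> set (block g (cs ! p)) \<Longrightarrow> place g W (p + 1) x \<in> set (grid_entries g W cs)"
  unfolding in_grid_entries by blast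

text \<open>The bound carries the induction: the items of position \<open>P\<close> lie in an
  interval of length \<open>2 ^ slot_bits g\<close> that starts where the previous ones end.\<close>

lemma distinct_grid_entries:
  "distinct (map fst (grid_entries g W cs)) \<and>
   (\<forall>b\<in>set (map fst (grid_entries g W cs)). b < 2 ^ slot_bits g * (length cs + 1))"
proof (induction cs rule: rev_induct)
  case (snoc c cs)
  let ?P = "1 + length cs"
  have e: "grid_entries g W (cs @ [c]) = grid_entries g W cs @ map (place g W ?P) (block g c)"
    by (simp add: grid_entries_def enumerate_append_eq)
  have f: "map fst (map (place g W ?P) (block g c)) = map (item_of g ?P) (map fst (block g c))"
    by (auto simp: place_def)
  have "inj_on (item_of g ?P) (set (map fst (block g c)))"
    by (auto simp: inj_on_def item_of_def)
  then have d: "distinct (map (item_of g ?P) (map fst (block g c)))"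
    using distinct_block[of g c] by (subst distinct_map) blast
  have r: "2 ^ slot_bits g * ?P \<le> b \<and> b < 2 ^ slot_bits g * (?P + 1)"
    if "b \<in> set (map (item_of g ?P) (map fst (block g c)))" for b
  proof -
    have "b \<in> (\<lambda>x. item_of g ?P (fst x)) ` set (block g c)"
      using that by (simp add: image_image)
    then obtain x where "x \<in> set (block g c)" "b = item_of g ?P (fst x)" by blast
    then show ?thesis using block_slot[of x g c] by (simp add: item_of_def)
  qed
  show ?case
    unfolding e map_append distinct_append f set_append
  proof (intro conjI ballI)
    show "set (map fst (grid_entries g W cs)) \<inter> set (map (item_of g ?P) (map fst (block g c))) = {}"
      using r snoc.IH by fastforce
    fix b assume "b \<in> set (map fst (grid_entries g W cs)) \<union> set (map (item_of g ?P) (map fst (block g c)))"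
    then show "b < 2 ^ slot_bits g * (length (cs @ [c]) + 1)"
    proof
      assume "b \<in> set (map fst (grid_entries g W cs))"
      then have "b < 2 ^ slot_bits g * (length cs + 1)" using snoc.IH by blast
      then show ?thesis by simp
    next
      assume "b \<in> set (map (item_of g ?P) (map fst (block g c)))"
      from r[OF this] show ?thesis by simp
    qed
  qed (use snoc.IH d in blast)+
qed (simp add: grid_entries_def)

section \<open>Solutions as independent sets with one vertex per cell\<close>

locale grid =
  fixes g W :: nat and cs :: "constraint list"
  assumes inside: "inside_grid W cs" and g: "g \<ge> 1"
begin

abbreviation "D \<equiv> grid_entries g W cs"
abbreviation "VS \<equiv> vertex_items g cs"
abbreviation "ES \<equiv> edge_items g cs"

lemma slot_bounds:
  "i < g \<Longrightarrow> 1 + i < 2 ^ slot_bits g"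
  "l < length (conflicts g c) \<Longrightarrow> 1 + g + l < 2 ^ slot_bits g"
  using slot_bits[of g c] by linarith+

lemma entry_cases:
  assumes "(b, s, t) \<in> set D"
  obtains (vertex) p i where "p < length cs" "i < g" "b = item_of g (p + 1) (1 + i)"
      "s = item_of g (p + 1) 0" "t = item_of g (p + 1) 0"
  | (edge) p l d i j where "p < length cs" "l < length (conflicts g (cs ! p))"
      "conflicts g (cs ! p) ! l = (d, i, j)" "b = item_of g (p + 1) (1 + g + l)"
      "s = item_of g (p + 1) (1 + i)" "t = item_of g (p + offset W d + 1) (1 + j)"
proof -
  obtain p x where p: "p < length cs" "x \<in> set (block g (cs ! p))" "(b, s, t) = place g W (p + 1) x"
    using assms unfolding in_grid_entries by blast
  then consider i where "i < g" "x = (1 + i, (0, 0), (0, 0))"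
    | l where "l < length (conflicts g (cs ! p))"
      "x = (case conflicts g (cs ! p) ! l of (d, i, j) \<Rightarrow> (1 + g + l, (0, 1 + i), (d, 1 + j)))"
    by (auto simp: block_def)
  then show ?thesis
  proof cases
    case 1
    then show ?thesis using that(1)[of p i] p by (simp add: place_def)
  next
    case 2
    obtain d i j where "conflicts g (cs ! p) ! l = (d, i, j)" by (metis prod_cases3)
    then show ?thesis using that(2)[of p l d i j] p 2 by (simp add: place_def)
  qed
qed

lemma vertex_entry:
  assumes "p < length cs" "i < g"
  shows "(item_of g (p + 1) (1 + i), item_of g (p + 1) 0, item_of g (p + 1) 0) \<in> set D"
proof -
  have "(1 + i, (0, 0), (0, 0)) \<in> set (block g (cs ! p))" using assms by (auto simp: block_def)
  from in_grid_entriesI[OF assms(1) this] show ?thesis by (simp add: place_def)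
qed

lemma edge_entry:
  assumes "p < length cs" "l < length (conflicts g (cs ! p))" "conflicts g (cs ! p) ! l = (d, i, j)"
  shows "(item_of g (p + 1) (1 + g + l), item_of g (p + 1) (1 + i),
    item_of g (p + offset W d + 1) (1 + j)) \<in> set D"
proof -
  have "(1 + g + l, (0, 1 + i), (d, 1 + j)) \<in> set (block g (cs ! p))"
    using assms by (force simp: block_def)
  from in_grid_entriesI[OF assms(1) this] show ?thesis by (simp add: place_def)
qed

text \<open>Beyond the end of the list \<open>inside_grid\<close> makes the relations trivial, and a
  trivial relation has no conflicts.\<close>

lemma conflict_inside:
  assumes "p < length cs" "(d, i, j) \<in> set (conflicts g (cs ! p))"
  shows "i < g" "j < g" "p + offset W d < length cs"
proof -
  obtain U H V where c: "cs ! p = (U, H, V)" by (metis prod_cases3)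
  show "i < g" "j < g" using assms(2) by (simp_all add: c conflicts_iff)
  show "p + offset W d < length cs"
  proof (rule ccontr)
    assume "\<not> p + offset W d < length cs"
    then show False using inside assms c
      by (auto simp: inside_grid_def conflicts_iff offset_def split: if_splits)
  qed
qed

lemma VS_iff: "b \<in> VS \<longleftrightarrow> (\<exists>p i. p < length cs \<and> i < g \<and> b = item_of g (p + 1) (1 + i))"
  by (auto simp: vertex_items_def)

lemma ES_iff: "b \<in> ES \<longleftrightarrow>
    (\<exists>p l. p < length cs \<and> l < length (conflicts g (cs ! p)) \<and> b = item_of g (p + 1) (1 + g + l))"
  by (auto simp: edge_items_def)

lemma VS_ES_disjoint: "VS \<inter> ES = {}"
proof -
  have False if "p < length cs" "i < g" "q < length cs" "l < length (conflicts g (cs ! q))"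
    "item_of g (p + 1) (1 + i) = item_of g (q + 1) (1 + g + l)" for p q i l
    using that item_of_inject[OF slot_bounds(1)[of i] slot_bounds(2)[of l "cs ! q"], of "p + 1" "q + 1"]
    by simp
  then show ?thesis unfolding disjoint_iff VS_iff ES_iff by metis
qed

lemma bottom_notin: "item_of g (p + 1) 0 \<notin> VS \<union> ES"
proof
  assume "item_of g (p + 1) 0 \<in> VS \<union> ES"
  then obtain q s where "s < 2 ^ slot_bits g" "s > 0" "item_of g (p + 1) 0 = item_of g (q + 1) s"
    unfolding Un_iff VS_iff ES_iff using slot_bounds by (metis add_gr_0 less_numeral_extra(1))
  then show False using item_of_inject[of 0 g s "p + 1" "q + 1"] by simp
qed

lemma item_bound:
  assumes "p < length cs" "s < 2 ^ slot_bits g"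
  shows "item_of g (p + 1) s < length (grid_prices g cs)"
proof -
  have "item_of g (p + 1) s < 2 ^ slot_bits g * (p + 2)" using assms(2) by (simp add: item_of_def)
  also have "\<dots> \<le> 2 ^ slot_bits g * (length cs + 1)" using assms(1) by (intro mult_le_mono) auto
  finally show ?thesis by (simp add: length_grid_prices)
qed

sublocale gadgets D "grid_prices g cs" VS ES
proof
  show "distinct (map fst D)" using distinct_grid_entries by blast
  show "VS \<inter> ES = {}" by (rule VS_ES_disjoint)
  show "fst ` set D = VS \<union> ES"
  proof (intro equalityI subsetI)
    fix b assume "b \<in> fst ` set D"
    then obtain s t where "(b, s, t) \<in> set D" by auto
    then show "b \<in> VS \<union> ES"
      by (cases rule: entry_cases) (unfold Un_iff VS_iff ES_iff, blast+)
  next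
    fix b assume "b \<in> VS \<union> ES"
    then consider p i where "p < length cs" "i < g" "b = item_of g (p + 1) (1 + i)"
      | p l where "p < length cs" "l < length (conflicts g (cs ! p))" "b = item_of g (p + 1) (1 + g + l)"
      unfolding Un_iff VS_iff ES_iff by blast
    then show "b \<in> fst ` set D"
    proof cases
      case 1
      then show ?thesis using vertex_entry[of p i] by force
    next
      case 2
      obtain d i j where "conflicts g (cs ! p) ! l = (d, i, j)" by (metis prod_cases3)
      then show ?thesis using edge_entry[of p l d i j] 2 by force
    qed
  qed
  fix b s t assume e: "(b, s, t) \<in> set D"
  show "s \<notin> VS \<union> ES \<and> t \<notin> VS \<union> ES \<and> grid_prices g cs ! s = 0 \<and> grid_prices g cs ! t = 0 \<and>
      grid_prices g cs ! b = 1" if b: "b \<in> VS"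
    using e
  proof (cases rule: entry_cases)
    case (vertex p i)
    then show ?thesis
      using bottom_notin[of p] grid_prices_nth[of 0 g "p + 1" cs]
        grid_prices_nth[OF slot_bounds(1)[of i], of "p + 1" cs] by simp
  next
    case (edge p l d i j)
    then have "b \<in> ES" unfolding ES_iff by blast
    then show ?thesis using b VS_ES_disjoint by blast
  qed
  show "s \<in> VS \<and> t \<in> VS \<and> grid_prices g cs ! b = 2" if b: "b \<in> ES"
    using e
  proof (cases rule: entry_cases)
    case (vertex p i)
    then have "b \<in> VS" unfolding VS_iff by blast
    then show ?thesis using b VS_ES_disjoint by blast
  next
    case (edge p l d i j)
    have "(d, i, j) \<in> set (conflicts g (cs ! p))" using edge(2,3) nth_mem by metis
    from conflict_inside[OF edge(1) this] have "s \<in> VS" "t \<in> VS"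
      unfolding VS_iff edge(5,6) using edge(1) by blast+
    then show ?thesis
      using grid_prices_nth[OF slot_bounds(2)[OF edge(2)], of "p + 1" cs] edge(1,4) by simp
  qed
  show "b < length (grid_prices g cs) \<and> s < length (grid_prices g cs) \<and> t < length (grid_prices g cs)"
    using e
  proof (cases rule: entry_cases)
    case (vertex p i)
    then show ?thesis using item_bound[OF vertex(1) slot_bounds(1)[of i]] item_bound[of p 0] by simp
  next
    case (edge p l d i j)
    have "(d, i, j) \<in> set (conflicts g (cs ! p))" using edge(2,3) nth_mem by metis
    from conflict_inside[OF edge(1) this]
    show ?thesis unfolding edge(4-6)
      using item_bound[OF edge(1) slot_bounds(2)[OF edge(2)]] item_bound[OF edge(1) slot_bounds(1)]
        item_bound[OF _ slot_bounds(1)] by blast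
  qed
qed

lemma card_VS: "card VS = length cs * g"
proof -
  have "inj_on (\<lambda>(p, i). item_of g (p + 1) (1 + i)) ({..<length cs} \<times> {..<g})"
  proof (rule inj_onI)
    fix x y assume xy: "x \<in> {..<length cs} \<times> {..<g}" "y \<in> {..<length cs} \<times> {..<g}"
      "(\<lambda>(p, i). item_of g (p + 1) (1 + i)) x = (\<lambda>(p, i). item_of g (p + 1) (1 + i)) y"
    obtain p i p' i' where "x = (p, i)" "y = (p', i')" by force
    then show "x = y"
      using xy item_of_inject[OF slot_bounds(1)[of i] slot_bounds(1)[of i'], of "p + 1" "p' + 1"] by simp
  qed
  then show ?thesis by (simp add: vertex_items_def card_image card_cartesian_product)
qed

lemma card_ES: "card ES = (\<Sum>p<length cs. length (conflicts g (cs ! p)))"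
proof -
  have "inj_on (\<lambda>(p, l). item_of g (p + 1) (1 + g + l))
      (SIGMA p:{..<length cs}. {..<length (conflicts g (cs ! p))})"
  proof (rule inj_onI)
    fix x y assume xy: "x \<in> (SIGMA p:{..<length cs}. {..<length (conflicts g (cs ! p))})"
      "y \<in> (SIGMA p:{..<length cs}. {..<length (conflicts g (cs ! p))})"
      "(\<lambda>(p, l). item_of g (p + 1) (1 + g + l)) x = (\<lambda>(p, l). item_of g (p + 1) (1 + g + l)) y"
    obtain p i p' i' where "x = (p, i)" "y = (p', i')" by force
    then show "x = y"
      using xy item_of_inject[OF slot_bounds(2)[of i "cs ! p"] slot_bounds(2)[of i' "cs ! p'"],
          of "p + 1" "p' + 1"] by simp
  qed
  then show ?thesis by (simp add: edge_items_def card_image)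
qed

lemma budget: "grid_budget g cs + length cs = card VS + card ES"
proof -
  have "grid_budget g cs = (\<Sum>p<length cs. g - 1 + length (conflicts g (cs ! p)))"
    by (simp add: grid_budget_def sum_list_sum_nth atLeast0LessThan)
  then have "grid_budget g cs + length cs =
      (\<Sum>p<length cs. g - 1 + length (conflicts g (cs ! p)) + 1)"
    by (simp only: sum.distrib) simp
  also have "\<dots> = (\<Sum>p<length cs. g + length (conflicts g (cs ! p)))"
    using g by (intro sum.cong) auto
  also have "\<dots> = card VS + card ES" by (simp add: sum.distrib card_VS card_ES)
  finally show ?thesis .
qed

lemma ends_conflict:
  assumes "p < length cs" "(d, i, j) \<in> set (conflicts g (cs ! p))"
  shows "\<exists>e\<in>ES. ends e = {item_of g (p + 1) (1 + i), item_of g (p + offset W d + 1) (1 + j)}"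
proof -
  obtain l where l: "l < length (conflicts g (cs ! p))" "conflicts g (cs ! p) ! l = (d, i, j)"
    using assms(2) by (auto simp: in_set_conv_nth)
  have "item_of g (p + 1) (1 + g + l) \<in> ES" unfolding ES_iff using assms(1) l by blast
  with ends_eq[OF edge_entry[OF assms(1) l]] show ?thesis by blast
qed

text \<open>An edge is a pair of values ruled out by some constraint, so the vertices of the values
  \<open>\<tau> p\<close>, one in each cell, never contain all its ends.\<close>

lemma independent_of_satisfies:
  assumes \<tau>: "satisfies g W cs \<tau>"
  shows "\<exists>S. S \<subseteq> VS \<and> length cs \<le> card S \<and> (\<forall>e\<in>ES. \<not> ends e \<subseteq> S)"
proof -
  define v where "v p = item_of g (p + 1) (1 + \<tau> p)" for p
  have \<tau>g: "\<tau> p < g" if "p < length cs" for p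
    using \<tau> that by (auto simp: satisfies_def split: prod.splits)
  have "inj_on v {..<length cs}"
  proof (rule inj_onI)
    fix p q assume "p \<in> {..<length cs}" "q \<in> {..<length cs}" "v p = v q"
    then show "p = q"
      using item_of_inject[OF slot_bounds(1)[OF \<tau>g[of p]] slot_bounds(1)[OF \<tau>g[of q]], of "p + 1" "q + 1"]
      by (simp add: v_def)
  qed
  then have "card (v ` {..<length cs}) = length cs" by (simp add: card_image)
  moreover have "v ` {..<length cs} \<subseteq> VS" using \<tau>g unfolding v_def VS_iff subset_iff by blast
  moreover have "\<not> ends e \<subseteq> v ` {..<length cs}" if e: "e \<in> ES" for e
  proof
    assume sub: "ends e \<subseteq> v ` {..<length cs}"
    obtain p l where pl: "p < length cs" "l < length (conflicts g (cs ! p))" "e = item_of g (p + 1) (1 + g + l)"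
      using e unfolding ES_iff by blast
    obtain d i j where dij: "conflicts g (cs ! p) ! l = (d, i, j)" by (metis prod_cases3)
    then have c: "(d, i, j) \<in> set (conflicts g (cs ! p))" using pl(2) nth_mem by metis
    note ins = conflict_inside[OF pl(1) c]
    have mem: "i' = \<tau> q" if it: "item_of g (q + 1) (1 + i') \<in> v ` {..<length cs}" "i' < g" for q i'
    proof -
      obtain r where r: "r < length cs" "item_of g (q + 1) (1 + i') = v r" using it(1) by blast
      then show ?thesis
        using item_of_inject[OF slot_bounds(1)[OF it(2)] slot_bounds(1)[OF \<tau>g[OF r(1)]], of "q + 1" "r + 1"]
        by (simp add: v_def)
    qed
    have "item_of g (p + 1) (1 + i) \<in> v ` {..<length cs}"
      "item_of g (p + offset W d + 1) (1 + j) \<in> v ` {..<length cs}"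
      using sub unfolding pl(3) ends_eq[OF edge_entry[OF pl(1,2) dij]] by simp_all
    note ij = mem[OF this(1) ins(1)] mem[OF this(2) ins(2)]
    obtain U H V where UHV: "cs ! p = (U, H, V)" by (metis prod_cases3)
    have "U (\<tau> p)" "H (\<tau> p) (\<tau> (p + 1))" "V (\<tau> p) (\<tau> (p + W))"
      using \<tau>[unfolded satisfies_def, rule_format, OF pl(1)] UHV by simp_all
    then show False
      using c unfolding UHV conflicts_iff ij by (simp add: offset_def split: if_splits)
  qed
  ultimately show ?thesis by (intro exI[of _ "v ` {..<length cs}"]) simp
qed

text \<open>The clique on each cell admits at most one vertex of \<open>S\<close>, and
  \<open>S\<close> has at least as many elements as there are cells; hence every cell contains
  exactly one, which is the value of \<open>\<tau>\<close>.\<close>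

lemma satisfies_of_independent:
  assumes S: "S \<subseteq> VS" "length cs \<le> card S" "\<And>e. e \<in> ES \<Longrightarrow> \<not> ends e \<subseteq> S"
  shows "\<exists>\<tau>. satisfies g W cs \<tau>"
proof -
  have no_conflict: False if nc: "p < length cs" "(d, i, j) \<in> set (conflicts g (cs ! p))"
    "item_of g (p + 1) (1 + i) \<in> S" "item_of g (p + offset W d + 1) (1 + j) \<in> S" for p d i j
  proof -
    obtain e where "e \<in> ES" "ends e = {item_of g (p + 1) (1 + i), item_of g (p + offset W d + 1) (1 + j)}"
      using ends_conflict[OF nc(1,2)] by blast
    moreover from this(1) have "\<not> ends e \<subseteq> S" by (rule S(3))
    ultimately show False using nc(3,4) by simp
  qed
  \<comment> \<open>Division recovers the position; subtracting 1 undoes the counting from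
    1.\<close>
  define row where "row b = b div 2 ^ slot_bits g - 1" for b :: nat
  have row: "row (item_of g (p + 1) (1 + i)) = p" if i: "i < g" for p i
  proof -
    have "(1 + i + 2 ^ slot_bits g * (p + 1)) div 2 ^ slot_bits g = (p + 1) + (1 + i) div 2 ^ slot_bits g"
      by (rule div_mult_self2) simp
    then show ?thesis using slot_bounds(1)[OF i] by (simp add: row_def item_of_def)
  qed
  have "inj_on row S"
  proof (rule inj_onI)
    fix a b assume ab: "a \<in> S" "b \<in> S" "row a = row b"
    then have "a \<in> VS" "b \<in> VS" using S(1) by auto
    then obtain p i q j where v: "p < length cs" "i < g" "a = item_of g (p + 1) (1 + i)"
      "q < length cs" "j < g" "b = item_of g (q + 1) (1 + j)" unfolding VS_iff by blast
    then have pq: "p = q" using ab(3) row[of i p] row[of j q] by simp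
    have "i = j"
    proof (rule ccontr)
      assume "i \<noteq> j"
      moreover obtain U H V where "cs ! p = (U, H, V)" by (metis prod_cases3)
      ultimately have "(0, i, j) \<in> set (conflicts g (cs ! p))"
        using v(2,5) by (simp add: conflicts_iff)
      from no_conflict[OF v(1) this] show False using ab(1,2) v(3,6) pq by simp
    qed
    then show "a = b" using v pq by simp
  qed
  then have "card (row ` S) = card S" by (rule card_image)
  moreover have "row ` S \<subseteq> {..<length cs}"
  proof
    fix p assume "p \<in> row ` S"
    then obtain b where "b \<in> S" "p = row b" by blast
    moreover from this S(1) obtain q i where "q < length cs" "i < g" "b = item_of g (q + 1) (1 + i)"
      unfolding VS_iff subset_iff by blast
    ultimately show "p \<in> {..<length cs}" using row[of i q] by simp
  qed
  \<comment> \<open>An injective image inside the set of positions that is at least as large must be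
    all of it.\<close>
  ultimately have "row ` S = {..<length cs}"
    using S(2) by (intro card_seteq) auto
  have "\<exists>i<g. item_of g (p + 1) (1 + i) \<in> S" if p: "p < length cs" for p
  proof -
    have "p \<in> row ` S" using p \<open>row ` S = _\<close> by simp
    then obtain b where b: "b \<in> S" "row b = p" by blast
    then obtain q i where qi: "i < g" "b = item_of g (q + 1) (1 + i)" using S(1) unfolding VS_iff subset_iff by blast
    then have "q = p" using b(2) row[of i q] by simp
    then show ?thesis using b qi by blast
  qed
  then obtain \<tau> where \<tau>: "\<And>p. p < length cs \<Longrightarrow> \<tau> p < g \<and> item_of g (p + 1) (1 + \<tau> p) \<in> S" by metis
  have "satisfies g W cs \<tau>"
    unfolding satisfies_def
  proof (intro allI impI)
    fix p assume p: "p < length cs"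
    obtain U H V where c: "cs ! p = (U, H, V)" by (metis prod_cases3)
    have "U (\<tau> p)"
    proof (rule ccontr)
      assume "\<not> U (\<tau> p)"
      then have "(0, \<tau> p, \<tau> p) \<in> set (conflicts g (cs ! p))" using \<tau>[OF p] by (simp add: c conflicts_iff)
      from no_conflict[OF p this] show False using \<tau>[OF p] by (simp add: offset_def)
    qed
    moreover have "H (\<tau> p) (\<tau> (p + 1))"
    proof (cases "p + 1 < length cs")
      case True
      show ?thesis
      proof (rule ccontr)
        assume "\<not> H (\<tau> p) (\<tau> (p + 1))"
        then have "(1, \<tau> p, \<tau> (p + 1)) \<in> set (conflicts g (cs ! p))"
          using \<tau>[OF p] \<tau>[OF True] by (simp add: c conflicts_iff)
        from no_conflict[OF p this] show False using \<tau>[OF p] \<tau>[OF True] by (simp add: offset_def)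
      qed
    next
      case False
      then show ?thesis using inside p c by (auto simp: inside_grid_def)
    qed
    moreover have "V (\<tau> p) (\<tau> (p + W))"
    proof (cases "p + W < length cs")
      case True
      show ?thesis
      proof (rule ccontr)
        assume "\<not> V (\<tau> p) (\<tau> (p + W))"
        then have "(2, \<tau> p, \<tau> (p + W)) \<in> set (conflicts g (cs ! p))"
          using \<tau>[OF p] \<tau>[OF True] by (simp add: c conflicts_iff)
        from no_conflict[OF p this] show False using \<tau>[OF p] \<tau>[OF True] by (simp add: offset_def)
      qed
    next
      case False
      then show ?thesis using inside p c by (auto simp: inside_grid_def)
    qed
    ultimately show "case cs ! p of (U, H, V) \<Rightarrow>
        \<tau> p < g \<and> U (\<tau> p) \<and> H (\<tau> p) (\<tau> (p + 1)) \<and> V (\<tau> p) (\<tau> (p + W))"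
      using \<tau>[OF p] by (simp add: c)
  qed
  then show ?thesis by blast
qed

end

definition grid_instance :: "nat \<Rightarrow> nat \<Rightarrow> constraint list \<Rightarrow> aug_input \<times> rat" where
  "grid_instance g W cs =
     (gadget_input (grid_entries g W cs) (grid_prices g cs), of_nat (grid_budget g cs))"

abbreviation restricted_augmentation :: "(aug_input \<times> rat) set" where
  "restricted_augmentation \<equiv> {(I, \<beta>). (I, \<beta>) \<in> min_cost_perfect_augmentation \<and>
     strict_prefs (graph_of I) \<and>
     (\<forall>a\<in>people (graph_of I). card (acceptable (graph_of I) a) \<le> 2)}"

theorem grid_instance_iff:
  assumes "inside_grid W cs" "g \<ge> 1"
  shows "grid_instance g W cs \<in> restricted_augmentation \<longleftrightarrow> (\<exists>\<tau>. satisfies g W cs \<tau>)"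
    and "valid_input (fst (grid_instance g W cs))"
proof -
  interpret grid g W cs by standard fact+
  show "valid_input (fst (grid_instance g W cs))"
    using valid_gadget_input by (simp add: grid_instance_def)
  have "grid_instance g W cs \<in> restricted_augmentation \<longleftrightarrow>
      (\<exists>k. perfect_augmentation G k \<and>
        augmentation_cost G (cost_of (gadget_input D (grid_prices g cs))) k \<le> of_nat (grid_budget g cs))"
    using valid_gadget_input strict_prefs_graph card_acceptable
    by (simp add: grid_instance_def min_cost_perfect_augmentation_def)
  also have "\<dots> \<longleftrightarrow> (\<exists>S. S \<subseteq> VS \<and> length cs \<le> card S \<and> (\<forall>e\<in>ES. \<not> ends e \<subseteq> S))"
    by (rule augmentation_iff_independent[OF budget])
  also have "\<dots> \<longleftrightarrow> (\<exists>\<tau>. satisfies g W cs \<tau>)"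
    using independent_of_satisfies satisfies_of_independent by blast
  finally show "grid_instance g W cs \<in> restricted_augmentation \<longleftrightarrow> (\<exists>\<tau>. satisfies g W cs \<tau>)" .
qed

section \<open>Computing grid instances by a register program\<close>

primrec seqs :: "cmd list \<Rightarrow> cmd" where
  "seqs [] = Skip"
| "seqs (c # cs) = Seq c (seqs cs)"

definition put :: "nat \<Rightarrow> bool list \<Rightarrow> cmd" where
  "put r bs = seqs (map (App r) bs)"

definition copy :: "nat \<Rightarrow> nat \<Rightarrow> (bool \<Rightarrow> bool list) \<Rightarrow> cmd" where
  "copy r q e = For q (put r (e False)) (put r (e True))"

lemma wf_seqs [simp]: "wf_cmd (seqs cs) \<longleftrightarrow> (\<forall>c\<in>set cs. wf_cmd c)"
  by (induction cs) auto

lemma regs_of_seqs [simp]: "regs_of (seqs cs) = (\<Union>c\<in>set cs. regs_of c)"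
  by (induction cs) auto

lemma writes_seqs [simp]: "writes (seqs cs) = (\<Union>c\<in>set cs. writes c)"
  by (induction cs) auto

lemma wf_put [simp]: "wf_cmd (put r bs)"
  and regs_of_put: "regs_of (put r bs) \<subseteq> {r}"
  and writes_put: "writes (put r bs) \<subseteq> {r}"
  by (auto simp: put_def)

lemma wf_copy [simp]: "q \<noteq> r \<Longrightarrow> wf_cmd (copy r q e)"
  using regs_of_put by (fastforce simp: copy_def)

lemma regs_of_copy: "regs_of (copy r q e) \<subseteq> {r, q}"
  using regs_of_put by (fastforce simp: copy_def)

lemma exec_put [simp]: "exec (put r bs) s = s(r := s r @ bs)"
  unfolding put_def by (induction bs arbitrary: s) auto

lemma exec_copy [simp]:
  assumes "q \<noteq> r"
  shows "exec (copy r q e) s = s(r := s r @ concat (map e (s q)))"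
proof -
  have "foldl (\<lambda>s b. (if b then exec (put r (e True)) else exec (put r (e False))) s) s bs =
      s(r := s r @ concat (map e bs))" for bs s
    by (induction bs arbitrary: s) (auto simp: fun_eq_iff)
  then show ?thesis by (simp add: copy_def)
qed

section \<open>Binary numbers as strings\<close>

primrec digits :: "nat \<Rightarrow> nat \<Rightarrow> bool list" where
  "digits 0 n = []"
| "digits (Suc w) n = odd n # digits w (n div 2)"

text \<open>\<open>nat_bits\<close> ends with the top bit. For \<open>P \<ge> 1\<close> this bit
  lies in \<open>P\<close>, so the low \<open>w\<close> digits are written in full, including zeros;
  hence the counting of positions from 1.\<close>

lemma nat_bits_digits:
  "n < 2 ^ w \<Longrightarrow> P \<ge> 1 \<Longrightarrow> nat_bits (n + 2 ^ w * P) = digits w n @ nat_bits P"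
proof (induction w arbitrary: n)
  case (Suc w)
  have "nat_bits (n + 2 ^ Suc w * P) = odd (n + 2 ^ Suc w * P) # nat_bits ((n + 2 ^ Suc w * P) div 2)"
    using Suc.prems(2) by (subst nat_bits.simps) auto
  moreover have "(n + 2 ^ Suc w * P) div 2 = n div 2 + 2 ^ w * P" by simp
  moreover have "n div 2 < 2 ^ w" using Suc.prems(1) by auto
  ultimately show ?case using Suc.IH[of "n div 2"] Suc.prems(2) by simp
qed simp

lemma nat_bits_Suc: "nat_bits (Suc n) = inc_bits (nat_bits n)"
proof (induction n rule: less_induct)
  case (less n)
  show ?case
  proof (cases "n = 0")
    case True
    then show ?thesis by (simp add: nat_bits.simps)
  next
    case False
    show ?thesis
    proof (cases "even n")
      case True
      then have "Suc n div 2 = n div 2" by simp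
      then show ?thesis using True False by (simp add: nat_bits.simps[of n] nat_bits.simps[of "Suc n"])
    next
      case odd: False
      then have "Suc n div 2 = Suc (n div 2)" by simp
      then show ?thesis
        using odd False less.IH[of "n div 2"] by (simp add: nat_bits.simps[of n] nat_bits.simps[of "Suc n"])
    qed
  qed
qed

lemma exec_repeat_Inc:
  "s r = nat_bits n \<Longrightarrow> exec (seqs (replicate m (Inc r))) s = s(r := nat_bits (n + m))"
proof (induction m arbitrary: n s)
  case (Suc m)
  have "exec (seqs (replicate m (Inc r))) (s(r := inc_bits (s r))) =
      (s(r := inc_bits (s r)))(r := nat_bits (Suc n + m))"
    using Suc.prems by (intro Suc.IH) (simp add: nat_bits_Suc)
  then show ?case by simp
qed (auto simp: fun_upd_idem)

lemma enc_nat_concat: "enc_nat n = concat (map (\<lambda>b. [True, b]) (nat_bits n)) @ [False]"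
  by (simp add: enc_nat_def enc_list_def)

lemma length_nat_bits: "length (nat_bits n) \<le> n"
proof (induction n rule: less_induct)
  case (less n)
  show ?case
  proof (cases "n = 0")
    case False
    then have "length (nat_bits (n div 2)) \<le> n div 2" using less by simp
    then show ?thesis using False by (simp add: nat_bits.simps[of n])
  qed (simp add: nat_bits.simps)
qed

lemma length_enc_nat: "length (enc_nat n) \<le> 2 * n + 1"
  using length_nat_bits[of n] by (simp add: enc_nat_concat length_concat sum_list_triv o_def)

lemma enc_rat_of_nat: "enc_rat (of_nat n) = enc_nat n @ enc_nat 1"
proof -
  have "quotient_of (of_nat n) = (int n, 1)"
    by (simp add: of_nat_rat quotient_of_Fract Rat.normalize_def)
  then show ?thesis by (simp add: enc_rat_def)
qed

section \<open>The encoded instance as a string\<close>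

definition person_bits :: "nat \<Rightarrow> nat \<Rightarrow> bool list" where
  "person_bits b s = [True, True] @ enc_nat b @ enc_nat 0 @ [True] @ enc_nat s @ enc_nat 1 @ [False]"

definition people_bits :: "(nat \<times> nat \<times> nat) list \<Rightarrow> bool list" where
  "people_bits D = concat (map (\<lambda>(b, s, t). person_bits b s @ person_bits b t) D)"

definition price_bits :: "nat \<Rightarrow> bool list" where
  "price_bits g = concat (map (\<lambda>c. True # enc_rat (of_nat c)) (price_block g))"

lemma concat_map_replicate:
  "concat (map f (concat (replicate n xs))) = concat (replicate n (concat (map f xs)))"
  by (induction n) auto

lemma concat_replicate_Suc: "concat (replicate (Suc n) xs) = concat (replicate n xs) @ xs"
  by (induction n) auto

text \<open>In this form the string can be assembled from pieces collected in separate registers;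
  the final \<open>enc_nat 1\<close> is the denominator of the budget.\<close>

lemma encode_grid_instance:
  "encode (grid_instance g W cs) =
     people_bits (grid_entries g W cs) @ [False] @
     concat (replicate (length cs + 1) (price_bits g)) @ [False] @
     enc_nat (grid_budget g cs) @ enc_nat 1"
proof -
  have 1: "enc_list (enc_list (\<lambda>e. enc_nat (fst e) @ enc_nat (snd e))) (pref_lists (gadget_input D pr)) =
      people_bits D @ [False]" for D pr
    unfolding gadget_input_def people_bits_def person_bits_def enc_list_def
    by (induction D) auto
  have 2: "enc_list enc_rat (prices (gadget_input D (grid_prices g cs))) =
      concat (replicate (length cs + 1) (price_bits g)) @ [False]" for D
    by (simp add: gadget_input_def enc_list_def grid_prices_def price_bits_def concat_map_replicate o_def
        del: replicate_Suc)
  show ?thesis by (simp add: encode_def grid_instance_def 1 2 enc_rat_of_nat)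
qed

text \<open>The digits of the slot are known when the program is written, and those of the position
  are copied from register 1, 2 or 3, so no arithmetic on item numbers takes place.\<close>

definition emit_index :: "nat \<Rightarrow> nat \<Rightarrow> nat \<times> nat \<Rightarrow> cmd" where
  "emit_index g ro = (\<lambda>(d, s). seqs
     [put ro (concat (map (\<lambda>b. [True, b]) (digits (slot_bits g) s))),
      copy ro (1 + d) (\<lambda>b. [True, b]), put ro [False]])"

definition emit_person :: "nat \<Rightarrow> nat \<Rightarrow> nat \<times> nat \<Rightarrow> nat \<times> nat \<Rightarrow> cmd" where
  "emit_person g ro a b = seqs
     [put ro [True, True], emit_index g ro a, put ro (enc_nat 0 @ [True]), emit_index g ro b,
      put ro (enc_nat 1 @ [False])]"

definition emit_entry :: "nat \<Rightarrow> nat \<Rightarrow> nat \<times> (nat \<times> nat) \<times> (nat \<times> nat) \<Rightarrow> cmd" where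
  "emit_entry g ro = (\<lambda>(s, a, b). Seq (emit_person g ro (0, s) a) (emit_person g ro (0, s) b))"

text \<open>Prices and budget go to registers of their own, since in the encoding they follow all
  people. The last three increments move \<open>P\<close>, \<open>P + 1\<close> and
  \<open>P + W\<close> on together, which replaces addition.\<close>

definition emit_block :: "nat \<Rightarrow> nat \<Rightarrow> constraint \<Rightarrow> cmd" where
  "emit_block g ro c = seqs
     [seqs (map (emit_entry g ro) (block g c)), 
      seqs (replicate (g - 1 + length (conflicts g c)) (Inc 4)),
      put 5 (price_bits g), Inc 1, Inc 2, Inc 3]"

definition positions :: "nat \<Rightarrow> nat \<Rightarrow> regs \<Rightarrow> bool" where
  "positions W P s \<longleftrightarrow> P \<ge> 1 \<and> (\<forall>d<3. s (1 + d) = nat_bits (P + offset W d))"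

lemma exec_emit_index:
  assumes "positions W P s" "d < 3" "sl < 2 ^ slot_bits g" "ro > 5"
  shows "exec (emit_index g ro (d, sl)) s =
    s(ro := s ro @ enc_nat (item_of g (P + offset W d) sl))"
proof -
  have "s (1 + d) = nat_bits (P + offset W d)" "P + offset W d \<ge> 1" using assms by (auto simp: positions_def)
  then show ?thesis
    using assms nat_bits_digits[OF assms(3), of "P + offset W d"]
    by (simp add: emit_index_def enc_nat_concat item_of_def)
qed

lemma positions_upd: "ro > 5 \<Longrightarrow> positions W P (s(ro := v)) = positions W P s"
  by (simp add: positions_def)

lemma exec_emit_person:
  assumes "positions W P s" "d < 3" "sl < 2 ^ slot_bits g" "d' < 3" "sl' < 2 ^ slot_bits g" "ro > 5"
  shows "exec (emit_person g ro (d, sl) (d', sl')) s =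
    s(ro := s ro @ person_bits (item_of g (P + offset W d) sl) (item_of g (P + offset W d') sl'))"
  using assms
  by (simp add: emit_person_def exec_emit_index[where W = W and P = P] positions_upd person_bits_def)

lemma block_targets:
  assumes "(s, (d1, s1), (d2, s2)) \<in> set (block g c)"
  shows "s < 2 ^ slot_bits g" "s1 < 2 ^ slot_bits g" "s2 < 2 ^ slot_bits g" "d1 < 3" "d2 < 3"
proof -
  show "s < 2 ^ slot_bits g" using block_slot[OF assms] by simp
  have "s1 \<le> g \<and> s2 \<le> g \<and> d1 < 3 \<and> d2 < 3"
  proof -
    consider i where "i < g" "(s, (d1, s1), (d2, s2)) = (1 + i, (0, 0), (0, 0))"
      | l where "l < length (conflicts g c)" "(s, (d1, s1), (d2, s2)) =
          (case conflicts g c ! l of (d, i, j) \<Rightarrow> (1 + g + l, (0, 1 + i), (d, 1 + j)))"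
      using assms unfolding block_def by auto
    then show ?thesis
    proof cases
      case 2
      obtain d i j where dij: "conflicts g c ! l = (d, i, j)" by (metis prod_cases3)
      then have "(d, i, j) \<in> set (conflicts g c)" using 2(1) nth_mem by metis
      moreover obtain U H V where "c = (U, H, V)" by (metis prod_cases3)
      ultimately have "i < g" "j < g" "d < 3" by (simp_all add: conflicts_iff)
      then show ?thesis using 2(2) dij by simp
    qed simp
  qed
  then show "s1 < 2 ^ slot_bits g" "s2 < 2 ^ slot_bits g" "d1 < 3" "d2 < 3"
    using slot_bits[of g c] by linarith+
qed

lemma exec_emit_entries:
  assumes "positions W P s" "set es \<subseteq> set (block g c)" "ro > 5"
  shows "exec (seqs (map (emit_entry g ro) es)) s = s(ro := s ro @ people_bits (map (place g W P) es))"
  using assms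
proof (induction es arbitrary: s)
  case Nil
  then show ?case by (simp add: people_bits_def)
next
  case (Cons e es)
  obtain sl d1 s1 d2 s2 where e: "e = (sl, (d1, s1), (d2, s2))" by (metis prod.collapse)
  then have "(sl, (d1, s1), (d2, s2)) \<in> set (block g c)" using Cons.prems by simp
  note t = block_targets[OF this]
  have "exec (emit_entry g ro e) s = s(ro := s ro @ people_bits [place g W P e])"
    using Cons.prems t
    by (simp add: emit_entry_def e exec_emit_person[where W = W and P = P] positions_upd
        people_bits_def place_def)
  then show ?case using Cons by (simp add: positions_upd people_bits_def del: fun_upd_apply) (simp add: fun_eq_iff)
qed

text \<open>The invariant after emitting the constraints \<open>cs\<close>. Its last clause protects
  the registers that control the loops, whose contents are fixed by \<open>s0\<close>.\<close>

definition emitted :: "nat \<Rightarrow> nat \<Rightarrow> nat \<Rightarrow> regs \<Rightarrow> constraint list \<Rightarrow> regs \<Rightarrow> bool" where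
  "emitted g W ro s0 cs s \<longleftrightarrow> positions W (length cs + 1) s \<and> s 4 = nat_bits (grid_budget g cs) \<and>
     s 5 = concat (replicate (length cs) (price_bits g)) \<and>
     s ro = people_bits (grid_entries g W cs) \<and> (\<forall>r. r \<notin> {1, 2, 3, 4, 5, ro} \<longrightarrow> s r = s0 r)"

lemma emitted_block:
  assumes "emitted g W ro s0 cs s" "ro > 5"
  shows "emitted g W ro s0 (cs @ [c]) (exec (emit_block g ro c) s)"
proof -
  let ?s = "s(ro := s ro @ people_bits (map (place g W (length cs + 1)) (block g c)))"
  let ?m = "g - 1 + length (conflicts g c)"
  have p: "s 1 = nat_bits (length cs + 1)" "s 2 = nat_bits (length cs + 2)" "s 3 = nat_bits (length cs + 1 + W)"
    using assms(1) unfolding emitted_def positions_def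
    by (auto simp: offset_def eval_nat_numeral dest!: spec[of _ "0 :: nat"] spec[of _ "1 :: nat"] spec[of _ "2 :: nat"])
  have "exec (emit_block g ro c) s = ?s(4 := nat_bits (grid_budget g cs + ?m), 5 := s 5 @ price_bits g,
      1 := nat_bits (Suc (length cs + 1)), 2 := nat_bits (Suc (length cs + 2)),
      3 := nat_bits (Suc (length cs + 1 + W)))"
    using assms p
    by (simp add: emit_block_def exec_emit_entries[where W = W and P = "length cs + 1" and c = c] emitted_def
        exec_repeat_Inc[where n = "grid_budget g cs"] nat_bits_Suc del: add_Suc_right add_Suc)
  moreover have "grid_budget g (cs @ [c]) = grid_budget g cs + ?m" by (simp add: grid_budget_def)
  moreover have "people_bits (grid_entries g W (cs @ [c])) =
      people_bits (grid_entries g W cs) @ people_bits (map (place g W (length cs + 1)) (block g c))"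
    by (simp add: grid_entries_def enumerate_append_eq people_bits_def)
  moreover have "concat (replicate (Suc (length cs)) (price_bits g)) =
      concat (replicate (length cs) (price_bits g)) @ price_bits g"
    by (rule concat_replicate_Suc)
  moreover have "d = 0 \<or> d = 1 \<or> d = 2" if "d < 3" for d :: nat using that by auto
  ultimately show ?thesis
    using assms unfolding emitted_def positions_def
    by (auto simp: offset_def numeral_2_eq_2 numeral_3_eq_3 less_Suc_eq)
qed

lemma emitted_For:
  assumes "emitted g W ro s0 cs s" "r \<notin> {1, 2, 3, 4, 5, ro}"
    and "\<And>b cs s. emitted g W ro s0 cs s \<Longrightarrow> emitted g W ro s0 (cs @ ds b) (exec (if b then d else c) s)"
  shows "emitted g W ro s0 (cs @ concat (map ds (s0 r))) (exec (For r c d) s)"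
proof -
  have "emitted g W ro s0 (cs @ concat (map ds bs)) (foldl (\<lambda>s b. (if b then exec d else exec c) s) s bs)"
    if "emitted g W ro s0 cs s" for bs cs s
    using that
  proof (induction bs arbitrary: cs s)
    case (Cons b bs)
    have "emitted g W ro s0 (cs @ ds b) ((if b then exec d else exec c) s)"
      using assms(3)[OF Cons.prems, of b] by (simp split: if_splits)
    from Cons.IH[OF this] show ?case by simp
  qed simp
  moreover have "s r = s0 r" using assms(1,2) by (simp add: emitted_def)
  ultimately show ?thesis using assms(1) by simp
qed

text \<open>Horner's rule, where a number is represented by the length of a register.\<close>

primrec horner :: "nat list \<Rightarrow> nat \<Rightarrow> nat \<Rightarrow> cmd" where
  "horner [] r q = Skip"
| "horner (a # as) r q =
     (let app = App (q + length as + 1) True; loop = For (q + length as) app app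
      in seqs [horner as r q, For r loop loop, put (q + length as + 1) (replicate a True)])"

definition horner_val :: "nat list \<Rightarrow> nat \<Rightarrow> nat" where
  "horner_val as n = foldr (\<lambda>a v. a + n * v) as 0"

lemma horner_val_simps [simp]:
  "horner_val [] n = 0" "horner_val (a # as) n = a + n * horner_val as n"
  by (simp_all add: horner_val_def)

lemma horner_val_coeffs: "horner_val (coeffs p) n = poly p n"
proof -
  have "horner_sum id n as = horner_val as n" for as
    by (induction as) auto
  then show ?thesis by (simp add: poly_def)
qed

lemma exec_For_const:
  "exec (For r c c) s = (exec c ^^ length (s r)) s"
proof -
  have "foldl (\<lambda>s b. (if b then exec c else exec c) s) s bs = (exec c ^^ length bs) s" for bs s
    by (induction bs arbitrary: s) (auto simp: funpow_swap1)
  then show ?thesis by simp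
qed

lemma exec_app_loop:
  assumes "q \<noteq> t"
  shows "exec (For q (App t b) (App t b)) s = s(t := s t @ replicate (length (s q)) b)"
proof -
  have "(exec (App t b) ^^ n) s = s(t := s t @ replicate n b)" for n
    by (induction n) (auto simp: fun_eq_iff replicate_append_same)
  then show ?thesis by (simp only: exec_For_const)
qed

lemma exec_app_loop2:
  assumes "q \<noteq> t" "r \<noteq> t"
  shows "exec (For r (For q (App t b) (App t b)) (For q (App t b) (App t b))) s =
    s(t := s t @ replicate (length (s r) * length (s q)) b)"
proof -
  have "(exec (For q (App t b) (App t b)) ^^ n) s = s(t := s t @ replicate (n * length (s q)) b)" for n
  proof (induction n)
    case (Suc n)
    have "exec (For q (App t b) (App t b)) (s(t := s t @ replicate (n * length (s q)) b)) =
        s(t := s t @ replicate (Suc n * length (s q)) b)"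
      unfolding exec_app_loop[OF assms(1)] using assms(1)
      by (simp add: replicate_add[symmetric] add.commute)
    then show ?case by (simp only: funpow.simps comp_apply Suc)
  qed simp
  then show ?thesis by (simp only: exec_For_const)
qed

lemma writes_horner: "writes (horner as r q) \<subseteq> {q..q + length as}"
proof (induction as)
  case (Cons a as)
  then show ?case using writes_put[of "q + length as + 1" "replicate a True"] by (auto simp: Let_def)
qed simp

lemma regs_of_horner: "regs_of (horner as r q) \<subseteq> insert r {q..q + length as}"
proof (induction as)
  case (Cons a as)
  then show ?case using regs_of_put[of "q + length as + 1" "replicate a True"] by (auto simp: Let_def)
qed simp

lemma wf_horner: "r < q \<Longrightarrow> wf_cmd (horner as r q)"
  by (induction as) (auto simp: Let_def)

text \<open>The second part covers the partial results, because \<open>polytime_exec\<close> asks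
  for a bound on every register. Each partial value is at most the sum of the coefficients times a
  power of \<open>length (s r) + 1\<close>.\<close>

lemma length_horner:
  assumes "r < q" "\<And>i. i \<le> length as \<Longrightarrow> s (q + i) = []"
  shows "length (exec (horner as r q) s (q + length as)) = horner_val as (length (s r))"
    and "i \<le> length as \<Longrightarrow> length (exec (horner as r q) s (q + i)) \<le>
      sum_list as * (length (s r) + 1) ^ length as"
proof -
  have *: "length (exec (horner as r q) s (q + length as)) = horner_val as (length (s r)) \<and>
    (\<forall>i\<le>length as. length (exec (horner as r q) s (q + i)) \<le>
      sum_list as * (length (s r) + 1) ^ length as)"
    using assms(2)
  proof (induction as)
    case Nil
    then show ?case using Nil.prems[of 0] by simp
  next
    case (Cons a as)
    let ?s = "exec (horner as r q) s" and ?n = "length (s r)" and ?t = "q + length as + 1"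
    let ?B = "sum_list as * (?n + 1) ^ length as"
    have IH: "length (?s (q + length as)) = horner_val as ?n" "\<And>i. i \<le> length as \<Longrightarrow> length (?s (q + i)) \<le> ?B"
      using Cons.IH Cons.prems by auto
    have "r \<notin> writes (horner as r q)" "?t \<notin> writes (horner as r q)"
      using writes_horner[of as r q] assms(1) by auto
    then have s: "?s r = s r" "?s ?t = []"
      using Cons.prems[of "length as + 1"] by (simp_all add: exec_unchanged)
    have e: "exec (horner (a # as) r q) s =
       ?s(?t := replicate (?n * length (?s (q + length as))) True @ replicate a True)"
      using s assms(1) by (simp add: Let_def exec_app_loop2 del: exec.simps(5))
    have val: "length (exec (horner (a # as) r q) s (q + length (a # as))) = horner_val (a # as) ?n"
      unfolding e using IH(1) by (simp add: add.commute)
    have B: "a + ?n * ?B \<le> (a + sum_list as) * (?n + 1) ^ Suc (length as)"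
    proof -
      have "1 \<le> (?n + 1) ^ Suc (length as)" by (rule one_le_power) simp
      then have 1: "a * 1 \<le> a * (?n + 1) ^ Suc (length as)" by (rule mult_le_mono2)
      have "?n * ?B \<le> (?n + 1) * ?B" by (intro mult_le_mono) auto
      also have "\<dots> = sum_list as * (?n + 1) ^ Suc (length as)" by (simp only: power_Suc ac_simps)
      finally show ?thesis unfolding add_mult_distrib using 1 by linarith
    qed
    have B': "?B \<le> (a + sum_list as) * (?n + 1) ^ Suc (length as)"
    proof (intro mult_le_mono power_increasing)
    qed auto
    have "length (exec (horner (a # as) r q) s (q + i)) \<le> sum_list (a # as) * (?n + 1) ^ length (a # as)"
      if i: "i \<le> length (a # as)" for i
    proof (cases "i = length (a # as)")
      case True
      have "length (exec (horner (a # as) r q) s (q + i)) = a + ?n * horner_val as ?n"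
        using val True by simp
      also have "\<dots> \<le> a + ?n * ?B" using IH(1) IH(2)[of "length as"] by simp
      finally show ?thesis using B by simp
    next
      case False
      then have "i \<le> length as" using i by simp
      moreover have "exec (horner (a # as) r q) s (q + i) = ?s (q + i)" unfolding e using False by simp
      ultimately show ?thesis using IH(2)[of i] B' by simp
    qed
    then show ?case using val by blast
  qed
  from * show "length (exec (horner as r q) s (q + length as)) = horner_val as (length (s r))" by blast
  from * show "i \<le> length as \<Longrightarrow> length (exec (horner as r q) s (q + i)) \<le>
      sum_list as * (length (s r) + 1) ^ length as" by blast
qed

text \<open>The first row describes the tape with \<open>pair_string x u\<close> for an arbitrary \<open>u\<close>, which has to fit
  into \<open>A\<close> cells and is followed by \<open>T\<close> further cells; the last row checks the output.\<close>

definition layout :: "(nat \<Rightarrow> constraint) \<Rightarrow> bool list \<Rightarrow> nat \<Rightarrow> nat \<Rightarrow> constraint list" where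
  "layout L x A T = (let m = 2 * length x + 1 + A + T in
     [L 0] @ concat (map (\<lambda>b. [L 1, if b then L 3 else L 2]) x) @ [L 4] @ replicate A (L 5) @
     replicate T (L 6) @ [L 7] @
     concat (replicate T (L 8 # replicate m (L 9) @ [L 10])) @
     [L 11, L 12] @ replicate m (L 13))"

text \<open>Registers \<open>rA\<close>, \<open>rT\<close> and 6 are counters whose bits are
  ignored. Register 6 holds the width less two, as each row that it serves has two further
  cells.\<close>

definition emit_layout :: "nat \<Rightarrow> nat \<Rightarrow> (nat \<Rightarrow> constraint) \<Rightarrow> nat \<Rightarrow> nat \<Rightarrow> cmd" where
  "emit_layout g ro L rA rT = (let em = (\<lambda>i. emit_block g ro (L i));
       rep = (\<lambda>r c. For r c c)
     in seqs [em 0, For 0 (seqs [em 1, em 2]) (seqs [em 1, em 3]), em 4, rep rA (em 5), rep rT (em 6),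
       em 7, rep rT (seqs [em 8, rep 6 (em 9), em 10]), em 11, em 12, rep 6 (em 13)])"

lemma concat_map_const: "concat (map (\<lambda>_. ds) xs) = concat (replicate (length xs) ds)"
  by (induction xs) auto

lemma emitted_rep:
  assumes "emitted g W ro s0 cs s" "r \<notin> {1, 2, 3, 4, 5, ro}"
    "\<And>cs s. emitted g W ro s0 cs s \<Longrightarrow> emitted g W ro s0 (cs @ ds) (exec c s)"
  shows "emitted g W ro s0 (cs @ concat (replicate (length (s0 r)) ds)) (exec (For r c c) s)"
  using emitted_For[OF assms(1,2), of "\<lambda>_. ds" c c] assms(3)
  by (simp add: concat_map_const del: exec.simps)

lemma concat_replicate_single: "concat (replicate n [c]) = replicate n c"
  by (induction n) auto

lemma emitted_rep_block:
  assumes "emitted g W ro s0 cs s" "r \<notin> {1, 2, 3, 4, 5, ro}" "ro > 5"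
  shows "emitted g W ro s0 (cs @ replicate (length (s0 r)) c)
    (exec (For r (emit_block g ro c) (emit_block g ro c)) s)"
  using emitted_rep[OF assms(1,2), of "[c]" "emit_block g ro c"] emitted_block assms(3)
  by (simp add: concat_replicate_single del: exec.simps)

lemma emitted_layout:
  assumes "emitted g W ro s0 [] s" "ro > 7" "rA > 5" "rT > 5" "rA \<noteq> ro" "rT \<noteq> ro"
    "s0 0 = x" "length (s0 rA) = A" "length (s0 rT) = T" "length (s0 6) = 2 * length x + 1 + A + T"
  shows "emitted g W ro s0 (layout L x A T) (exec (emit_layout g ro L rA rT) s)"
proof -
  let ?m = "2 * length x + 1 + A + T"
  let ?em = "\<lambda>i. emit_block g ro (L i)"
  have ro: "ro > 5" using assms(2) by simp
  have r: "0 \<notin> {1, 2, 3, 4, 5, ro}" "rA \<notin> {1, 2, 3, 4, 5, ro}" "rT \<notin> {1, 2, 3, 4, 5, ro}"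
    "6 \<notin> {1, 2, 3, 4, 5, ro}" using assms(2-6) by auto
  note b = emitted_block[OF _ ro]
  have x: "emitted g W ro s0 (cs @ concat (map (\<lambda>b. [L 1, if b then L 3 else L 2]) x))
      (exec (For 0 (seqs [?em 1, ?em 2]) (seqs [?em 1, ?em 3])) s)"
    if "emitted g W ro s0 cs s" for cs s
    unfolding assms(7)[symmetric]
  proof (rule emitted_For[OF that r(1)])
    fix b cs s assume "emitted g W ro s0 cs s"
    from b[OF b[OF this, of "L 1"], of "L (if b then 3 else 2)"]
    show "emitted g W ro s0 (cs @ [L 1, if b then L 3 else L 2])
        (exec (if b then seqs [?em 1, ?em 3] else seqs [?em 1, ?em 2]) s)" by (cases b) simp_all
  qed
  have row: "emitted g W ro s0 (cs @ (L 8 # replicate ?m (L 9) @ [L 10]))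
      (exec (seqs [?em 8, For 6 (?em 9) (?em 9), ?em 10]) s)" if "emitted g W ro s0 cs s" for cs s
    using b[OF emitted_rep_block[OF b[OF that, of "L 8"] r(4) ro, of "L 9"], of "L 10"] assms(10)
    by (simp del: exec.simps(5))
  have rows: "emitted g W ro s0 (cs @ concat (replicate T (L 8 # replicate ?m (L 9) @ [L 10])))
      (exec (For rT (seqs [?em 8, For 6 (?em 9) (?em 9), ?em 10])
        (seqs [?em 8, For 6 (?em 9) (?em 9), ?em 10])) s)" if "emitted g W ro s0 cs s" for cs s
    using emitted_rep[OF that r(3) row] assms(9) by simp
  note A = emitted_rep_block[where ?s0.0 = s0 and r = rA, OF _ r(2) ro, unfolded assms(8)]
  note T = emitted_rep_block[where ?s0.0 = s0 and r = rT, OF _ r(3) ro, unfolded assms(9)]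
  note m = emitted_rep_block[where ?s0.0 = s0 and r = 6, OF _ r(4) ro, unfolded assms(10)]
  have "emitted g W ro s0
      ((((((((((([] @ [L 0]) @ concat (map (\<lambda>b. [L 1, if b then L 3 else L 2]) x)) @ [L 4]) @ replicate A (L 5)) @
        replicate T (L 6)) @ [L 7]) @ concat (replicate T (L 8 # replicate ?m (L 9) @ [L 10]))) @ [L 11]) @
        [L 12]) @ replicate ?m (L 13)))
      (exec (For 6 (?em 13) (?em 13)) (exec (?em 12) (exec (?em 11)
        (exec (For rT (seqs [?em 8, For 6 (?em 9) (?em 9), ?em 10])
        (seqs [?em 8, For 6 (?em 9) (?em 9), ?em 10])) (exec (?em 7) (exec (For rT (?em 6) (?em 6))
         (exec (For rA (?em 5) (?em 5)) (exec (?em 4)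
         (exec (For 0 (seqs [?em 1, ?em 2]) (seqs [?em 1, ?em 3])) (exec (?em 0) s))))))))))"
    by (rule m[OF b[OF b[OF rows[OF b[OF T[OF A[OF b[OF x[OF b[OF assms(1)]]]]]]]]]])
  then show ?thesis
    by (simp add: layout_def emit_layout_def Let_def del: exec.simps(5))
qed

lemma length_layout:
  "length (layout L x A T) = (T + 2) * (2 * length x + 1 + A + T + 2)"
proof -
  have "length (concat (map (\<lambda>b. [L 1, if b then L 3 else L 2]) x)) = 2 * length x"
    by (induction x) auto
  then show ?thesis
    by (simp add: layout_def Let_def length_concat sum_list_replicate algebra_simps)
qed

text \<open>Registers: 0 holds the input, 1 to 3 the numbers \<open>P\<close>, \<open>P + 1\<close> and \<open>P + W\<close> for the current
  position \<open>P\<close>, 4 the budget, 5 the prices; 6 and 7 and the results of \<^const>\<open>horner\<close> are used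
  only for their lengths.\<close>

definition reduction_setup :: "nat list \<Rightarrow> nat list \<Rightarrow> cmd" where
  "reduction_setup ps qs = seqs [horner ps 0 8,
     copy 7 0 (\<lambda>_. [True, True]), App 7 True, copy 7 (8 + length ps) (\<lambda>_. [True]),
     horner qs 7 (9 + length ps),
     copy 6 7 (\<lambda>_. [True]), copy 6 (9 + length ps + length qs) (\<lambda>_. [True]),
     Inc 1, Inc 2, Inc 2, seqs (replicate 3 (Inc 3)), For 6 (Inc 3) (Inc 3)]"

text \<open>\<open>put 5\<close> supplies the missing price block of position 0; all blocks are
  equal, so it may come last. The budget is an integer, hence the denominator 1 at the end.\<close>

definition reduction_finish :: "nat \<Rightarrow> nat \<Rightarrow> cmd" where
  "reduction_finish g ro = seqs [App ro False, put 5 (price_bits g), copy ro 5 (\<lambda>b. [b]), App ro False,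
     copy ro 4 (\<lambda>b. [True, b]), put ro (False # enc_nat 1)]"

definition reduction_cmd :: "nat \<Rightarrow> (nat \<Rightarrow> constraint) \<Rightarrow> nat list \<Rightarrow> nat list \<Rightarrow> cmd" where
  "reduction_cmd g L ps qs = (let ro = 10 + length ps + length qs in
     seqs [reduction_setup ps qs,
       emit_layout g ro L (8 + length ps) (9 + length ps + length qs),
       reduction_finish g ro])"

lemma concat_singletons: "concat (map (\<lambda>b. [b]) xs) = xs"
  by (induction xs) auto

lemma exec_Inc_loop:
  assumes "s t = nat_bits m" "r \<noteq> t"
  shows "exec (For r (Inc t) (Inc t)) s = s(t := nat_bits (m + length (s r)))"
proof -
  have "(exec (Inc t) ^^ n) s = s(t := nat_bits (m + n))" for n
    by (induction n) (use assms(1) in \<open>auto simp: nat_bits_Suc fun_upd_idem\<close>)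
  then show ?thesis by (simp only: exec_For_const)
qed

lemma nat_bits_0: "nat_bits 0 = []"
  by (simp add: nat_bits.simps)

lemma exec_reduction_setup:
  fixes x ps qs
  defines "s \<equiv> exec (reduction_setup ps qs) (input_regs x)"
    and "n \<equiv> length x"
    and "A \<equiv> horner_val ps (length x)"
    and "T \<equiv> horner_val qs (2 * length x + 1 + horner_val ps (length x))"
  shows "s 0 = x" "s 1 = nat_bits 1" "s 2 = nat_bits 2" "s 3 = nat_bits (2 * n + 1 + A + T + 3)"
    "s 4 = []" "s 5 = []" "length (s 6) = 2 * n + 1 + A + T" "length (s 7) = 2 * n + 1 + A"
    "length (s (8 + length ps)) = A" "length (s (9 + length ps + length qs)) = T"
    "r \<ge> 10 + length ps + length qs \<Longrightarrow> s r = []"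
    "length (s r) \<le> n + (2 * n + 1 + A + T + 3) + sum_list ps * (n + 1) ^ length ps +
       sum_list qs * (2 * n + 1 + A + 1) ^ length qs"
proof -
  let ?rA = "8 + length ps" and ?rT = "9 + length ps + length qs"
  define s1 where "s1 = exec (horner ps 0 8) (input_regs x)"
  have w1: "r \<notin> writes (horner ps 0 8)" if "r < 8 \<or> r > ?rA" for r
    using writes_horner[of ps 0 8] that by auto
  have s1: "s1 r = input_regs x r" if "r < 8 \<or> r > ?rA" for r
    using exec_unchanged[OF w1[OF that]] by (simp add: s1_def)
  have z1: "input_regs x (8 + i) = []" for i by (simp add: input_regs_def)
  have A: "length (s1 ?rA) = A" "\<And>i. i \<le> length ps \<Longrightarrow> length (s1 (8 + i)) \<le> sum_list ps * (n + 1) ^ length ps"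
    using length_horner[of 0 8 ps "input_regs x"] z1
    by (simp_all add: s1_def A_def n_def input_regs_def)
  define v where "v = concat (map (\<lambda>_. [True, True]) x) @ True # concat (map (\<lambda>_. [True]) (s1 ?rA))"
  have lv: "length v = 2 * n + 1 + A"
    using A by (simp add: v_def n_def length_concat o_def sum_list_triv)
  define s2 where "s2 = s1(7 := v)"
  define s3 where "s3 = exec (horner qs 7 (9 + length ps)) s2"
  have w3: "r \<notin> writes (horner qs 7 (9 + length ps))" if "r < 9 + length ps \<or> r > ?rT" for r
    using writes_horner[of qs 7 "9 + length ps"] that by auto
  have s3: "s3 r = s2 r" if "r < 9 + length ps \<or> r > ?rT" for r
    using exec_unchanged[OF w3[OF that]] by (simp add: s3_def)
  have z2: "s2 (9 + length ps + i) = []" for i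
    using s1[of "9 + length ps + i"] by (simp add: s2_def input_regs_def)
  have T: "length (s3 ?rT) = T"
    "\<And>i. i \<le> length qs \<Longrightarrow> length (s3 (9 + length ps + i)) \<le> sum_list qs * (2 * n + 1 + A + 1) ^ length qs"
    using length_horner[of 7 "9 + length ps" qs s2] z2 lv
    by (simp_all add: s3_def T_def s2_def A_def n_def)
  define u where "u = concat (map (\<lambda>_. [True]) v) @ concat (map (\<lambda>_. [True]) (s3 ?rT))"
  have lu: "length u = 2 * n + 1 + A + T"
    using T lv by (simp add: u_def length_concat o_def sum_list_triv)
  have init: "s1 7 = []" "s1 0 = x" "s3 7 = v" "s3 6 = []" "s3 0 = x" "s3 1 = nat_bits 0" "s3 2 = nat_bits 0"
    "s3 3 = nat_bits 0" "s3 4 = []" "s3 5 = []"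
    using s1 s3 by (simp_all add: s2_def input_regs_def nat_bits_0)
  have s: "s = s3(6 := u, 1 := nat_bits 1, 2 := nat_bits 2, 3 := nat_bits (3 + length u))"
  proof -
    have e1: "exec (seqs [horner ps 0 8, copy 7 0 (\<lambda>_. [True, True]), App 7 True, copy 7 ?rA (\<lambda>_. [True])])
        (input_regs x) = s2"
      using init by (simp add: s1_def[symmetric] s2_def v_def)
    have e2: "exec (seqs [copy 6 7 (\<lambda>_. [True]), copy 6 ?rT (\<lambda>_. [True])]) s3 = s3(6 := u)"
      using init by (simp add: u_def)
    have e3: "exec (seqs [Inc 1, Inc 2, Inc 2]) t = t(1 := nat_bits 1, 2 := nat_bits 2)"
      if t: "t 1 = nat_bits 0" "t 2 = nat_bits 0" for t
      using t by (simp add: nat_bits_Suc[symmetric] numeral_2_eq_2)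
    \<comment> \<open>Register 3 must start at \<open>1 + W\<close>, where \<open>W\<close> is the
      length of register 6 plus 2: three increments and a loop over register 6.\<close>
    have e4: "exec (seqs [seqs (replicate 3 (Inc 3)), For 6 (Inc 3) (Inc 3)]) t =
        t(3 := nat_bits (3 + length (t 6)))" if t: "t 3 = nat_bits 0" for t
    proof -
      have "exec (seqs (replicate 3 (Inc 3))) t = t(3 := nat_bits 3)"
        using exec_repeat_Inc[where s = t and r = 3 and n = 0 and m = 3] t by simp
      then show ?thesis by (simp add: exec_Inc_loop[where m = 3] del: exec.simps(5))
    qed
    have "s = exec (seqs [seqs (replicate 3 (Inc 3)), For 6 (Inc 3) (Inc 3)])
       (exec (seqs [Inc 1, Inc 2, Inc 2])
       (exec (seqs [copy 6 7 (\<lambda>_. [True]), copy 6 ?rT (\<lambda>_. [True])])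
       (exec (horner qs 7 (9 + length ps))
       (exec (seqs [horner ps 0 8, copy 7 0 (\<lambda>_. [True, True]), App 7 True, copy 7 ?rA (\<lambda>_. [True])])
        (input_regs x)))))"
      by (simp only: s_def reduction_setup_def seqs.simps exec.simps)
    then show ?thesis
      unfolding e1 s3_def[symmetric] e2 using init by (subst (asm) e3, simp, simp) (subst (asm) e4, auto)
  qed
  show "s 0 = x" "s 1 = nat_bits 1" "s 2 = nat_bits 2" "s 3 = nat_bits (2 * n + 1 + A + T + 3)"
    "s 4 = []" "s 5 = []" "length (s 6) = 2 * n + 1 + A + T" "length (s 7) = 2 * n + 1 + A"
    "length (s ?rT) = T"
    using init lu lv T by (simp_all add: s)
  show "length (s ?rA) = A" using s3[of ?rA] A by (simp add: s s2_def)
  show "s r = []" if "r \<ge> 10 + length ps + length qs"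
    using that s3[of r] s1[of r] by (simp add: s s2_def input_regs_def)
  let ?B1 = "sum_list ps * (n + 1) ^ length ps" and ?B2 = "sum_list qs * (2 * n + 1 + A + 1) ^ length qs"
  consider "r = 0" | "r \<in> {1, 2, 3}" | "r \<in> {4, 5}" | "r = 6" | "r = 7" | "8 \<le> r" "r \<le> ?rA" | "?rA < r" "r \<le> ?rT" | "?rT < r"
    by fastforce
  then show "length (s r) \<le> n + (2 * n + 1 + A + T + 3) + ?B1 + ?B2"
  proof cases
    case 2
    have "length (s r) \<le> 2 * n + 1 + A + T + 3"
      using 2 order_trans[OF length_nat_bits[of 1]] order_trans[OF length_nat_bits[of 2]]
        order_trans[OF length_nat_bits[of "3 + length u"]] lu by (auto simp: s)
    then show ?thesis by simp
  next
    case 6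
    then have "s r = s1 (8 + (r - 8))" using s3[of r] by (simp add: s s2_def)
    moreover have "r - 8 \<le> length ps" using 6 by simp
    ultimately show ?thesis using A(2)[of "r - 8"] by simp
  next
    case 7
    then have "s r = s3 (9 + length ps + (r - (9 + length ps)))" by (simp add: s)
    moreover have "r - (9 + length ps) \<le> length qs" using 7 by simp
    ultimately show ?thesis using T(2)[of "r - (9 + length ps)"] by simp
  qed (use init lu lv s3[of r] s1[of r] in \<open>auto simp: s s2_def n_def input_regs_def\<close>)
qed

section \<open>Well-formedness and registers of the reduction program\<close>

lemma emit_index_regs:
  assumes "d < 3" "ro > 5"
  shows "wf_cmd (emit_index g ro (d, sl))" "regs_of (emit_index g ro (d, sl)) \<subseteq> {1, 2, 3, 4, 5, ro}"
proof -
  have d: "1 + d \<in> {1, 2, 3}" using assms(1) by auto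
  show "wf_cmd (emit_index g ro (d, sl))" using assms by (simp add: emit_index_def)
  have "regs_of (emit_index g ro (d, sl)) \<subseteq> {ro, 1 + d}"
    unfolding emit_index_def prod.case regs_of_seqs
    using regs_of_put[of ro] regs_of_copy[of ro "1 + d"] by fastforce
  then show "regs_of (emit_index g ro (d, sl)) \<subseteq> {1, 2, 3, 4, 5, ro}" using d by blast
qed

lemma emit_person_regs:
  assumes "d < 3" "d' < 3" "ro > 5"
  shows "wf_cmd (emit_person g ro (d, sl) (d', sl'))"
    "regs_of (emit_person g ro (d, sl) (d', sl')) \<subseteq> {1, 2, 3, 4, 5, ro}"
proof -
  have p: "regs_of (put ro bs) \<subseteq> {1, 2, 3, 4, 5, ro}" for bs using regs_of_put[of ro bs] by blast
  show "wf_cmd (emit_person g ro (d, sl) (d', sl'))"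
    using emit_index_regs(1) assms by (simp add: emit_person_def)
  show "regs_of (emit_person g ro (d, sl) (d', sl')) \<subseteq> {1, 2, 3, 4, 5, ro}"
    using emit_index_regs(2)[OF assms(1,3)] emit_index_regs(2)[OF assms(2,3)] p
    unfolding emit_person_def regs_of_seqs by (simp add: Un_least)
qed

lemma emit_block_regs:
  assumes "ro > 5"
  shows "wf_cmd (emit_block g ro c)" "regs_of (emit_block g ro c) \<subseteq> {1, 2, 3, 4, 5, ro}"
proof -
  have e: "wf_cmd (emit_entry g ro e) \<and> regs_of (emit_entry g ro e) \<subseteq> {1, 2, 3, 4, 5, ro}"
    if e: "e \<in> set (block g c)" for e
  proof -
    obtain sl d1 s1 d2 s2 where [simp]: "e = (sl, (d1, s1), (d2, s2))" by (metis prod.collapse)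
    have "d1 < 3" "d2 < 3" using block_targets[of sl d1 s1 d2 s2] e by simp_all
    then show ?thesis
      using emit_person_regs[OF _ _ assms, of 0] by (simp add: emit_entry_def Un_least)
  qed
  have p: "regs_of (put 5 bs) \<subseteq> {1, 2, 3, 4, 5, ro}" for bs using regs_of_put[of 5 bs] by blast
  show "wf_cmd (emit_block g ro c)" using e by (simp add: emit_block_def)
  have "(\<Union>e\<in>set (block g c). regs_of (emit_entry g ro e)) \<subseteq> {1, 2, 3, 4, 5, ro}" using e by blast
  then show "regs_of (emit_block g ro c) \<subseteq> {1, 2, 3, 4, 5, ro}"
    using p unfolding emit_block_def regs_of_seqs by (simp add: Un_least)
qed

lemma emit_layout_regs:
  assumes "ro > 7" "rA > 7" "rT > 7" "rA \<noteq> ro" "rT \<noteq> ro"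
  shows "wf_cmd (emit_layout g ro L rA rT)"
    "regs_of (emit_layout g ro L rA rT) \<subseteq> {0, 1, 2, 3, 4, 5, 6, rA, rT, ro}"
proof -
  have ro: "ro > 5" using assms(1) by simp
  note r = emit_block_regs(2)[OF ro, of g]
  have n: "r \<notin> regs_of (emit_block g ro c)" if r: "r \<notin> {1, 2, 3, 4, 5, ro}" for r c
    using emit_block_regs(2)[OF ro, of g c] r by blast
  show "wf_cmd (emit_layout g ro L rA rT)"
    using emit_block_regs(1)[OF ro] n assms by (simp add: emit_layout_def Let_def)
  have r': "regs_of (emit_block g ro c) \<subseteq> {0, 1, 2, 3, 4, 5, 6, rA, rT, ro}" for c
    using r[of c] by blast
  show "regs_of (emit_layout g ro L rA rT) \<subseteq> {0, 1, 2, 3, 4, 5, 6, rA, rT, ro}"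
    using r' by (simp add: emit_layout_def Let_def Un_least)
qed

lemma reduction_cmd_regs:
  "wf_cmd (reduction_cmd g L ps qs)"
  "regs_of (reduction_cmd g L ps qs) \<subseteq> {..<11 + length ps + length qs}"
proof -
  let ?ro = "10 + length ps + length qs"
  let ?R = "{..<11 + length ps + length qs}"
  have c: "regs_of (copy r q e) \<subseteq> ?R" if r: "r \<in> ?R" "q \<in> ?R" for r q e
    using regs_of_copy[of r q e] r by blast
  have p: "regs_of (put r bs) \<subseteq> ?R" if r: "r \<in> ?R" for r bs
    using regs_of_put[of r bs] r by blast
  have h: "regs_of (horner as r q) \<subseteq> ?R" if r: "r \<in> ?R" "q + length as \<in> ?R" for as r q
  proof -
    have "insert r {q..q + length as} \<subseteq> ?R" using r by auto
    then show ?thesis using regs_of_horner[of as r q] by blast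
  qed
  have s: "wf_cmd (reduction_setup ps qs)" "regs_of (reduction_setup ps qs) \<subseteq> ?R"
    unfolding reduction_setup_def by (simp_all add: wf_horner c h)
  have f: "wf_cmd (reduction_finish g ?ro)" "regs_of (reduction_finish g ?ro) \<subseteq> ?R"
    unfolding reduction_finish_def by (simp_all add: c p)
  have l: "wf_cmd (emit_layout g ?ro L (8 + length ps) (9 + length ps + length qs))"
    "regs_of (emit_layout g ?ro L (8 + length ps) (9 + length ps + length qs)) \<subseteq> ?R"
    using emit_layout_regs[of ?ro "8 + length ps" "9 + length ps + length qs" g L] by auto
  show "wf_cmd (reduction_cmd g L ps qs)" using s f l by (simp add: reduction_cmd_def Let_def)
  show "regs_of (reduction_cmd g L ps qs) \<subseteq> ?R"
    using s f l by (simp add: reduction_cmd_def Let_def)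
qed

text \<open>Each register is bounded by one of the summands, and their sum serves for all registers
  at once.\<close>

lemma exec_reduction_cmd:
  fixes x ps qs L g r
  defines "A \<equiv> horner_val ps (length x)"
  defines "T \<equiv> horner_val qs (2 * length x + 1 + A)"
  defines "W \<equiv> 2 * length x + 1 + A + T + 2"
  defines "cs \<equiv> layout L x A T"
  defines "ro \<equiv> 10 + length ps + length qs"
  defines "s \<equiv> exec (reduction_cmd g L ps qs) (input_regs x)"
  shows "s ro = encode (grid_instance g W cs)"
    and "length (s r) \<le> length x + (W + 2) + sum_list ps * (length x + 1) ^ length ps +
      sum_list qs * (2 * length x + 1 + A + 1) ^ length qs +
      (length cs + W + 2) + grid_budget g cs + length (encode (grid_instance g W cs))"
proof -
  define s0 where "s0 = exec (reduction_setup ps qs) (input_regs x)"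
  define s1 where "s1 = exec (emit_layout g ro L (8 + length ps) (9 + length ps + length qs)) s0"
  note set = exec_reduction_setup[where x = x and ps = ps and qs = qs, folded s0_def A_def, folded T_def]
  have "positions W 1 s0"
    unfolding positions_def
  proof (intro conjI allI impI)
    have e: "1 + 0 = (1 :: nat)" "1 + 1 = (2 :: nat)" "1 + 2 = (3 :: nat)" by simp_all
    have o: "1 + offset W 0 = 1" "1 + offset W 1 = 2" "1 + offset W 2 = 2 * length x + 1 + A + T + 3"
      by (simp_all add: offset_def W_def)
    fix d :: nat assume "d < 3"
    then have "d = 0 \<or> d = 1 \<or> d = 2" by linarith
    then show "s0 (1 + d) = nat_bits (1 + offset W d)"
      by (elim disjE) (simp_all only: e o set(2-4))
  qed simp
  then have "emitted g W ro s0 [] s0"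
    using set(5,6) set(11)[of ro]
    by (simp add: emitted_def grid_budget_def nat_bits_0 grid_entries_def people_bits_def ro_def)
  then have em: "emitted g W ro s0 cs s1"
    unfolding s1_def cs_def by (rule emitted_layout) (use set in \<open>simp_all add: ro_def\<close>)
  have s: "s = exec (reduction_finish g ro) s1"
    by (simp add: s_def reduction_cmd_def s1_def s0_def ro_def Let_def)
  have s': "s = s1(ro := encode (grid_instance g W cs), 5 := s1 5 @ price_bits g)"
    unfolding s reduction_finish_def
    using em ro_def by (auto simp: emitted_def encode_grid_instance concat_singletons enc_nat_concat[of "grid_budget g cs"]
      concat_replicate_Suc simp del: replicate_Suc)
  show "s ro = encode (grid_instance g W cs)" using s' ro_def by simp
  let ?E = "length (encode (grid_instance g W cs))"
  have e5: "length (s1 5 @ price_bits g) \<le> ?E"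
    using em by (simp add: emitted_def encode_grid_instance concat_replicate_Suc del: replicate_Suc)
  have p: "length (s1 (1 + d)) \<le> length cs + W + 2" if d: "d < 3" for d
  proof -
    have "s1 (1 + d) = nat_bits (length cs + 1 + offset W d)"
      using em d by (simp add: emitted_def positions_def)
    moreover have "offset W d \<le> W + 1" by (simp add: offset_def)
    ultimately show ?thesis using length_nat_bits[of "length cs + 1 + offset W d"] by simp
  qed
  have b4: "length (s1 4) \<le> grid_budget g cs"
    using em length_nat_bits by (simp add: emitted_def)
  consider "r = ro" | "r = 5" | "r = 1 \<or> r = 2 \<or> r = 3" | "r = 4" | "r \<notin> {1, 2, 3, 4, 5, ro}"
    by blast
  then show "length (s r) \<le> length x + (W + 2) + sum_list ps * (length x + 1) ^ length ps +
      sum_list qs * (2 * length x + 1 + A + 1) ^ length qs +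
      (length cs + W + 2) + grid_budget g cs + ?E"
  proof cases
    case 1
    then show ?thesis using s' ro_def by simp
  next
    case 2
    then show ?thesis using s' e5 by simp
  next
    case 3
    then have "s r = s1 r" using s' ro_def by auto
    moreover have "length (s1 (1 + (r - 1))) \<le> length cs + W + 2" using 3 by (intro p) auto
    moreover have "1 + (r - 1) = r" using 3 by auto
    ultimately show ?thesis by simp
  next
    case 4
    then show ?thesis using s' b4 ro_def by simp
  next
    case 5
    then have "s r = s0 r" using s' em by (simp add: emitted_def)
    then show ?thesis using set(12)[of r] by (simp add: W_def)
  qed
qed

section \<open>Size of the encoded instance\<close>

lemma length_person_bits: "length (person_bits b s) \<le> 2 * b + 2 * s + 20"
  using length_enc_nat[of b] length_enc_nat[of s] length_enc_nat[of 0] length_enc_nat[of 1]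
  by (simp add: person_bits_def)

lemma length_block: "length (block g c) \<le> g + 3 * (g * g)"
  using length_conflicts[of g c] by (simp add: block_def)

lemma sum_list_le: "(\<And>x. x \<in> set xs \<Longrightarrow> f x \<le> B) \<Longrightarrow> (\<Sum>x\<leftarrow>xs. f x) \<le> length xs * (B :: nat)"
proof (induction xs)
  case (Cons a xs)
  then have "f a \<le> B" "(\<Sum>x\<leftarrow>xs. f x) \<le> length xs * B" by auto
  then show ?case by simp
qed simp

lemma grid_budget_le: "grid_budget g cs \<le> length cs * (g + 3 * (g * g))"
  unfolding grid_budget_def
proof (rule sum_list_le)
  fix c show "g - 1 + length (conflicts g c) \<le> g + 3 * (g * g)" using length_conflicts[of g c] by simp
qed

text \<open>\<open>M\<close> bounds every item number. As \<open>M\<close> is polynomial itself,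
  binary numbers may be estimated by a linear function of their values; an entry describes two
  people with two item numbers each, which gives \<open>8 * M + 40\<close>.\<close>

lemma length_encode_grid_instance:
  fixes g W cs
  defines "M \<equiv> 2 ^ slot_bits g * (length cs + W + 2)"
  shows "length (encode (grid_instance g W cs)) \<le>
    length cs * ((g + 3 * (g * g)) * (8 * M + 40)) + (length cs + 1) * length (price_bits g) +
    2 * (length cs * (g + 3 * (g * g))) + 20"
proof -
  have person: "length ((\<lambda>(b, s, t). person_bits b s @ person_bits b t) e) \<le> 8 * M + 40"
    if e: "e \<in> set (grid_entries g W cs)" for e
  proof -
    obtain p y where p: "p < length cs" "e = place g W (p + 1) y" "y \<in> set (block g (cs ! p))"
      using e unfolding in_grid_entries by blast
    obtain sl d1 s1 d2 s2 where y: "y = (sl, (d1, s1), (d2, s2))" by (metis prod.collapse)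
    note t = block_targets[OF p(3)[unfolded y]]
    have item: "item_of g (p + 1 + offset W d) k \<le> M" if k: "k < 2 ^ slot_bits g" for d k
    proof -
      have "item_of g (p + 1 + offset W d) k \<le> 2 ^ slot_bits g * (p + 1 + offset W d + 1)"
        using k by (simp add: item_of_def)
      also have "\<dots> \<le> M"
        unfolding M_def using p(1) by (intro mult_le_mono) (auto simp: offset_def)
      finally show ?thesis .
    qed
    have i: "item_of g (p + 1) sl \<le> M" using item[OF t(1), of 0] by simp
    show ?thesis
      using i item[OF t(2), of d1] item[OF t(3), of d2]
        length_person_bits[of "item_of g (p + 1) sl" "item_of g (p + 1 + offset W d1) s1"]
        length_person_bits[of "item_of g (p + 1) sl" "item_of g (p + 1 + offset W d2) s2"]
      by (simp add: p(2) y place_def)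
  qed
  have "length (people_bits (grid_entries g W cs)) \<le> length (grid_entries g W cs) * (8 * M + 40)"
    unfolding people_bits_def length_concat map_map
    using sum_list_le[OF person] by (simp add: o_def)
  moreover have "length (grid_entries g W cs) \<le> length cs * (g + 3 * (g * g))"
  proof -
    have "length (grid_entries g W cs) = (\<Sum>y\<leftarrow>List.enumerate 1 cs. length (block g (snd y)))"
      by (simp add: grid_entries_def length_concat o_def case_prod_beta)
    also have "\<dots> \<le> length (List.enumerate 1 cs) * (g + 3 * (g * g))"
      by (intro sum_list_le length_block)
    finally show ?thesis by simp
  qed
  ultimately have "length (people_bits (grid_entries g W cs)) \<le> length cs * (g + 3 * (g * g)) * (8 * M + 40)"
    by (meson mult_le_mono1 order_trans)
  moreover have "length (concat (replicate (length cs + 1) (price_bits g))) = (length cs + 1) * length (price_bits g)"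
    by (simp only: length_concat map_replicate sum_list_replicate of_nat_id)
  moreover have "length (enc_nat (grid_budget g cs)) \<le> 2 * (length cs * (g + 3 * (g * g))) + 1"
    using length_enc_nat[of "grid_budget g cs"] grid_budget_le[of g cs] by linarith
  ultimately show ?thesis
    using length_enc_nat[of 1] unfolding encode_grid_instance length_append by (simp add: mult.assoc)
qed

lemma is_poly_power: "is_poly f \<Longrightarrow> is_poly (\<lambda>x. f x ^ k)"
  by (induction k) (auto intro!: is_poly_intros)

text \<open>\<open>g\<close>, \<open>L\<close> and the coefficients of \<open>p\<close> and
  \<open>q\<close> are constants of the program. The values \<open>A\<close> and \<open>T\<close>
  are computed as lengths of registers and so serve directly as loop bounds.\<close>

theorem polytime_grid_instance:
  fixes p q :: "nat poly"
  defines "A \<equiv> \<lambda>n. poly p n"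
  defines "T \<equiv> \<lambda>n. poly q (2 * n + 1 + A n)"
  defines "W \<equiv> \<lambda>n. 2 * n + 1 + A n + T n + 2"
  shows "polytime (\<lambda>x. encode (grid_instance g (W (length x)) (layout L x (A (length x)) (T (length x)))))"
proof -
  let ?ps = "coeffs p" and ?qs = "coeffs q"
  \<comment> \<open>\<open>N n\<close> is the number of cells, \<open>M n\<close> a bound on all
    item numbers.\<close>
  define N where "N n = (T n + 2) * W n" for n
  define M where "M n = 2 ^ slot_bits g * (N n + W n + 2)" for n
  define b where "b n = n + (W n + 2) + sum_list ?ps * (n + 1) ^ length ?ps +
      sum_list ?qs * (2 * n + 1 + A n + 1) ^ length ?qs +
      (N n + W n + 2) + N n * (g + 3 * (g * g)) +
      (N n * ((g + 3 * (g * g)) * (8 * M n + 40)) + (N n + 1) * length (price_bits g) +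
       2 * (N n * (g + 3 * (g * g))) + 20)" for n
  have A: "is_poly A" unfolding A_def by (rule is_poly_intros)
  have "is_poly (\<lambda>n. 2 * n + 1 + A n)" by (intro is_poly_intros A)
  then have T: "is_poly T" unfolding T_def by (rule is_poly_compose[OF is_poly_intros(3)])
  have W: "is_poly W" unfolding W_def by (intro is_poly_intros A T)
  have N: "is_poly N" unfolding N_def by (intro is_poly_intros T W)
  have M: "is_poly M" unfolding M_def by (intro is_poly_intros N W)
  have b: "is_poly b" unfolding b_def by (intro is_poly_intros is_poly_power A W N M)
  let ?c = "reduction_cmd g L ?ps ?qs"
  let ?k = "11 + length ?ps + length ?qs"
  have out: "exec ?c (input_regs x) (?k - 1) =
      encode (grid_instance g (W (length x)) (layout L x (A (length x)) (T (length x))))" for x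
  proof -
    have k: "?k - 1 = 10 + length ?ps + length ?qs" by simp
    show ?thesis
      using exec_reduction_cmd(1)[of g L ?ps ?qs x]
      unfolding k horner_val_coeffs A_def T_def W_def .
  qed
  have len: "length (exec ?c (input_regs x) r) \<le> b (length x)" for x r
  proof -
    let ?cs = "layout L x (A (length x)) (T (length x))"
    have cs: "length ?cs = N (length x)" by (simp add: length_layout N_def W_def)
    have "length (exec ?c (input_regs x) r) \<le>
      length x + (W (length x) + 2) + sum_list ?ps * (length x + 1) ^ length ?ps +
      sum_list ?qs * (2 * length x + 1 + A (length x) + 1) ^ length ?qs +
      (length ?cs + W (length x) + 2) + grid_budget g ?cs +
      length (encode (grid_instance g (W (length x)) ?cs))"
      using exec_reduction_cmd(2)[of g L ?ps ?qs x r]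
      unfolding horner_val_coeffs A_def T_def W_def .
    also have "\<dots> \<le> b (length x)"
      unfolding b_def M_def cs[symmetric]
      by (intro add_mono order_refl grid_budget_le length_encode_grid_instance)
    finally show ?thesis .
  qed
  have "polytime (\<lambda>x. exec ?c (input_regs x) (?k - 1))"
    by (rule polytime_exec[OF reduction_cmd_regs _ b len]) simp
  then show ?thesis unfolding out .
qed

section \<open>Computation tableaux\<close>

text \<open>The tile at column \<open>i\<close> of row \<open>t\<close> contains the state at time \<open>t\<close>, the symbols under the heads,
  the symbols of all tapes in cell \<open>i\<close>, and the positions of all heads relative to cell \<open>i\<close>:
  0, 1, 2 for a head to the left of, at, and to the right of the cell. Since the state and the
  symbols under the heads are known in every column, all rules become local.\<close>

datatype tile = Tile (state_of: nat) (read_of: "nat list") (cell_of: "nat list") (rel_of: "nat list")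

definition rel :: "nat \<Rightarrow> nat \<Rightarrow> nat" where
  "rel h i = (if h < i then 0 else if h = i then 1 else 2)"

text \<open>Where one column cannot tell how far away the head is, two outcomes stay open, and the
  horizontal rule decides. The flag \<open>b\<close> marks column 0, where a left move has no
  effect.\<close>

definition rel_step :: "bool \<Rightarrow> move \<Rightarrow> nat \<Rightarrow> nat \<Rightarrow> bool" where
  "rel_step b m r r' = (case m of
     Stay \<Rightarrow> r' = r
   | Go_Right \<Rightarrow> (if r = 0 then r' \<noteq> 2 else r' = 2)
   | Go_Left \<Rightarrow> (if r = 0 then r' = 0 else if r = 1 then r' = (if b then 1 else 0) else r' \<noteq> 0))"

definition rel_next :: "nat \<Rightarrow> nat \<Rightarrow> bool" where
  "rel_next r r' \<longleftrightarrow> (if r = 2 then r' \<noteq> 0 else r' = 0)"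

lemma rel_step_rel: "rel_step (i = 0) m (rel h i) (rel (move_head m h) i)"
  by (cases m) (auto simp: rel_step_def rel_def)

lemma rel_next_rel: "rel_next (rel h i) (rel h (i + 1))"
  by (auto simp: rel_next_def rel_def)

lemma rel_eq_1: "rel h i = Suc 0 \<longleftrightarrow> h = i"
  by (simp add: rel_def)

lemma rel_less_3: "rel h i < 3"
  by (simp add: rel_def)

text \<open>To the right of the head, 1 and then 0 force 0. Going left, 0 or 1 would force 0 in the
  next column, where 1 or 2 stands, so only 2 remains.\<close>

lemma rel_determined:
  assumes nx: "\<And>i. i + 1 < W \<Longrightarrow> rel_next (f i) (f (i + 1))" and r: "\<And>i. i < W \<Longrightarrow> f i < 3"
    and h: "h < W" "f h = 1" and i: "i < W"
  shows "f i = rel h i"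
proof -
  have "f (h + 1 + d) = 0" if "h + 1 + d < W" for d
    using that
  proof (induction d)
    case 0
    then show ?case using nx[of h] h by (simp add: rel_next_def)
  next
    case (Suc d)
    then show ?case using nx[of "h + 1 + d"] by (simp add: rel_next_def)
  qed
  from this[of "i - (h + 1)"] have above: "f i = 0" if "h < i" using that i by simp
  have "f (h - d) = (if d = 0 then 1 else 2)" if "d \<le> h" for d
    using that
  proof (induction d)
    case (Suc d)
    then have "rel_next (f (h - Suc d)) (f (h - d))"
      using nx[of "h - Suc d"] h by (simp add: Suc_diff_Suc)
    then show ?case using Suc r[of "h - Suc d"] h by (auto simp: rel_next_def split: if_splits)
  qed (use h in simp)
  from this[of "h - i"] have below: "f i = (if i = h then 1 else 2)" if "i \<le> h" using that by simp
  show ?thesis using above below by (auto simp: rel_def)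
qed

text \<open>It suffices to find the 1 in its new place. After a right move, column \<open>h\<close>
  has 2, so column \<open>h + 1\<close> is not 0, while \<open>rel_step\<close> forbids 2 there.
  After a left move from \<open>h > 0\<close>, column \<open>h\<close> has 0, so column
  \<open>h - 1\<close> is not 2, while \<open>rel_step\<close> forbids 0 there.\<close>

lemma rel_moved:
  assumes nx: "\<And>i. i + 1 < W \<Longrightarrow> rel_next (f i) (f (i + 1))" and r: "\<And>i. i < W \<Longrightarrow> f i < 3"
    and step: "\<And>i. i < W \<Longrightarrow> rel_step (i = 0) m (rel h i) (f i)" and h: "h + 1 < W" and i: "i < W"
  shows "f i = rel (move_head m h) i"
proof -
  have "move_head m h < W" using h by (cases m) auto
  moreover have "f (move_head m h) = 1"
  proof (cases m)
    case Stay
    then show ?thesis using step[of h] h by (simp add: rel_step_def rel_def)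
  next
    case Go_Right
    then show ?thesis using step[of h] step[of "h + 1"] nx[of h] r[of "h + 1"] h
      by (auto simp: rel_step_def rel_def rel_next_def)
  next
    case Go_Left
    show ?thesis
    proof (cases "h = 0")
      case True
      then show ?thesis using Go_Left step[of 0] h by (simp add: rel_step_def rel_def)
    next
      case False
      then have "f h = 0" "f (h - 1) \<noteq> 0" "f (h - 1) < 3" "rel_next (f (h - 1)) (f h)"
      proof -
        have "h - 1 < h" using False by simp
        then have "h - 1 < W" "h < W" "h - 1 + 1 < W" "rel h (h - 1) = 2" "rel h h = 1"
          using h by (simp_all add: rel_def)
        then show "f h = 0" "f (h - 1) \<noteq> 0" "f (h - 1) < 3" "rel_next (f (h - 1)) (f h)"
          using Go_Left step[of h] step[of "h - 1"] nx[of "h - 1"] r[of "h - 1"] False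
          by (simp_all add: rel_step_def)
      qed
      then show ?thesis using Go_Left by (auto simp: rel_next_def split: if_splits)
    qed
  qed
  ultimately show ?thesis using rel_determined[where f = f and W = W and i = i, OF nx r _ _ i] by blast
qed

section \<open>Machine steps as rules between neighbouring tiles\<close>

locale machine =
  fixes M :: tm
  assumes valid: "valid_tm M"
begin

abbreviation "k \<equiv> tapes M"

text \<open>Halting becomes an ordinary action that rewrites what it reads, so one vertical rule
  covers all rows, also those after the machine has halted.\<close>

definition action :: "nat \<Rightarrow> nat list \<Rightarrow> nat \<times> (nat \<times> move) list" where
  "action q ss = (if q = 1 then (q, map (\<lambda>s. (s, Stay)) ss) else trans M q ss)"

definition reads :: "config \<Rightarrow> nat list" where
  "reads c = map tape_read (snd c)"

lemma tm_step_action: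
  "tm_step M c = (fst (action (fst c) (reads c)), map2 tape_act (snd (action (fst c) (reads c))) (snd c))"
proof (cases "fst c = 1")
  case True
  have "map2 tape_act (map (\<lambda>s. (s, Stay)) (map tape_read ts)) ts = ts" for ts :: "tape list"
    by (rule nth_equalityI) (auto simp: tape_act_def tape_read_def)
  then show ?thesis using True by (simp add: tm_step_def action_def reads_def prod_eq_iff)
qed (simp add: tm_step_def action_def reads_def Let_def)

definition valid_config :: "config \<Rightarrow> bool" where
  "valid_config c \<longleftrightarrow> fst c < states M \<and> length (snd c) = k \<and>
     (\<forall>j<k. \<forall>i. fst (snd c ! j) i < symbols M)"

lemma valid_action:
  assumes "q < states M" "length ss = k" "set ss \<subseteq> {..<symbols M}"
  shows "fst (action q ss) < states M" "length (snd (action q ss)) = k"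
    "j < k \<Longrightarrow> fst (snd (action q ss) ! j) < symbols M"
proof -
  have *: "fst (action q ss) < states M \<and> length (snd (action q ss)) = k \<and>
      fst ` set (snd (action q ss)) \<subseteq> {..<symbols M}"
    using assms valid unfolding action_def valid_tm_def by auto
  then show "fst (action q ss) < states M" "length (snd (action q ss)) = k" by auto
  show "fst (snd (action q ss) ! j) < symbols M" if "j < k"
  proof -
    have "snd (action q ss) ! j \<in> set (snd (action q ss))" using * that by (intro nth_mem) simp
    then show ?thesis using * by blast
  qed
qed

lemma valid_cells:
  assumes "valid_config c" "t \<in> set (snd c)"
  shows "fst t i < symbols M"
  using assms by (metis in_set_conv_nth valid_config_def)

lemma valid_reads:
  assumes "valid_config c"
  shows "length (reads c) = k" "set (reads c) \<subseteq> {..<symbols M}"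
  using assms valid_cells[OF assms] by (auto simp: valid_config_def reads_def tape_read_def)

lemma valid_config_step:
  assumes c: "valid_config c"
  shows "valid_config (tm_step M c)"
proof -
  note a = valid_action[OF _ valid_reads[OF c], of "fst c"]
  show ?thesis
    using c a unfolding tm_step_action valid_config_def
    by (auto simp: tape_act_def)
qed

lemma valid_config_init: "valid_config (tm_init M y)"
  using valid
  by (auto simp: valid_config_def tm_init_def valid_tm_def tape_content_def nth_Cons' )

abbreviation run :: "bool list \<Rightarrow> nat \<Rightarrow> config" where
  "run y t \<equiv> (tm_step M ^^ t) (tm_init M y)"

lemma valid_run: "valid_config (run y t)"
  by (induction t) (auto simp: valid_config_init valid_config_step)

text \<open>A head advances by at most one cell per step, so a grid that is wider than its number of
  rows contains all heads.\<close>

lemma head_bound: "j < k \<Longrightarrow> snd (snd (run y t) ! j) \<le> t"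
proof (induction t)
  case 0
  then show ?case by (auto simp: tm_init_def nth_Cons')
next
  case (Suc t)
  let ?c = "run y t"
  note a = valid_action[OF _ valid_reads[OF valid_run[where y = y and t = t]], of "fst ?c"]
  have l: "length (snd ?c) = k" "fst ?c < states M" using valid_run[where y = y and t = t] by (auto simp: valid_config_def)
  let ?m = "snd (snd (action (fst ?c) (reads ?c)) ! j)"
  have "snd (snd (run y (Suc t)) ! j) = move_head ?m (snd (snd ?c ! j))"
    using a l Suc.prems by (simp add: tm_step_action tape_act_def)
  moreover have "move_head ?m (snd (snd ?c ! j)) \<le> snd (snd ?c ! j) + 1" by (cases ?m) auto
  ultimately show ?case using Suc by linarith
qed

definition snapshot :: "config \<Rightarrow> nat \<Rightarrow> tile" where
  "snapshot c i = Tile (fst c) (reads c) (map (\<lambda>t. fst t i) (snd c)) (map (\<lambda>t. rel (snd t) i) (snd c))"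

definition tiles :: "tile set" where
  "tiles = (\<lambda>(q, a, b, c). Tile q a b c) ` ({..<states M} \<times> {a. set a \<subseteq> {..<symbols M} \<and> length a = k} \<times>
     {a. set a \<subseteq> {..<symbols M} \<and> length a = k} \<times> {a. set a \<subseteq> {..<3} \<and> length a = k})"

lemma finite_tiles: "finite tiles"
  unfolding tiles_def by (intro finite_imageI finite_cartesian_product finite_lists_length_eq) auto

lemma in_tiles: "z \<in> tiles \<longleftrightarrow> state_of z < states M \<and>
   set (read_of z) \<subseteq> {..<symbols M} \<and> length (read_of z) = k \<and>
   set (cell_of z) \<subseteq> {..<symbols M} \<and> length (cell_of z) = k \<and>
   set (rel_of z) \<subseteq> {..<3} \<and> length (rel_of z) = k" (is "_ \<longleftrightarrow> ?r")
proof
  assume r: ?r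
  show "z \<in> tiles"
    unfolding tiles_def
    by (rule image_eqI[of _ _ "(state_of z, read_of z, cell_of z, rel_of z)"]) (use r in auto)
qed (auto simp: tiles_def)

lemma snapshot_in_tiles:
  assumes "valid_config c"
  shows "snapshot c i \<in> tiles"
proof -
  have "set (map (\<lambda>t. fst t i) (snd c)) \<subseteq> {..<symbols M}" 
    using valid_cells[OF assms] by auto
  then show ?thesis
    using assms valid_reads[OF assms] rel_less_3 by (auto simp: in_tiles snapshot_def valid_config_def)
qed

definition consistent :: "tile \<Rightarrow> bool" where
  "consistent z \<longleftrightarrow> (\<forall>j<k. rel_of z ! j = 1 \<longrightarrow> cell_of z ! j = read_of z ! j)"

text \<open>\<open>b\<close> marks column 0, where all heads start and where every tape carries the
  marker 1.\<close>

definition initial :: "nat set \<Rightarrow> bool \<Rightarrow> tile \<Rightarrow> bool" where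
  "initial S b z \<longleftrightarrow> state_of z = 0 \<and> cell_of z ! 0 \<in> S \<and>
     (\<forall>j<k. 0 < j \<longrightarrow> cell_of z ! j = (if b then 1 else 0)) \<and>
     (\<forall>j<k. rel_of z ! j = (if b then 1 else 0))"

definition horizontal :: "tile \<Rightarrow> tile \<Rightarrow> bool" where
  "horizontal z z' \<longleftrightarrow> state_of z' = state_of z \<and> read_of z' = read_of z \<and>
     (\<forall>j<k. rel_next (rel_of z ! j) (rel_of z' ! j))"

text \<open>In the first row, a blank on the input tape is followed by blanks only, so the guessed
  certificate has no gaps.\<close>

definition horizontal0 :: "tile \<Rightarrow> tile \<Rightarrow> bool" where
  "horizontal0 z z' \<longleftrightarrow> horizontal z z' \<and> (cell_of z ! 0 = 0 \<longrightarrow> cell_of z' ! 0 = 0)"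

definition vertical :: "bool \<Rightarrow> tile \<Rightarrow> tile \<Rightarrow> bool" where
  "vertical b z z' \<longleftrightarrow> (case action (state_of z) (read_of z) of (q, as) \<Rightarrow>
     state_of z' = q \<and>
     (\<forall>j<k. cell_of z' ! j = (if rel_of z ! j = 1 then fst (as ! j) else cell_of z ! j) \<and>
       rel_step b (snd (as ! j)) (rel_of z ! j) (rel_of z' ! j)))"

definition final :: "nat \<Rightarrow> tile \<Rightarrow> bool" where
  "final s z \<longleftrightarrow> state_of z = 1 \<and> last (cell_of z) = s"

lemma consistent_snapshot:
  assumes "valid_config c"
  shows "consistent (snapshot c i)"
  using assms by (auto simp: consistent_def snapshot_def valid_config_def reads_def rel_def tape_read_def)

lemma horizontal_snapshot:
  assumes "valid_config c"
  shows "horizontal (snapshot c i) (snapshot c (i + 1))"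
  using assms rel_next_rel by (auto simp: horizontal_def snapshot_def valid_config_def)

lemma nth_tapes_step:
  assumes "valid_config c" "j < k"
  shows "snd (tm_step M c) ! j = tape_act (snd (action (fst c) (reads c)) ! j) (snd c ! j)"
  using assms valid_action[OF _ valid_reads[OF assms(1)], of "fst c"]
  by (simp add: tm_step_action valid_config_def)

lemma vertical_snapshot:
  assumes c: "valid_config c"
  shows "vertical (i = 0) (snapshot c i) (snapshot (tm_step M c) i)"
proof -
  have l: "length (snd c) = k" "length (snd (tm_step M c)) = k"
    using c valid_config_step[OF c] by (auto simp: valid_config_def)
  show ?thesis
    unfolding vertical_def snapshot_def
    using l rel_step_rel
    by (auto simp: nth_tapes_step[OF c] tape_act_def rel_eq_1 tm_step_action[of c] split: prod.split)
qed

text \<open>State and cells are forced by the row above alone; head positions and the symbols read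
  also need the horizontal rule.\<close>

lemma vertical_cells:
  assumes c: "valid_config c" and z: "vertical b (snapshot c i) z" "z \<in> tiles"
  shows "state_of z = fst (tm_step M c)" "cell_of z = map (\<lambda>t. fst t i) (snd (tm_step M c))"
proof -
  have l: "length (snd c) = k" "length (snd (tm_step M c)) = k"
    using c valid_config_step[OF c] by (auto simp: valid_config_def)
  show "state_of z = fst (tm_step M c)"
    using z(1) by (auto simp: vertical_def snapshot_def tm_step_action[of c] split: prod.splits)
  show "cell_of z = map (\<lambda>t. fst t i) (snd (tm_step M c))"
  proof (rule nth_equalityI)
    show "length (cell_of z) = length (map (\<lambda>t. fst t i) (snd (tm_step M c)))"
      using z(2) l by (simp add: in_tiles)
    fix j assume "j < length (cell_of z)"
    then have j: "j < k" using z(2) by (simp add: in_tiles)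
    then show "cell_of z ! j = map (\<lambda>t. fst t i) (snd (tm_step M c)) ! j"
      using z(1) l
      by (auto simp: vertical_def snapshot_def nth_tapes_step[OF c] tape_act_def rel_eq_1 split: prod.splits if_splits)
  qed
qed

text \<open>Each head stands in some column, where the symbol it reads is known, and the horizontal rule
  carries this symbol to all other columns.\<close>

lemma row_snapshot:
  assumes c: "valid_config c" and heads: "\<And>j. j < k \<Longrightarrow> snd (snd c ! j) < W"
    and z: "\<And>i. i < W \<Longrightarrow> z i \<in> tiles \<and> consistent (z i)" "\<And>i. i + 1 < W \<Longrightarrow> horizontal (z i) (z (i + 1))"
    and s: "\<And>i. i < W \<Longrightarrow> state_of (z i) = fst c"
    and cells: "\<And>i. i < W \<Longrightarrow> cell_of (z i) = map (\<lambda>t. fst t i) (snd c)"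
    and rels: "\<And>i j. i < W \<Longrightarrow> j < k \<Longrightarrow> rel_of (z i) ! j = rel (snd (snd c ! j)) i"
    and i: "i < W"
  shows "z i = snapshot c i"
proof -
  have l: "length (snd c) = k" using c by (simp add: valid_config_def)
  have same: "read_of (z i') = read_of (z 0)" if "i' < W" for i'
    using that
  proof (induction i')
    case (Suc i')
    then show ?case using z(2)[of i'] by (simp add: horizontal_def)
  qed simp
  have "read_of (z i) ! j = reads c ! j" if j: "j < k" for j
  proof -
    let ?h = "snd (snd c ! j)"
    have h: "?h < W" by (rule heads[OF j])
    have "rel_of (z ?h) ! j = 1" using rels[OF h j] by (simp add: rel_def)
    then have "read_of (z ?h) ! j = cell_of (z ?h) ! j" using z(1)[OF h] j by (simp add: consistent_def)
    also have "\<dots> = reads c ! j" using cells[OF h] l j by (simp add: reads_def tape_read_def)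
    finally show ?thesis using same[OF h] same[OF i] by simp
  qed
  then have "read_of (z i) = reads c"
    using z(1)[OF i] valid_reads[OF c] by (intro nth_equalityI) (auto simp: in_tiles)
  moreover have "rel_of (z i) = map (\<lambda>t. rel (snd t) i) (snd c)"
    using z(1)[OF i] rels[OF i] l by (intro nth_equalityI) (auto simp: in_tiles)
  ultimately show ?thesis
    using s[OF i] cells[OF i] by (cases "z i") (simp add: snapshot_def)
qed

lemma tiles_rel:
  assumes "z \<in> tiles" "j < k"
  shows "rel_of z ! j < 3"
proof -
  have "rel_of z ! j \<in> set (rel_of z)" using assms by (intro nth_mem) (simp add: in_tiles)
  moreover have "set (rel_of z) \<subseteq> {..<3}" using assms(1) by (simp add: in_tiles)
  ultimately show ?thesis by blast
qed

text \<open>The vertical rule gives state and cells, \<open>rel_moved\<close> the head positions,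
  and \<open>row_snapshot\<close> then the symbols under the heads. The margin
  \<open>+ 1 < W\<close> keeps a head in the grid after a right move.\<close>

lemma next_row_snapshot:
  assumes c: "valid_config c" and heads: "\<And>j. j < k \<Longrightarrow> snd (snd c ! j) + 1 < W"
    and z: "\<And>i. i < W \<Longrightarrow> z i \<in> tiles \<and> consistent (z i)" "\<And>i. i + 1 < W \<Longrightarrow> horizontal (z i) (z (i + 1))"
    and v: "\<And>i. i < W \<Longrightarrow> vertical (i = 0) (snapshot c i) (z i)"
    and i: "i < W"
  shows "z i = snapshot (tm_step M c) i"
proof (rule row_snapshot[where c = "tm_step M c" and W = W and z = z and i = i,
    OF valid_config_step[OF c] _ z _ _ _ i])
  have l: "length (snd c) = k" using c by (simp add: valid_config_def)
  show "state_of (z i) = fst (tm_step M c)" "cell_of (z i) = map (\<lambda>t. fst t i) (snd (tm_step M c))" if "i < W" for i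
    using vertical_cells[OF c v[OF that]] z(1)[OF that] by simp_all
  have hd: "snd (snd (tm_step M c) ! j) = move_head (snd (snd (action (fst c) (reads c)) ! j)) (snd (snd c ! j))"
    if "j < k" for j
    using nth_tapes_step[OF c that] by (simp add: tape_act_def)
  show "snd (snd (tm_step M c) ! j) < W" if j: "j < k" for j
  proof -
    have "move_head m h \<le> h + 1" for m h by (cases m) auto
    then show ?thesis unfolding hd[OF j] using heads[OF j] by (rule le_less_trans)
  qed
  show "rel_of (z i) ! j = rel (snd (snd (tm_step M c) ! j)) i" if ij: "i < W" "j < k" for i j
    unfolding hd[OF ij(2)]
  proof (rule rel_moved[where W = W and f = "\<lambda>i. rel_of (z i) ! j", OF _ _ _ heads[OF ij(2)] ij(1)])
    show "rel_next (rel_of (z i) ! j) (rel_of (z (i + 1)) ! j)" if "i + 1 < W" for i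
      using z(2)[OF that] ij(2) by (simp add: horizontal_def)
    show "rel_of (z i) ! j < 3" if "i < W" for i
      using tiles_rel z(1)[OF that] ij(2) by blast
    show "rel_step (i = 0) (snd (snd (action (fst c) (reads c)) ! j)) (rel (snd (snd c ! j)) i) (rel_of (z i) ! j)"
      if "i < W" for i
      using v[OF that] ij(2) l by (simp add: vertical_def snapshot_def case_prod_beta)
  qed
qed

end

section \<open>The first row\<close>

text \<open>Codes 1 and 4 are the continuation and end bits of \<open>enc_list\<close>, codes 2 and
  3 the bits of the input; 5 is a free cell of the certificate, 6 and 7 are blanks.\<close>

definition symbols_at :: "nat \<Rightarrow> nat set" where
  "symbols_at c = (if c = 0 then {1} else if c = 1 \<or> c = 3 then {3} else if c = 2 \<or> c = 4 then {2}
     else if c = 5 then {0, 2, 3} else {0})"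

definition first_codes :: "bool list \<Rightarrow> nat \<Rightarrow> nat \<Rightarrow> nat list" where
  "first_codes x A T = [0] @ concat (map (\<lambda>b. [1, if b then 3 else 2]) x) @ [4] @ replicate A 5 @
     replicate T 6 @ [7]"

definition bit_symbol :: "bool \<Rightarrow> nat" where
  "bit_symbol b = (if b then 3 else 2)"

definition zero_closed :: "nat list \<Rightarrow> bool" where
  "zero_closed zs \<longleftrightarrow> (\<forall>i. i + 1 < length zs \<longrightarrow> zs ! i = 0 \<longrightarrow> zs ! (i + 1) = 0)"

lemma length_concat_pairs: "length (concat (map (\<lambda>b. [f b, h b]) x)) = 2 * length x"
  by (induction x) auto

definition width :: "bool list \<Rightarrow> nat \<Rightarrow> nat \<Rightarrow> nat" where
  "width x A T = 2 * length x + 1 + A + T + 2"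

lemma width_pos: "0 < width x A T"
  by (simp add: width_def)

lemma length_first_codes: "length (first_codes x A T) = width x A T"
  by (simp add: first_codes_def length_concat_pairs width_def)

lemma length_layout_width: "length (layout L x A T) = (T + 2) * width x A T"
  by (simp only: length_layout width_def)

lemma map_tape_content:
  assumes "length y < n"
  shows "map (tape_content y) [0..<n] = 1 # map bit_symbol y @ replicate (n - 1 - length y) 0"
proof (rule nth_equalityI)
  fix i assume "i < length (map (tape_content y) [0..<n])"
  then show "map (tape_content y) [0..<n] ! i = (1 # map bit_symbol y @ replicate (n - 1 - length y) 0) ! i"
    by (cases i) (auto simp: tape_content_def nth_append bit_symbol_def)
qed (use assms in simp)

lemma zero_closed_Cons:
  "zero_closed (a # l) \<longleftrightarrow> zero_closed l \<and> (a = 0 \<longrightarrow> l \<noteq> [] \<longrightarrow> hd l = 0)"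
proof (cases l)
  case (Cons b m)
  show ?thesis
  proof
    assume z: "zero_closed (a # l)"
    have "zero_closed l"
      unfolding zero_closed_def
    proof (intro allI impI)
      fix i assume "i + 1 < length l" "l ! i = 0"
      then show "l ! (i + 1) = 0" using z[unfolded zero_closed_def, rule_format, of "Suc i"] by simp
    qed
    moreover have "a = 0 \<longrightarrow> hd l = 0"
      using z[unfolded zero_closed_def, rule_format, of 0] Cons by simp
    ultimately show "zero_closed l \<and> (a = 0 \<longrightarrow> l \<noteq> [] \<longrightarrow> hd l = 0)" by simp
  next
    assume z: "zero_closed l \<and> (a = 0 \<longrightarrow> l \<noteq> [] \<longrightarrow> hd l = 0)"
    show "zero_closed (a # l)"
      unfolding zero_closed_def
    proof (intro allI impI)
      fix i assume i: "i + 1 < length (a # l)" "(a # l) ! i = 0"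
      show "(a # l) ! (i + 1) = 0"
      proof (cases i)
        case 0
        then show ?thesis using i z Cons by simp
      next
        case (Suc j)
        then show ?thesis using i conjunct1[OF z, unfolded zero_closed_def, rule_format, of j] by simp
      qed
    qed
  qed
qed (simp add: zero_closed_def)

lemma zero_closed_append: "zero_closed (l @ m) \<Longrightarrow> zero_closed l \<and> zero_closed m"
proof (induction l)
  case Nil
  then show ?case by (simp add: zero_closed_def)
qed (auto simp: zero_closed_Cons hd_append split: if_splits)

text \<open>Bits never follow a blank, so the part before the first blank is the string
  \<open>u\<close>.\<close>

lemma zero_closed_bits:
  assumes "set l \<subseteq> {0, 2, 3}" "zero_closed l"
  shows "\<exists>u. length u \<le> length l \<and> l = map bit_symbol u @ replicate (length l - length u) 0"
  using assms
proof (induction l)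
  case (Cons a l)
  then obtain u where u: "length u \<le> length l" "l = map bit_symbol u @ replicate (length l - length u) 0"
    by (auto simp: zero_closed_Cons)
  show ?case
  proof (cases "a = 0")
    case True
    have "u = []"
    proof (cases u)
      case (Cons b u')
      then have "hd l = bit_symbol b" "l \<noteq> []" by (subst u(2), simp)+
      moreover have "bit_symbol b \<noteq> 0" by (simp add: bit_symbol_def)
      ultimately show ?thesis using Cons.prems True unfolding zero_closed_Cons by simp
    qed simp
    then show ?thesis using u True by (intro exI[of _ "[]"]) simp
  next
    case False
    then have "a = bit_symbol (a = 3)" using Cons.prems by (auto simp: bit_symbol_def)
    then show ?thesis using u by (intro exI[of _ "(a = 3) # u"]) (simp add: Suc_diff_le)
  qed
qed simp

lemma list_all2_replicate: "list_all2 P xs (replicate n c) \<longleftrightarrow> length xs = n \<and> (\<forall>x\<in>set xs. P x c)"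
  by (auto simp: list_all2_conv_all_nth all_set_conv_all_nth)

lemma list_all2_bits:
  "list_all2 (\<lambda>s c. s \<in> symbols_at c) zs (concat (map (\<lambda>b. [1, if b then 3 else 2]) x)) \<longleftrightarrow>
   zs = map bit_symbol (concat (map (\<lambda>b. [True, b]) x))"
  by (induction x arbitrary: zs) (auto simp: list_all2_Cons2 symbols_at_def bit_symbol_def)

text \<open>Code 5 leaves a cell free, \<open>zero_closed\<close> rules out gaps, and the other
  codes fix their cells. What remains is exactly the choice of a \<open>u\<close> of at most
  \<open>A\<close> bits.\<close>

lemma first_row_iff:
  fixes x A T
  defines "n \<equiv> length (first_codes x A T)"
  shows "list_all2 (\<lambda>s c. s \<in> symbols_at c) zs (first_codes x A T) \<and> zero_closed zs \<longleftrightarrow>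
    (\<exists>u. length u \<le> A \<and> zs = map (tape_content (pair_string x u)) [0..<n])"
proof -
  let ?P = "\<lambda>s c. s \<in> symbols_at c"
  let ?X = "map bit_symbol (concat (map (\<lambda>b. [True, b]) x))"
  have n: "n = 2 * length x + 1 + A + T + 2" by (simp add: n_def length_first_codes width_def)
  have row: "map (tape_content (pair_string x u)) [0..<n] =
      [1] @ ?X @ [2] @ (map bit_symbol u @ replicate (A - length u) 0) @ replicate T 0 @ [0]" if u: "length u \<le> A" for u
  proof -
    have "length (pair_string x u) = 2 * length x + 1 + length u"
      by (simp add: pair_string_def enc_list_def length_concat_pairs)
    moreover have "replicate (n - 1 - (2 * length x + 1 + length u)) (0 :: nat) =
        replicate (A - length u) 0 @ replicate T 0 @ [0]"
    proof -
      have "n - 1 - (2 * length x + 1 + length u) = (A - length u) + (T + 1)" using n u by simp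
      then show ?thesis by (simp add: replicate_add replicate_append_same)
    qed
    ultimately show ?thesis
      using n u by (subst map_tape_content) (simp_all add: pair_string_def enc_list_def bit_symbol_def)
  qed
  show ?thesis
  proof
    assume l: "list_all2 ?P zs (first_codes x A T) \<and> zero_closed zs"
    then obtain z0 zx z4 zA zT z7 where zs: "zs = z0 @ zx @ z4 @ zA @ zT @ z7"
      and p: "list_all2 ?P z0 [0]" "list_all2 ?P zx (concat (map (\<lambda>b. [1, if b then 3 else 2]) x))"
      "list_all2 ?P z4 [4]" "list_all2 ?P zA (replicate A 5)" "list_all2 ?P zT (replicate T 6)" "list_all2 ?P z7 [7]"
      unfolding first_codes_def list_all2_append2 by blast
    have "z0 = [1]" "zx = ?X" "z4 = [2]" "z7 = [0]"
      using p(1-3,6) list_all2_bits by (auto simp: list_all2_Cons2 symbols_at_def)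
    moreover have "zT = replicate T 0"
      using p(5) by (auto simp: list_all2_replicate symbols_at_def intro!: replicate_eqI)
    moreover have A: "length zA = A" "set zA \<subseteq> {0, 2, 3}"
      using p(4) by (auto simp: list_all2_replicate symbols_at_def)
    moreover have "zero_closed zA" using l zero_closed_append unfolding zs by blast
    then obtain u where "length u \<le> length zA" "zA = map bit_symbol u @ replicate (length zA - length u) 0"
      using zero_closed_bits[OF A(2)] by blast
    ultimately have "length u \<le> A" "zs = [1] @ ?X @ [2] @ (map bit_symbol u @ replicate (A - length u) 0) @ replicate T 0 @ [0]"
      using zs by simp_all
    then show "\<exists>u. length u \<le> A \<and> zs = map (tape_content (pair_string x u)) [0..<n]"
      using row by metis
  next
    assume "\<exists>u. length u \<le> A \<and> zs = map (tape_content (pair_string x u)) [0..<n]"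
    then obtain u where u: "length u \<le> A" and zs: "zs = map (tape_content (pair_string x u)) [0..<n]" by blast
    have "zero_closed zs" unfolding zs zero_closed_def by (auto simp: tape_content_def split: if_splits)
    moreover have "list_all2 ?P zs (first_codes x A T)"
      unfolding zs row[OF u] first_codes_def
    proof (intro list_all2_appendI)
      show "list_all2 ?P ?X (concat (map (\<lambda>b. [1, if b then 3 else 2]) x))"
        unfolding list_all2_bits ..
      show "list_all2 ?P (map bit_symbol u @ replicate (A - length u) 0) (replicate A 5)"
        using u by (auto simp: list_all2_replicate symbols_at_def bit_symbol_def)
    qed (auto simp: symbols_at_def list_all2_replicate)
    ultimately show "list_all2 ?P zs (first_codes x A T) \<and> zero_closed zs" by blast
  qed
qed

text \<open>Codes 0 and 7 single out the leftmost column, which carries the marker, and the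
  rightmost one, which has no right neighbour.\<close>

lemma first_codes_nth:
  assumes "i < length (first_codes x A T)"
  shows "first_codes x A T ! i < 8" "first_codes x A T ! i = 0 \<longleftrightarrow> i = 0"
    "first_codes x A T ! i = 7 \<longleftrightarrow> i + 1 = length (first_codes x A T)"
proof -
  define mid where "mid = concat (map (\<lambda>b. [1, if b then 3 else 2]) x) @ [4] @ replicate A 5 @ replicate T (6 :: nat)"
  have fc: "first_codes x A T = 0 # mid @ [7]" by (simp add: first_codes_def mid_def)
  have mid: "0 < c \<and> c < 7" if "c \<in> set mid" for c using that by (auto simp: mid_def split: if_splits)
  have m: "0 < mid ! j \<and> mid ! j < 7" if "j < length mid" for j using mid[of "mid ! j"] that by simp
  consider "i = 0" | j where "i = Suc j" "j < length mid" | "i = Suc (length mid)"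
    using assms unfolding fc by (cases i) (auto simp: less_Suc_eq)
  then have *: "first_codes x A T ! i < 8 \<and> (first_codes x A T ! i = 0 \<longleftrightarrow> i = 0) \<and>
    (first_codes x A T ! i = 7 \<longleftrightarrow> i + 1 = length (first_codes x A T))"
  proof cases
    case (2 j)
    then show ?thesis using m[of j] by (simp add: fc nth_append)
  qed (simp_all add: fc)
  show "first_codes x A T ! i < 8" by (fact *[THEN conjunct1])
  show "first_codes x A T ! i = 0 \<longleftrightarrow> i = 0" by (fact *[THEN conjunct2, THEN conjunct1])
  show "first_codes x A T ! i = 7 \<longleftrightarrow> i + 1 = length (first_codes x A T)"
    by (fact *[THEN conjunct2, THEN conjunct2])
qed

section \<open>Tableaux as solutions of local constraints\<close>

lemma nth_concat_rows:
  "\<forall>r\<in>set rows. length r = W \<Longrightarrow> t < length rows \<Longrightarrow> i < W \<Longrightarrow> concat rows ! (t * W + i) = rows ! t ! i"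
proof (induction rows arbitrary: t)
  case (Cons r rows)
  show ?case
  proof (cases t)
    case (Suc t')
    have "(r @ concat rows) ! (W + (t' * W + i)) = concat rows ! (t' * W + i)"
      using Cons.prems(1) by (metis list.set_intros(1) nth_append_length_plus)
    then show ?thesis using Cons Suc by (simp add: add.assoc)
  qed (use Cons in \<open>simp add: nth_append\<close>)
qed simp

definition code_rows :: "bool list \<Rightarrow> nat \<Rightarrow> nat \<Rightarrow> nat list list" where
  "code_rows x A T = (let m = 2 * length x + 1 + A + T in
     [first_codes x A T] @ replicate T (8 # replicate m 9 @ [10]) @ [11 # 12 # replicate m 13])"

lemma layout_codes: "layout L x A T = map L (concat (code_rows x A T))"
proof -
  have "map L (concat (map (\<lambda>b. [1, if b then 3 else 2]) x)) = concat (map (\<lambda>b. [L 1, if b then L 3 else L 2]) x)"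
    by (induction x) auto
  moreover have "map L (concat (replicate T r)) = concat (replicate T (map L r))" for r
    by (induction T) auto
  ultimately show ?thesis
    by (simp add: layout_def code_rows_def Let_def first_codes_def)
qed

definition code :: "bool list \<Rightarrow> nat \<Rightarrow> nat \<Rightarrow> nat \<Rightarrow> nat \<Rightarrow> nat" where
  "code x A T t i =
     (if t = 0 then first_codes x A T ! i
      else if t \<le> T then (if i = 0 then 8 else if i + 1 < width x A T then 9 else 10)
      else (if i = 0 then 11 else if i = 1 then 12 else 13))"

lemma layout_nth:
  assumes "t < T + 2" "i < width x A T"
  shows "layout L x A T ! (t * width x A T + i) = L (code x A T t i)"
    "t * width x A T + i < length (layout L x A T)"
proof -
  let ?W = "width x A T" and ?m = "2 * length x + 1 + A + T"
  have W: "?W = ?m + 2" by (simp add: width_def)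
  have "t * ?W + i < t * ?W + ?W" using assms(2) by simp
  also have "\<dots> = (t + 1) * ?W" by simp
  also have "\<dots> \<le> (T + 2) * ?W" using assms(1) by (intro mult_le_mono1) simp
  finally show l: "t * ?W + i < length (layout L x A T)" by (simp only: length_layout_width)
  have "\<forall>r\<in>set (code_rows x A T). length r = ?W"
    by (auto simp: code_rows_def Let_def length_first_codes) (simp_all add: width_def)
  moreover have "t < length (code_rows x A T)" using assms(1) by (simp add: code_rows_def Let_def)
  ultimately have "concat (code_rows x A T) ! (t * ?W + i) = code_rows x A T ! t ! i"
    using assms(2) by (rule nth_concat_rows)
  moreover have "code_rows x A T ! t ! i = code x A T t i"
  proof -
    consider "t = 0" | t' where "t = Suc t'" "t' < T" | "t = Suc T"
      using assms(1) by (cases t) (auto simp: less_Suc_eq)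
    then show ?thesis
    proof cases
      case (2 t')
      have "(8 # replicate m 9 @ [10]) ! i = (if i = 0 then 8 else if i + 1 < m + 2 then 9 else 10 :: nat)"
        if "i < m + 2" for m using that by (cases i) (auto simp: nth_append)
      from this[of ?m] 2 assms(2) show ?thesis
        unfolding W code_rows_def code_def Let_def by (simp add: nth_append del: replicate_Suc)
    next
      case 3
      have "(11 # 12 # replicate m 13) ! i = (if i = 0 then 11 else if i = 1 then 12 else 13 :: nat)"
        if "i < m + 2" for m using that by (auto simp: nth_Cons')
      from this[of ?m] 3 assms(2) show ?thesis
        unfolding W code_rows_def code_def Let_def by (simp add: nth_append del: replicate_Suc)
    qed (simp add: code_rows_def code_def Let_def)
  qed
  ultimately show "layout L x A T ! (t * ?W + i) = L (code x A T t i)"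
    using l by (simp add: layout_codes)
qed

lemma grid_position:
  assumes "p < n * (W :: nat)"
  obtains t i where "p = t * W + i" "t < n" "i < W"
proof
  show "p = (p div W) * W + p mod W" by simp
  show "p div W < n" using assms by (simp add: less_mult_imp_div_less)
  show "p mod W < W" using assms by (cases W) simp_all
qed

context machine
begin

text \<open>A polynomial-time program only has to exist for each machine, so an arbitrary
  enumeration of the tiles suffices.\<close>

definition tile_list :: "tile list" where
  "tile_list = (SOME l. set l = tiles)"

lemma set_tile_list: "set tile_list = tiles"
  unfolding tile_list_def using finite_list[OF finite_tiles] by (rule someI_ex)

text \<open>Codes below 8 form the first row, 8 to 10 a later row with its left and right ends, 11
  to 13 the last row. The symbols 1, 3, 0 there spell the tape content of the output
  \<open>[True]\<close>.\<close>

definition tile_constraint :: "nat \<Rightarrow> (tile \<Rightarrow> bool) \<times> (tile \<Rightarrow> tile \<Rightarrow> bool) \<times> (tile \<Rightarrow> tile \<Rightarrow> bool)" where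
  "tile_constraint c =
     (if c < 8 then (\<lambda>z. consistent z \<and> initial (symbols_at c) (c = 0) z,
        if c = 7 then (\<lambda>_ _. True) else horizontal0, vertical (c = 0))
      else if c < 11 then (consistent, if c = 10 then (\<lambda>_ _. True) else horizontal, vertical (c = 8))
      else (final (if c = 11 then 1 else if c = 12 then 3 else 0), (\<lambda>_ _. True), (\<lambda>_ _. True)))"

definition index_constraint :: "nat \<Rightarrow> constraint" where
  "index_constraint c = (case tile_constraint c of (U, H, V) \<Rightarrow>
     (\<lambda>i. U (tile_list ! i), \<lambda>i j. H (tile_list ! i) (tile_list ! j),
      \<lambda>i j. V (tile_list ! i) (tile_list ! j)))"

text \<open>Rows 0 to \<open>T\<close> are full configurations. Row \<open>T + 1\<close> is only
  inspected for the halting state and the output, both forced by the row above.\<close>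

definition tableau :: "bool list \<Rightarrow> nat \<Rightarrow> nat \<Rightarrow> (nat \<Rightarrow> nat \<Rightarrow> tile) \<Rightarrow> bool" where
  "tableau x A T z \<longleftrightarrow>
     (\<forall>t<T + 2. \<forall>i<width x A T. z t i \<in> tiles) \<and>
     (\<forall>t\<le>T. \<forall>i<width x A T. consistent (z t i)) \<and>
     (\<forall>t\<le>T. \<forall>i<width x A T. vertical (i = 0) (z t i) (z (t + 1) i)) \<and>
     (\<forall>t\<le>T. \<forall>i. i + 1 < width x A T \<longrightarrow> horizontal (z t i) (z t (i + 1))) \<and>
     (\<forall>i<width x A T. initial (symbols_at (first_codes x A T ! i)) (i = 0) (z 0 i)) \<and>
     (\<forall>i. i + 1 < width x A T \<longrightarrow> cell_of (z 0 i) ! 0 = 0 \<longrightarrow> cell_of (z 0 (i + 1)) ! 0 = 0) \<and>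
     (\<forall>i<width x A T. final (tape_content [True] i) (z (T + 1) i))"

lemma tile_constraint_code:
  assumes "i < width x A T"
  shows "tile_constraint (code x A T t i) =
    (if t = 0 then \<lambda>z. consistent z \<and> initial (symbols_at (first_codes x A T ! i)) (i = 0) z
     else if t \<le> T then consistent else final (tape_content [True] i),
     if t \<le> T \<and> i + 1 < width x A T then (if t = 0 then horizontal0 else horizontal) else (\<lambda>_ _. True),
     if t \<le> T then vertical (i = 0) else (\<lambda>_ _. True))"
proof -
  have i: "i < length (first_codes x A T)" using assms by (simp add: length_first_codes)
  note f = first_codes_nth[OF i]
  show ?thesis
  proof (cases "t = 0")
    case True
    have "first_codes x A T ! i = 7 \<longleftrightarrow> \<not> i + 1 < width x A T" using f(3) i by (auto simp: length_first_codes)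
    then show ?thesis using True f(1,2) by (simp add: code_def tile_constraint_def)
  next
    case False
    have "2 < width x A T" by (simp add: width_def)
    then show ?thesis
      using assms False by (auto simp: code_def tile_constraint_def tape_content_def)
  qed
qed

lemma tile_constraint_holds:
  assumes "i < width x A T" "tile_constraint (code x A T t i) = (U, H, V)"
  shows "U (z t i) \<and> H (z t i) (z t (i + 1)) \<and> V (z t i) (z (t + 1) i) \<longleftrightarrow>
    (t = 0 \<longrightarrow> initial (symbols_at (first_codes x A T ! i)) (i = 0) (z 0 i)) \<and>
    (t \<le> T \<longrightarrow> consistent (z t i)) \<and> (t > T \<longrightarrow> final (tape_content [True] i) (z t i)) \<and>
    (t \<le> T \<longrightarrow> i + 1 < width x A T \<longrightarrow> horizontal (z t i) (z t (i + 1))) \<and>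
    (t = 0 \<longrightarrow> i + 1 < width x A T \<longrightarrow> cell_of (z 0 i) ! 0 = 0 \<longrightarrow> cell_of (z 0 (i + 1)) ! 0 = 0) \<and>
    (t \<le> T \<longrightarrow> vertical (i = 0) (z t i) (z (t + 1) i))"
proof -
  have U: "U = (if t = 0 then \<lambda>z. consistent z \<and> initial (symbols_at (first_codes x A T ! i)) (i = 0) z
     else if t \<le> T then consistent else final (tape_content [True] i))"
    and H: "H = (if t \<le> T \<and> i + 1 < width x A T then (if t = 0 then horizontal0 else horizontal) else (\<lambda>_ _. True))"
    and V: "V = (if t \<le> T then vertical (i = 0) else (\<lambda>_ _. True))"
    using assms(2) unfolding tile_constraint_code[OF assms(1)] prod.inject by simp_all
  consider "t = 0" | "0 < t" "t \<le> T" | "T < t" by linarith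
  then show ?thesis
    by cases (simp_all add: U H V horizontal0_def conj_ac)
qed

lemma tableau_iff:
  "tableau x A T z \<longleftrightarrow> (\<forall>t<T + 2. \<forall>i<width x A T. z t i \<in> tiles \<and>
    (\<forall>U H V. tile_constraint (code x A T t i) = (U, H, V) \<longrightarrow>
       U (z t i) \<and> H (z t i) (z t (i + 1)) \<and> V (z t i) (z (t + 1) i)))"
    (is "_ \<longleftrightarrow> (\<forall>t<T + 2. \<forall>i<width x A T. z t i \<in> tiles \<and> ?C t i)")
proof -
  have C: "?C t i \<longleftrightarrow>
    (t = 0 \<longrightarrow> initial (symbols_at (first_codes x A T ! i)) (i = 0) (z 0 i)) \<and>
    (t \<le> T \<longrightarrow> consistent (z t i)) \<and> (t > T \<longrightarrow> final (tape_content [True] i) (z t i)) \<and>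
    (t \<le> T \<longrightarrow> i + 1 < width x A T \<longrightarrow> horizontal (z t i) (z t (i + 1))) \<and>
    (t = 0 \<longrightarrow> i + 1 < width x A T \<longrightarrow> cell_of (z 0 i) ! 0 = 0 \<longrightarrow> cell_of (z 0 (i + 1)) ! 0 = 0) \<and>
    (t \<le> T \<longrightarrow> vertical (i = 0) (z t i) (z (t + 1) i))" (is "_ \<longleftrightarrow> ?D t i")
    if i: "i < width x A T" for t i
  proof -
    obtain U H V where c: "tile_constraint (code x A T t i) = (U, H, V)" by (metis prod_cases3)
    show ?thesis unfolding tile_constraint_holds[OF i c, symmetric] c by simp
  qed
  show ?thesis
  proof
    assume z: "tableau x A T z"
    show "\<forall>t<T + 2. \<forall>i<width x A T. z t i \<in> tiles \<and> ?C t i"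
    proof (intro allI impI)
      fix t i assume t: "t < T + 2" and i: "i < width x A T"
      have "t \<le> T \<or> t = T + 1" using t by linarith
      then have "?D t i" using z i unfolding tableau_def by (elim disjE) simp_all
      then show "z t i \<in> tiles \<and> ?C t i" using z t i unfolding C[OF i] by (simp add: tableau_def)
    qed
  next
    assume r: "\<forall>t<T + 2. \<forall>i<width x A T. z t i \<in> tiles \<and> ?C t i"
    have tl: "z t i \<in> tiles" and d: "?D t i" if "t < T + 2" "i < width x A T" for t i
      using r[rule_format, OF that] unfolding C[OF that(2)] by (rule conjunct1, rule conjunct2)
    show "tableau x A T z"
      unfolding tableau_def
    proof (intro conjI allI impI)
      fix t i assume "t < T + 2" "i < width x A T"
      then show "z t i \<in> tiles" by (rule tl)
    next
      fix t i assume "t \<le> T" "i < width x A T"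
      then show "consistent (z t i)" "vertical (i = 0) (z t i) (z (t + 1) i)"
        using d[of t i] by simp_all
    next
      fix t i assume "t \<le> T" "i + 1 < width x A T"
      then show "horizontal (z t i) (z t (i + 1))" using d[of t i] by simp
    next
      fix i assume "i < width x A T"
      then show "initial (symbols_at (first_codes x A T ! i)) (i = 0) (z 0 i)" using d[of 0 i] by simp
    next
      fix i assume "i + 1 < width x A T" "cell_of (z 0 i) ! 0 = 0"
      then show "cell_of (z 0 (i + 1)) ! 0 = 0" using d[of 0 i] by simp
    next
      fix i assume "i < width x A T"
      then show "final (tape_content [True] i) (z (T + 1) i)" using d[of "T + 1" i] by simp
    qed
  qed
qed

text \<open>The right edge carries no horizontal rule and the last row no rule at all; every other
  rule points to a cell of the grid.\<close>

lemma inside_grid_layout: "inside_grid (width x A T) (layout index_constraint x A T)"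
  unfolding inside_grid_def
proof (intro allI impI)
  let ?W = "width x A T" and ?cs = "layout index_constraint x A T"
  fix p assume "p < length ?cs"
  then have "p < (T + 2) * ?W" unfolding length_layout_width .
  then obtain t i where pti: "p = t * ?W + i" and t: "t < T + 2" and i: "i < ?W" by (rule grid_position)
  have c: "?cs ! p = index_constraint (code x A T t i)" unfolding pti by (rule layout_nth(1)[OF t i])
  have 1: "(t \<le> T \<and> i + 1 < ?W) = False" if p1: "(T + 2) * ?W \<le> p + 1"
  proof -
    have "p + 1 < (T + 2) * ?W" if ti: "i + 1 < ?W"
    proof -
      have "p + 1 < (t + 1) * ?W" using ti pti by simp
      also have "\<dots> \<le> (T + 2) * ?W" using t by (intro mult_le_mono1) simp
      finally show ?thesis .
    qed
    then show ?thesis using p1 by auto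
  qed
  have 2: "(t \<le> T) = False" if pW: "(T + 2) * ?W \<le> p + ?W"
  proof -
    have "p + ?W < (T + 2) * ?W" if tT: "t \<le> T"
    proof -
      have "p + ?W < (t + 2) * ?W" using pti i by simp
      also have "\<dots> \<le> (T + 2) * ?W" using tT by (intro mult_le_mono1) simp
      finally show ?thesis .
    qed
    then show ?thesis using pW by auto
  qed
  show "case ?cs ! p of (U, H, V) \<Rightarrow> (length ?cs \<le> p + 1 \<longrightarrow> H = (\<lambda>_ _. True)) \<and>
      (length ?cs \<le> p + ?W \<longrightarrow> V = (\<lambda>_ _. True))"
    unfolding c index_constraint_def tile_constraint_code[OF i] prod.case length_layout_width
    using 1 2 by (intro conjI impI) (simp_all only: if_False)
qed

text \<open>Values are indices into \<open>tile_list\<close>. Position \<open>p + 1\<close> of a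
  cell at the right edge belongs to the next row, but the horizontal relation is trivial
  there.\<close>

lemma satisfies_iff_tableau:
  "(\<exists>\<tau>. satisfies (length tile_list) (width x A T) (layout index_constraint x A T) \<tau>) \<longleftrightarrow>
   (\<exists>z. tableau x A T z)"
proof
  let ?W = "width x A T" and ?cs = "layout index_constraint x A T"
  assume "\<exists>\<tau>. satisfies (length tile_list) ?W ?cs \<tau>"
  then obtain \<tau> where \<tau>: "satisfies (length tile_list) ?W ?cs \<tau>" by blast
  define z where "z t i = tile_list ! \<tau> (t * ?W + i)" for t i
  have "tableau x A T z"
    unfolding tableau_iff
  proof (intro allI impI conjI)
    fix t i assume t: "t < T + 2" and i: "i < ?W"
    have n: "t * ?W + i + 1 = t * ?W + (i + 1)" "t * ?W + i + ?W = (t + 1) * ?W + i" by simp_all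
    note s = \<tau>[unfolded satisfies_def, rule_format, OF layout_nth(2)[OF t i],
      unfolded layout_nth(1)[OF t i] index_constraint_def n]
    obtain U H V where c: "tile_constraint (code x A T t i) = (U, H, V)" by (metis prod_cases3)
    have s': "\<tau> (t * ?W + i) < length tile_list" "U (z t i) \<and> H (z t i) (z t (i + 1)) \<and> V (z t i) (z (t + 1) i)"
      using s unfolding c prod.case z_def by simp_all
    show "z t i \<in> tiles" unfolding z_def set_tile_list[symmetric] by (rule nth_mem[OF s'(1)])
    fix U' H' V' assume "tile_constraint (code x A T t i) = (U', H', V')"
    then show "U' (z t i)" "H' (z t i) (z t (i + 1))" "V' (z t i) (z (t + 1) i)" using s'(2) c by simp_all
  qed
  then show "\<exists>z. tableau x A T z" by blast
next
  let ?W = "width x A T" and ?cs = "layout index_constraint x A T"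
  assume "\<exists>z. tableau x A T z"
  then obtain z where z: "tableau x A T z" by blast
  define ix where "ix y = (SOME i. i < length tile_list \<and> tile_list ! i = y)" for y
  have ix: "ix y < length tile_list \<and> tile_list ! ix y = y" if y: "y \<in> tiles" for y
    unfolding ix_def by (rule someI_ex) (use y[folded set_tile_list] in \<open>simp add: in_set_conv_nth\<close>)
  define \<tau> where "\<tau> p = ix (z (p div ?W) (p mod ?W))" for p
  have \<tau>: "\<tau> (t * ?W + i) = ix (z t i)" if i: "i < ?W" for t i
  proof -
    have "(t * ?W + i) div ?W = t" "(t * ?W + i) mod ?W = i" using i by (simp_all add: div_mult_self3)
    then show ?thesis by (simp only: \<tau>_def)
  qed
  have tl: "z t i \<in> tiles" if "t < T + 2" "i < ?W" for t i
    using z that by (simp add: tableau_def)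
  have "satisfies (length tile_list) ?W ?cs \<tau>"
    unfolding satisfies_def
  proof (intro allI impI)
    fix p assume "p < length ?cs"
    then have "p < (T + 2) * ?W" unfolding length_layout_width .
    then obtain t i where pti: "p = t * ?W + i" and t: "t < T + 2" and i: "i < ?W" by (rule grid_position)
    obtain U H V where c: "tile_constraint (code x A T t i) = (U, H, V)" by (metis prod_cases3)
    have s: "U (z t i) \<and> H (z t i) (z t (i + 1)) \<and> V (z t i) (z (t + 1) i)"
      using z t i c unfolding tableau_iff by blast
    have Heq: "H = (if t \<le> T \<and> i + 1 < ?W then (if t = 0 then horizontal0 else horizontal) else (\<lambda>_ _. True))"
      and Veq: "V = (if t \<le> T then vertical (i = 0) else (\<lambda>_ _. True))"
      using c unfolding tile_constraint_code[OF i] prod.inject by simp_all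
    have tp: "\<tau> p = ix (z t i)" unfolding pti by (rule \<tau>[OF i])
    have z0: "tile_list ! \<tau> p = z t i" "\<tau> p < length tile_list" using ix[OF tl[OF t i]] by (simp_all add: tp)
    have H: "H (tile_list ! \<tau> p) (tile_list ! \<tau> (p + 1))"
    proof (cases "t \<le> T \<and> i + 1 < ?W")
      case True
      have "\<tau> (p + 1) = ix (z t (i + 1))" unfolding pti add.assoc by (rule \<tau>) (use True in blast)
      then have "tile_list ! \<tau> (p + 1) = z t (i + 1)" using ix[OF tl[OF t, of "i + 1"]] True by simp
      then show ?thesis using s z0(1) by simp
    next
      case False
      then have "H = (\<lambda>_ _. True)" unfolding Heq by (rule if_not_P)
      then show ?thesis by simp
    qed
    have V: "V (tile_list ! \<tau> p) (tile_list ! \<tau> (p + ?W))"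
    proof (cases "t \<le> T")
      case True
      have "p + ?W = (t + 1) * ?W + i" using pti by simp
      then have "\<tau> (p + ?W) = ix (z (t + 1) i)" by (simp only: \<tau>[OF i])
      then have "tile_list ! \<tau> (p + ?W) = z (t + 1) i" using ix[OF tl[OF _ i, of "t + 1"]] True by simp
      then show ?thesis using s z0(1) by simp
    next
      case False
      then have "V = (\<lambda>_ _. True)" unfolding Veq by (rule if_not_P)
      then show ?thesis by simp
    qed
    have "?cs ! p = index_constraint (code x A T t i)" unfolding pti by (rule layout_nth(1)[OF t i])
    then show "case ?cs ! p of (U, H, V) \<Rightarrow> \<tau> p < length tile_list \<and> U (\<tau> p) \<and>
        H (\<tau> p) (\<tau> (p + 1)) \<and> V (\<tau> p) (\<tau> (p + ?W))"
      using H V s z0 by (simp add: index_constraint_def c)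
  qed
  then show "\<exists>\<tau>. satisfies (length tile_list) ?W ?cs \<tau>" by blast
qed

end

section \<open>Tableaux and accepting runs\<close>

context machine
begin

lemma tapes_init:
  "j < k \<Longrightarrow> snd (tm_init M y) ! j = (if j = 0 then tape_content y else tape_content [], 0)"
  by (cases j) (simp_all add: tm_init_def)

lemma length_tapes_init: "length (snd (tm_init M y)) = k"
  using valid_config_init[of y] by (simp add: valid_config_def)

lemma k_pos: "0 < k"
  using valid by (simp add: valid_tm_def)

lemma tape_content_Nil: "tape_content [] i = (if i = 0 then 1 else 0)"
  by (simp add: tape_content_def)

text \<open>Restricted to the \<open>W\<close> output cells that a tableau can show.\<close>

definition accepts :: "bool list \<Rightarrow> nat \<Rightarrow> nat \<Rightarrow> bool" where
  "accepts y t W \<longleftrightarrow> fst (run y t) = 1 \<and> (\<forall>i<W. fst (last (snd (run y t))) i = tape_content [True] i)"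

lemma final_snapshot:
  assumes "state_of z = fst c" "cell_of z = map (\<lambda>t. fst t i) (snd c)" "valid_config c"
  shows "final s z \<longleftrightarrow> fst c = 1 \<and> fst (last (snd c)) i = s"
proof -
  have "snd c \<noteq> []" using assms(3) k_pos by (auto simp: valid_config_def)
  then show ?thesis using assms(1,2) by (simp add: final_def last_map)
qed

lemma tableau_of_run:
  assumes u: "length u \<le> A" and acc: "accepts (pair_string x u) (T + 1) (width x A T)"
  shows "tableau x A T (\<lambda>t. snapshot (run (pair_string x u) t))"
proof -
  let ?y = "pair_string x u" and ?W = "width x A T"
  let ?z = "\<lambda>t. snapshot (run ?y t)"
  have "map (tape_content ?y) [0..<?W] = map (tape_content ?y) [0..<length (first_codes x A T)]"
    by (simp add: length_first_codes)
  then have row: "list_all2 (\<lambda>s c. s \<in> symbols_at c) (map (tape_content ?y) [0..<?W]) (first_codes x A T)"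
    "zero_closed (map (tape_content ?y) [0..<?W])"
    using first_row_iff[of "map (tape_content ?y) [0..<?W]" x A T] u by blast+
  have cell0: "cell_of (?z 0 i) ! 0 = tape_content ?y i" for i
    using tapes_init[of 0 ?y] length_tapes_init[of ?y] k_pos by (simp add: snapshot_def)
  show ?thesis
    unfolding tableau_def
  proof (intro conjI allI impI)
    fix t i show "?z t i \<in> tiles" by (rule snapshot_in_tiles[OF valid_run])
    show "consistent (?z t i)" by (rule consistent_snapshot[OF valid_run])
    show "horizontal (?z t i) (?z t (i + 1))" by (rule horizontal_snapshot[OF valid_run])
    show "vertical (i = 0) (?z t i) (?z (t + 1) i)"
      using vertical_snapshot[OF valid_run[where y = ?y and t = t], of i] by simp
  next
    fix i assume i: "i < ?W"
    have "tape_content ?y i \<in> symbols_at (first_codes x A T ! i)"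
      using list_all2_nthD[OF row(1), of i] i by simp
    then show "initial (symbols_at (first_codes x A T ! i)) (i = 0) (?z 0 i)"
      using cell0[of i] tapes_init[of _ ?y] length_tapes_init[of ?y]
      by (auto simp: initial_def snapshot_def tape_content_Nil rel_def) (simp_all add: tm_init_def)
    have c: "valid_config (run ?y (T + 1))" by (rule valid_run)
    have "final (tape_content [True] i) (?z (T + 1) i) \<longleftrightarrow>
        fst (run ?y (T + 1)) = 1 \<and> fst (last (snd (run ?y (T + 1)))) i = tape_content [True] i"
      by (rule final_snapshot[OF _ _ c]) (simp_all add: snapshot_def del: funpow.simps)
    then show "final (tape_content [True] i) (?z (T + 1) i)" using acc i unfolding accepts_def by blast
  next
    fix i assume i: "i + 1 < ?W" "cell_of (?z 0 i) ! 0 = 0"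
    then show "cell_of (?z 0 (i + 1)) ! 0 = 0"
      using row(2)[unfolded zero_closed_def, rule_format, of i] unfolding cell0 by simp
  qed
qed

text \<open>The first row yields the certificate \<open>u\<close>, and from there each row forces
  the next one to be the following configuration.\<close>

lemma run_of_tableau:
  assumes z: "tableau x A T z"
  shows "\<exists>u. length u \<le> A \<and> accepts (pair_string x u) (T + 1) (width x A T)"
proof -
  let ?W = "width x A T"
  have W: "T + 2 < ?W" by (simp add: width_def)
  have zt: "\<And>t i. t < T + 2 \<Longrightarrow> i < ?W \<Longrightarrow> z t i \<in> tiles"
    and zc: "\<And>t i. t \<le> T \<Longrightarrow> i < ?W \<Longrightarrow> consistent (z t i)"
    and zv: "\<And>t i. t \<le> T \<Longrightarrow> i < ?W \<Longrightarrow> vertical (i = 0) (z t i) (z (t + 1) i)"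
    and zh: "\<And>t i. t \<le> T \<Longrightarrow> i + 1 < ?W \<Longrightarrow> horizontal (z t i) (z t (i + 1))"
    and z0: "\<And>i. i < ?W \<Longrightarrow> initial (symbols_at (first_codes x A T ! i)) (i = 0) (z 0 i)"
    and zz: "\<And>i. i + 1 < ?W \<Longrightarrow> cell_of (z 0 i) ! 0 = 0 \<Longrightarrow> cell_of (z 0 (i + 1)) ! 0 = 0"
    and zf: "\<And>i. i < ?W \<Longrightarrow> final (tape_content [True] i) (z (T + 1) i)"
    using z unfolding tableau_def by blast+
  let ?zs = "map (\<lambda>i. cell_of (z 0 i) ! 0) [0..<?W]"
  have "list_all2 (\<lambda>s c. s \<in> symbols_at c) ?zs (first_codes x A T)"
    using z0 by (simp add: list_all2_conv_all_nth length_first_codes initial_def)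
  moreover have "zero_closed ?zs"
    unfolding zero_closed_def using zz by simp
  ultimately obtain u where u: "length u \<le> A" "?zs = map (tape_content (pair_string x u)) [0..<?W]"
    using first_row_iff[of ?zs x A T] unfolding length_first_codes by blast
  let ?y = "pair_string x u"
  have cell0: "cell_of (z 0 i) ! 0 = tape_content ?y i" if "i < ?W" for i
    using arg_cong[OF u(2), of "\<lambda>l. l ! i"] that by simp
  have row: "z t i = snapshot (run ?y t) i" if "t \<le> T" "i < ?W" for t i
    using that
  proof (induction t arbitrary: i)
    case 0
    have "z 0 i = snapshot (tm_init M ?y) i"
    proof (rule row_snapshot[where c = "tm_init M ?y" and W = ?W and z = "z 0", OF valid_config_init])
      show "snd (snd (tm_init M ?y) ! j) < ?W" if "j < k" for j
        using tapes_init[OF that, of ?y] width_pos by simp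
      show "z 0 i \<in> tiles \<and> consistent (z 0 i)" if "i < ?W" for i using zt[of 0 i] zc[of 0 i] that by simp
      show "horizontal (z 0 i) (z 0 (i + 1))" if "i + 1 < ?W" for i using zh[of 0 i] that by simp
      show "state_of (z 0 i) = fst (tm_init M ?y)" if "i < ?W" for i
        using z0[OF that] by (simp add: initial_def tm_init_def)
      show "cell_of (z 0 i) = map (\<lambda>t. fst t i) (snd (tm_init M ?y))" if i: "i < ?W" for i
      proof (rule nth_equalityI)
        have "z 0 i \<in> tiles" using zt[of 0 i] i by simp
        then have l: "length (cell_of (z 0 i)) = k" by (simp add: in_tiles)
        then show "length (cell_of (z 0 i)) = length (map (\<lambda>t. fst t i) (snd (tm_init M ?y)))"
          by (simp add: length_tapes_init)
        fix j assume "j < length (cell_of (z 0 i))"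
        then have j: "j < k" using l by simp
        then show "cell_of (z 0 i) ! j = map (\<lambda>t. fst t i) (snd (tm_init M ?y)) ! j"
          using z0[OF i] cell0[OF i] tapes_init[OF j, of ?y]
          by (cases "j = 0") (simp_all add: initial_def length_tapes_init tape_content_Nil)
      qed
      show "rel_of (z 0 i) ! j = rel (snd (snd (tm_init M ?y) ! j)) i" if "i < ?W" "j < k" for i j
        using z0[OF that(1)] that(2) tapes_init[OF that(2), of ?y] by (simp add: initial_def rel_def)
    qed (use 0 in simp)
    then show ?case by simp
  next
    case (Suc t)
    have c: "valid_config (run ?y t)" by (rule valid_run)
    have "z (Suc t) i = snapshot (tm_step M (run ?y t)) i"
    proof (rule next_row_snapshot[where c = "run ?y t" and W = ?W and z = "z (Suc t)", OF c])
      show "snd (snd (run ?y t) ! j) + 1 < ?W" if "j < k" for j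
        using head_bound[OF that, where t = t and y = ?y] Suc.prems W by linarith
      show "z (Suc t) i \<in> tiles \<and> consistent (z (Suc t) i)" if "i < ?W" for i
        using zt[of "Suc t" i] zc[of "Suc t" i] that Suc.prems by simp
      show "horizontal (z (Suc t) i) (z (Suc t) (i + 1))" if "i + 1 < ?W" for i
        using zh[of "Suc t" i] that Suc.prems by simp
      show "vertical (i = 0) (snapshot (run ?y t) i) (z (Suc t) i)" if "i < ?W" for i
        using zv[of t i] Suc.IH[of i] that Suc.prems by simp
    qed (use Suc.prems in simp)
    then show ?case by simp
  qed
  have c: "valid_config (run ?y T)" "valid_config (tm_step M (run ?y T))"
    using valid_run valid_config_step by blast+
  \<comment> \<open>The last row need not be a snapshot; its states and cells follow from the
    vertical rule.\<close>
  have "fst (run ?y (T + 1)) = 1 \<and> fst (last (snd (run ?y (T + 1)))) i = tape_content [True] i" if i: "i < ?W" for i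
  proof -
    have v: "vertical (i = 0) (snapshot (run ?y T) i) (z (T + 1) i)" using zv[of T i] row[of T i] i by simp
    have t: "z (T + 1) i \<in> tiles" using zt[of "T + 1" i] i by simp
    show ?thesis
      using final_snapshot[OF vertical_cells[OF c(1) v t] c(2)] zf[OF i] by simp
  qed
  then show ?thesis using u(1) width_pos unfolding accepts_def by (intro exI[of _ u]) blast
qed

text \<open>After halting nothing changes, so inspecting a later time \<open>t\<close> is the same.
  Three cells suffice: the bit in cell 1 and the blank in cell 2 identify
  \<open>[True]\<close>.\<close>

lemma accepts_iff:
  assumes comp: "computes_in_time M v p" and t: "p (length y) \<le> t" and W: "W \<ge> 3"
  shows "accepts y t W \<longleftrightarrow> v y = [True]"
proof -
  let ?c = "run y (p (length y))"
  have c: "fst ?c = 1" "fst (last (snd ?c)) = tape_content (v y)"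
    using comp by (simp_all add: computes_in_time_def Let_def)
  have "run y t = (tm_step M ^^ (t - p (length y))) ?c"
    using funpow_add[of "t - p (length y)" "p (length y)" "tm_step M"] t by simp
  then have r: "run y t = ?c" by (simp add: halted_stable[OF c(1)])
  have "v y = [True]" if eq: "\<forall>i<W. tape_content (v y) i = tape_content [True] i"
  proof -
    have "tape_content (v y) 1 = 3" "tape_content (v y) 2 = 0"
      using eq[rule_format, of 1] eq[rule_format, of 2] W by (simp_all add: tape_content_def)
    then have "length (v y) = 1" "v y ! 0" by (auto simp: tape_content_def split: if_splits)
    then show ?thesis by (cases "v y") auto
  qed
  then show ?thesis unfolding accepts_def r c by auto
qed

end

text \<open>An encoded instance in the image comes from no other valid instance, since
  \<open>encode\<close> is injective on valid inputs.\<close>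

lemma encode_restricted_iff:
  assumes "valid_input (fst p)" "snd p \<ge> 0"
  shows "encode p \<in> encode ` restricted_augmentation \<longleftrightarrow> p \<in> restricted_augmentation"
proof (rule inj_on_image_mem_iff[OF inj_on_encode])
  show "p \<in> {(I, \<beta>). valid_input I \<and> \<beta> \<ge> 0}" using assms by (cases p) simp
  show "restricted_augmentation \<subseteq> {(I, \<beta>). valid_input I \<and> \<beta> \<ge> 0}"
    by (auto simp: min_cost_perfect_augmentation_def)
qed

theorem theorem6:
  shows "NP_hard (encode ` {(I, \<beta>). (I, \<beta>) \<in> min_cost_perfect_augmentation \<and>
           strict_prefs (graph_of I) \<and>
           (\<forall>a\<in>people (graph_of I). card (acceptable (graph_of I) a) \<le> 2)})"
  unfolding NP_hard_def
proof
  fix L :: "bool list set" assume "L \<in> NP"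
  then obtain v p where v: "polytime v"
    and L: "\<And>x. x \<in> L \<longleftrightarrow> (\<exists>u. length u \<le> poly p (length x) \<and> v (pair_string x u) = [True])"
    unfolding NP_def by blast
  from v obtain M q where M: "valid_tm M" "computes_in_time M v (poly q)" unfolding polytime_def by blast
  interpret machine M by standard (rule M(1))
  define A where "A n = poly p n" for n
  \<comment> \<open>The verifier's time bound at the greatest length of
    \<open>pair_string x u\<close> for \<open>length u \<le> A n\<close>; it is monotone, so it
    covers shorter certificates as well.\<close>
  define T where "T n = poly q (2 * n + 1 + A n)" for n
  define f where "f x = grid_instance (length tile_list) (width x (A (length x)) (T (length x)))
    (layout index_constraint x (A (length x)) (T (length x)))" for x
  have "polytime (\<lambda>x. encode (f x))"
    using polytime_grid_instance[of "length tile_list" p q index_constraint]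
    unfolding f_def A_def T_def width_def .
  \<comment> \<open>At least one tile exists, so \<open>g - 1\<close> in the budget is not
    truncated.\<close>
  moreover have g: "length tile_list \<ge> 1"
  proof -
    have "snapshot (tm_init M []) 0 \<in> set tile_list"
      unfolding set_tile_list by (rule snapshot_in_tiles[OF valid_config_init])
    then show ?thesis by (cases tile_list) auto
  qed
  moreover have "x \<in> L \<longleftrightarrow> encode (f x) \<in> encode ` restricted_augmentation" for x
  proof -
    let ?A = "A (length x)" and ?T = "T (length x)"
    have acc: "accepts (pair_string x u) (?T + 1) (width x ?A ?T) \<longleftrightarrow> v (pair_string x u) = [True]"
      if u: "length u \<le> ?A" for u
    proof (rule accepts_iff[OF M(2)])
      have "length (pair_string x u) \<le> 2 * length x + 1 + ?A"
        using u by (simp add: pair_string_def enc_list_def length_concat_pairs)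
      from mono_poly_nat[OF this, of q]
      show "poly q (length (pair_string x u)) \<le> ?T + 1" by (simp add: T_def)
      show "3 \<le> width x ?A ?T" by (simp add: width_def)
    qed
    have "x \<in> L \<longleftrightarrow> (\<exists>u. length u \<le> ?A \<and> accepts (pair_string x u) (?T + 1) (width x ?A ?T))"
      using L[of x] acc by (auto simp: A_def)
    also have "\<dots> \<longleftrightarrow> (\<exists>z. tableau x ?A ?T z)"
      using tableau_of_run run_of_tableau by blast
    also have "\<dots> \<longleftrightarrow> f x \<in> restricted_augmentation"
      unfolding f_def grid_instance_iff(1)[OF inside_grid_layout g] by (rule satisfies_iff_tableau[symmetric])
    also have "\<dots> \<longleftrightarrow> encode (f x) \<in> encode ` restricted_augmentation"
    proof (rule encode_restricted_iff[symmetric])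
      show "valid_input (fst (f x))" unfolding f_def by (rule grid_instance_iff(2)[OF inside_grid_layout g])
      show "snd (f x) \<ge> 0" by (simp add: f_def grid_instance_def)
    qed
    finally show ?thesis .
  qed
  ultimately show "poly_reducible L (encode ` restricted_augmentation)"
    unfolding poly_reducible_def by blast
qed

end
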